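(* Assume that $\mu$ is strictly contracting and admits a moment of order $2$. Let $s^2=\lim_{n\to+\infty}\frac1n\mathbb E[(\sigma(A_n,W_0)-n\lambda_\mu)^2]$, where $W_0$ has law $\nu$ and is independent of $(Y_n)_{n\in\mathbb N}$. Then $$s^2=\lim_{n\to+\infty}\frac1n\sup_{x\in S^+}\mathbb E\big((\sigma(A_n,x)-n\lambda_\mu)^2\big)=\lim_{n\to+\infty}\frac1n\mathbb E\big((\log\|A_n\|-n\lambda_\mu)^2\big)$$ $$=\lim_{n\to+\infty}\frac1n\mathbb E\big((\log v(A_n)-n\lambda_\mu)^2\big)=\lim_{n\to+\infty}\frac1n\mathbb E\big((\log\kappa(A_n)-n\lambda_\mu)^2\big),$$ and, with $Z_n$ denoting any of $\sigma(A_n,x)$ (for a given $x\in S^+$), $\log\|A_n\|$, $\log v(A_n)$ or $\log\kappa(A_n)$, the sequence $\frac1{\sqrt n}(Z_n-n\lambda_\mu)$ converges in distribution to $\mathcal N(0,s^2)$. Moreover, if $s>0$, $$\sup_{x\in S^+}\sup_{t\in\mathbb R}\Big|\mathbb P\big(\sigma(A_n,x)-n\lambda_\mu\le t\sqrt n\big)-\Phi(t/s)\Big|\underset{n\to+\infty}\longrightarrow 0 .$$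
   Context: Let $d\ge 2$ be an integer and $\mathbb N=\{1,2,\dots\}$. $\|\cdot\|$ denotes the $\ell^1$ norm on $\mathbb R^d$ and also the associated operator norm on $d\times d$ matrices. $G$ is the semigroup of $d\times d$ real matrices with nonnegative entries such that every row and every column contains a strictly positive entry, with the topology induced by the norm; $G^+\subset G$ is the set of matrices all of whose entries are strictly positive. $S^+=\{x\in\mathbb R^d:\|x\|=1,\ x_i\ge 0\ \forall i\}$, equipped with the metric $\mathbf d(x,y)=\varphi(m(x,y)m(y,x))$, where $\varphi(s)=\frac{1-s}{1+s}$ and $m(x,y)=\inf\{x_i/y_i: 1\le i\le d,\ y_i>0\}$; Borel sets of $S^+$ refer to $\mathbf d$. For $g\in G$: $v(g)=\inf_{x\in S^+}\|gx\|$, $N(g)=\max(\|g\|,1/v(g))$, and $\kappa(g)$ is the spectral radius of $g$. For $(g,x)\in G\times S^+$, $g\cdot x=gx/\|gx\|$ and $\sigma(g,x)=\log\|gx\|$. $\mu$ is a Borel probability measure on $G$; $\mu^{*r}$ is its $r$-fold convolution (the law of a product of $r$ independent matrices of law $\mu$). $\mu$ is strictly contracting if $\mu^{*r}(G^+)>0$ for some $r\in\mathbb N$. $\mu$ admits a moment of order $p\ge1$ if $\int_G(\log N(g))^p\,d\mu(g)<\infty$. When $\mu$ is strictly contracting there is a unique $\mu$-invariant Borel probability measure $\nu$ on $S^+$, i.e. $\int f(g\cdot x)\,d\mu(g)d\nu(x)=\int f\,d\nu$ for all nonnegative Borel $f$. $(Y_n)_{n\in\mathbb N}$ are iid with law $\mu$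 and $A_n=Y_n\cdots Y_1$. $\lambda_\mu\in\mathbb R$ is the almost sure (and $L^1$) limit of $\frac1n\log\|A_n\|$, which exists and is constant as soon as $\int_G|\log\|g\||\,d\mu(g)<\infty$. If $\mu$ is strictly contracting and admits a moment of order $2$, the limit defining $s^2$ exists in $[0,\infty)$; $s=\sqrt{s^2}$. $\Phi$ is the standard normal distribution function; $\mathcal N(0,0)$ is the Dirac mass at $0$. *)

theory Defs
  imports "HOL-Probability.Probability"
begin

definition l1_norm :: "real^'d \<Rightarrow> real" where
  "l1_norm x = (\<Sum>i\<in>UNIV. \<bar>x $ i\<bar>)"

definition l1_opnorm :: "real^'d^'d \<Rightarrow> real" where
  "l1_opnorm g = (SUP x\<in>{x. l1_norm x = 1}. l1_norm (g *v x))"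

definition G_set :: "(real^'d^'d) set" where
  "G_set = {g. (\<forall>i j. 0 \<le> g $ i $ j) \<and> (\<forall>i. \<exists>j. 0 < g $ i $ j) \<and> (\<forall>j. \<exists>i. 0 < g $ i $ j)}"

definition G_plus :: "(real^'d^'d) set" where
  "G_plus = {g \<in> G_set. \<forall>i j. 0 < g $ i $ j}"

text \<open>All norms on a finite-dimensional space are equivalent, so the subspace topology on
  \<^term>\<open>G_set\<close> is the one induced by the standard topology of matrices.\<close>

definition G_borel :: "(real^'d^'d) measure" where
  "G_borel = restrict_space borel G_set"

definition S_plus :: "(real^'d) set" where
  "S_plus = {x. l1_norm x = 1 \<and> (\<forall>i. 0 \<le> x $ i)}"

definition m_ratio :: "real^'d \<Rightarrow> real^'d \<Rightarrow> real" where
  "m_ratio x y = (INF i\<in>{i. 0 < y $ i}. x $ i / y $ i)"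

definition S_dist :: "real^'d \<Rightarrow> real^'d \<Rightarrow> real" where
  "S_dist x y = (let s = m_ratio x y * m_ratio y x in (1 - s) / (1 + s))"

text \<open>The metric \<^term>\<open>S_dist\<close> does not induce the Euclidean topology on \<^term>\<open>S_plus\<close>: points
  with different supports are at distance 1.\<close>

definition S_borel :: "(real^'d) measure" where
  "S_borel = sigma S_plus {U. openin (Metric_space.mtopology S_plus S_dist) U}"

definition v_min :: "real^'d^'d \<Rightarrow> real" where
  "v_min g = (INF x\<in>S_plus. l1_norm (g *v x))"

definition N_max :: "real^'d^'d \<Rightarrow> real" where
  "N_max g = max (l1_opnorm g) (1 / v_min g)"

definition spec_rad :: "real^'d^'d \<Rightarrow> real" where
  "spec_rad g = Max {cmod z | z. \<exists>u::complex^'d. u \<noteq> 0 \<and>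
     (\<chi> i j. complex_of_real (g $ i $ j)) *v u = z *s u}"

definition act :: "real^'d^'d \<Rightarrow> real^'d \<Rightarrow> real^'d" where
  "act g x = (1 / l1_norm (g *v x)) *\<^sub>R (g *v x)"

definition cocycle :: "real^'d^'d \<Rightarrow> real^'d \<Rightarrow> real" where
  "cocycle g x = ln (l1_norm (g *v x))"

definition mat_convolution ::
  "(real^'d^'d) measure \<Rightarrow> (real^'d^'d) measure \<Rightarrow> (real^'d^'d) measure" where
  "mat_convolution M N = distr (M \<Otimes>\<^sub>M N) G_borel (\<lambda>(g, h). g ** h)"

primrec conv_power :: "(real^'d^'d) measure \<Rightarrow> nat \<Rightarrow> (real^'d^'d) measure" where
  "conv_power M 0 = return G_borel (mat 1)"
| "conv_power M (Suc r) = mat_convolution M (conv_power M r)"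

definition strictly_contracting :: "(real^'d^'d) measure \<Rightarrow> bool" where
  "strictly_contracting \<mu> \<longleftrightarrow> (\<exists>r\<ge>1. emeasure (conv_power \<mu> r) G_plus > 0)"

definition has_moment :: "real \<Rightarrow> (real^'d^'d) measure \<Rightarrow> bool" where
  "has_moment p \<mu> \<longleftrightarrow> (\<integral>\<^sup>+ g. ennreal (ln (N_max g) powr p) \<partial>\<mu>) < \<infinity>"

definition invariant_prob :: "(real^'d^'d) measure \<Rightarrow> (real^'d) measure \<Rightarrow> bool" where
  "invariant_prob \<mu> \<nu> \<longleftrightarrow> prob_space \<nu> \<and> sets \<nu> = sets S_borel \<and>
     (\<forall>f \<in> S_borel \<rightarrow>\<^sub>M (borel :: ennreal measure).
        (\<integral>\<^sup>+ x. (\<integral>\<^sup>+ g. f (act g x) \<partial>\<mu>) \<partial>\<nu>) = (\<integral>\<^sup>+ x. f x \<partial>\<nu>))"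

text \<open>Only the factors \<^term>\<open>Y n\<close> with \<^prop>\<open>n \<ge> 1\<close> occur.\<close>

primrec rand_prod :: "(nat \<Rightarrow> 'w \<Rightarrow> real^'d^'d) \<Rightarrow> nat \<Rightarrow> 'w \<Rightarrow> real^'d^'d" where
  "rand_prod Y 0 \<omega> = mat 1"
| "rand_prod Y (Suc n) \<omega> = Y (Suc n) \<omega> ** rand_prod Y n \<omega>"

definition iid_seq :: "'w measure \<Rightarrow> (real^'d^'d) measure \<Rightarrow> (nat \<Rightarrow> 'w \<Rightarrow> real^'d^'d) \<Rightarrow> bool" where
  "iid_seq P \<mu> Y \<longleftrightarrow> prob_space.indep_vars P (\<lambda>_. G_borel) Y {1..} \<and>
     (\<forall>n\<ge>1. distr P G_borel (Y n) = \<mu>)"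

definition indep_of_seq ::
  "'w measure \<Rightarrow> ('w \<Rightarrow> real^'d) \<Rightarrow> (nat \<Rightarrow> 'w \<Rightarrow> real^'d^'d) \<Rightarrow> bool" where
  "indep_of_seq P W Y \<longleftrightarrow> prob_space.indep_set P
     (sets (vimage_algebra (space P) W S_borel))
     (sets (vimage_algebra (space P) (\<lambda>\<omega>. \<lambda>n\<in>{1..}. Y n \<omega>) (\<Pi>\<^sub>M n\<in>{1..}. G_borel)))"

text \<open>The almost sure limit is a constant determined by the common law of the \<^term>\<open>Y n\<close>.\<close>

definition lyapunov :: "'w measure \<Rightarrow> (nat \<Rightarrow> 'w \<Rightarrow> real^'d^'d) \<Rightarrow> real" where
  "lyapunov P Y =
     (THE l. AE \<omega> in P. (\<lambda>n. ln (l1_opnorm (rand_prod Y n \<omega>)) / real n) \<longlonglongrightarrow> l)"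

text \<open>Second moments are taken in \<^typ>\<open>ennreal\<close>, so that convergence to a finite limit includes
  (eventual) square-integrability and suprema of second moments need no boundedness assumption.\<close>

definition second_moment :: "'w measure \<Rightarrow> ('w \<Rightarrow> real) \<Rightarrow> ennreal" where
  "second_moment P X = (\<integral>\<^sup>+ \<omega>. ennreal ((X \<omega>)\<^sup>2) \<partial>P)"

text \<open>\<^term>\<open>normal_density 0 0\<close> is not a probability density; the variance 0 normal law is a Dirac
  mass.\<close>

definition centered_normal :: "real \<Rightarrow> real measure" where
  "centered_normal s = (if s = 0 then return borel 0 else density lborel (normal_density 0 s))"

text \<open>\<^const>\<open>weak_conv_m\<close> is convergence of the distribution functions at the continuity points
  of the limit.\<close>

definition clt_holds :: "'w measure \<Rightarrow> real \<Rightarrow> real \<Rightarrow> (nat \<Rightarrow> 'w \<Rightarrow> real) \<Rightarrow> bool" where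
  "clt_holds P l s Z \<longleftrightarrow>
     weak_conv_m (\<lambda>n. distr P borel (\<lambda>\<omega>. (Z n \<omega> - real n * l) / sqrt (real n))) (centered_normal s)"

end

theory Submission
  imports Defs
begin

text \<open>
  Write \<open>A(a,n) = Y(a+n) \<cdots> Y(a+1)\<close> and \<open>L(a,n) = log \<parallel>A(a,n)\<parallel>\<close>. For a nonnegative matrix \<open>g\<close> the
  numbers \<open>\<parallel>g\<parallel>\<close> and \<open>v(g)\<close> are the largest and the smallest column sum, and \<open>\<parallel>gx\<parallel>\<close> for \<open>x \<in> S\<^sup>+\<close>
  as well as the spectral radius \<open>\<kappa>(g)\<close> lie between them. So each of the four sequences of
  the theorem differs from \<open>L(0,n)\<close> by at most \<open>D(0,n)\<close>, where
  \<open>D(a,n) = log \<parallel>A(a,n)\<parallel> - log v(A(a,n))\<close>.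

  The probabilistic input on the matrices is that \<open>\<parallel>D(a,n)\<parallel>\<^sub>2\<close> is bounded uniformly in \<open>a\<close> and
  \<open>n\<close> (\<open>l2_log_ratio_Y_bounded\<close>). By strict contraction there are \<open>r\<close> and \<open>C\<close> such that, with
  positive probability, within each row of \<open>A(a,r)\<close> the entries are comparable up to the factor
  \<open>C\<close>. On this event \<open>D(a,r+n) \<le> log C\<close>, whatever the remaining factors are; on its complement
  \<open>D(a,r+n) \<le> D(a+r,n) + D(a,r)\<close>. As the event is independent of \<open>D(a+r,n)\<close>, the \<open>L\<^sup>2\<close> norms
  satisfy a contracting recursion.

  Since \<open>L(a,n) + L(a+n,m) - D(a+n,m) \<le> L(a,n+m) \<le> L(a,n) + L(a+n,m)\<close>, the process \<open>L\<close> is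
  additive up to an error bounded in \<open>L\<^sup>2\<close>, while its values over disjoint blocks of indices are
  independent. Such processes are treated abstractly in the locale \<open>almost_additive\<close>. If
  \<open>\<parallel>error\<parallel>\<^sub>2 \<le> K\<close>, then splitting \<open>q\<close> consecutive blocks of length \<open>m\<close> dyadically, and using the
  orthogonality of the errors that belong to disjoint groups of blocks, shows that the centred
  value over the union of the blocks differs from the sum of the \<open>q\<close> centred block values by at
  most \<open>5K(\<surd>q - 1)\<close> in \<open>L\<^sup>2\<close> (\<open>l2_block_error\<close>). After division by \<open>\<surd>n\<close> with \<open>n \<approx> qm\<close>, the
  process is thus approximated, uniformly for large \<open>n\<close>, by a normalised sum of independent
  identically distributed variables up to \<open>5K/\<surd>m\<close>. Letting first \<open>n\<close> and then \<open>m\<close> tend to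
  infinity, one gets the convergence of the variance and, by the classical central limit theorem
  and characteristic functions, the convergence in law. The means are almost additive numbers,
  hence \<open>E L(0,n) = n\<lambda> + O(1)\<close>. Finally \<open>\<lambda>\<close> is the almost sure limit of \<open>L(0,n)/n\<close>: the variance
  bound gives summability along the squares \<open>n = k\<^sup>2\<close>, and the increments between consecutive
  squares are controlled by the second moment of \<open>log N\<close>.

  The uniform statement follows because the distribution function of \<open>\<sigma>(A(0,n),x)\<close> lies, for all
  \<open>x\<close> at once, between those of \<open>log \<parallel>A(0,n)\<parallel>\<close> and \<open>log v(A(0,n))\<close>, and both converge uniformly
  to the continuous limit.
\<close>

section \<open>Nonnegative matrices and their column sums\<close>

text \<open>The sum of the entries in column \<open>j\<close>; for nonnegative matrices it equals \<open>\<parallel>g e\<^sub>j\<parallel>\<close>.\<close>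

definition col_sum :: "real^'d^'d \<Rightarrow> 'd \<Rightarrow> real" where
  "col_sum g j = (\<Sum>i\<in>UNIV. g $ i $ j)"

lemma G_set_nonneg: "g \<in> G_set \<Longrightarrow> 0 \<le> g $ i $ j"
  by (simp add: G_set_def)

lemma G_set_one: "mat 1 \<in> (G_set :: (real^'d^'d) set)"
proof -
  have "\<exists>j. 0 < (mat 1 :: real^'d^'d) $ i $ j" for i
    by (rule exI[of _ i]) (simp add: mat_def)
  moreover have "\<exists>i. 0 < (mat 1 :: real^'d^'d) $ i $ j" for j
    by (rule exI[of _ j]) (simp add: mat_def)
  ultimately show ?thesis
    by (auto simp: G_set_def mat_def)
qed

lemma G_set_mult:
  assumes g: "g \<in> G_set" and h: "h \<in> G_set"
  shows "g ** h \<in> (G_set :: (real^'d^'d) set)"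
proof -
  have nn: "0 \<le> g $ i $ k * h $ k $ j" for i j k
    using g h by (simp add: G_set_def)
  have pos: "0 < (g ** h) $ i $ j" if "0 < g $ i $ k" "0 < h $ k $ j" for i j k
  proof -
    have "0 < g $ i $ k * h $ k $ j" using that by simp
    also have "\<dots> \<le> (\<Sum>k\<in>UNIV. g $ i $ k * h $ k $ j)"
      by (rule member_le_sum) (auto intro: nn)
    finally show ?thesis by (simp add: matrix_matrix_mult_def)
  qed
  have "\<exists>j. 0 < (g ** h) $ i $ j" for i
  proof -
    obtain k where "0 < g $ i $ k" using g unfolding G_set_def by blast
    moreover obtain j where "0 < h $ k $ j" using h unfolding G_set_def by blast
    ultimately show ?thesis using pos by blast
  qed
  moreover have "\<exists>i. 0 < (g ** h) $ i $ j" for j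
  proof -
    obtain k where "0 < h $ k $ j" using h unfolding G_set_def by blast
    moreover obtain i where "0 < g $ i $ k" using g unfolding G_set_def by blast
    ultimately show ?thesis using pos by blast
  qed
  moreover have "0 \<le> (g ** h) $ i $ j" for i j
    by (simp add: matrix_matrix_mult_def sum_nonneg nn)
  ultimately show ?thesis by (simp add: G_set_def)
qed

lemma col_sum_pos: "g \<in> G_set \<Longrightarrow> 0 < col_sum g j"
  unfolding col_sum_def
  by (simp add: G_set_def) (metis UNIV_I finite_class.finite_UNIV sum_pos2)

lemma col_sum_mult: "col_sum (g ** h) j = (\<Sum>k\<in>UNIV. col_sum g k * h $ k $ j)"
  unfolding col_sum_def matrix_matrix_mult_def
  by (simp add: sum_distrib_right) (rule sum.swap)

lemma l1_norm_mult_le: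
  assumes "g \<in> G_set"
  shows "l1_norm (g *v x) \<le> (\<Sum>j\<in>UNIV. col_sum g j * \<bar>x $ j\<bar>)"
proof -
  have "l1_norm (g *v x) \<le> (\<Sum>i\<in>UNIV. \<Sum>j\<in>UNIV. g $ i $ j * \<bar>x $ j\<bar>)"
    unfolding l1_norm_def matrix_vector_mult_def
    by (auto intro!: sum_mono order_trans[OF sum_abs]
        simp: abs_mult abs_of_nonneg G_set_nonneg[OF assms])
  also have "\<dots> = (\<Sum>j\<in>UNIV. col_sum g j * \<bar>x $ j\<bar>)"
    by (subst sum.swap) (simp add: col_sum_def sum_distrib_right)
  finally show ?thesis .
qed

lemma l1_norm_mult_eq:
  assumes "g \<in> G_set" "\<And>i. 0 \<le> x $ i"
  shows "l1_norm (g *v x) = (\<Sum>j\<in>UNIV. col_sum g j * x $ j)"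
proof -
  have "l1_norm (g *v x) = (\<Sum>i\<in>UNIV. \<Sum>j\<in>UNIV. g $ i $ j * x $ j)"
    unfolding l1_norm_def matrix_vector_mult_def
    by (simp add: abs_of_nonneg sum_nonneg G_set_nonneg[OF assms(1)] assms(2))
  also have "\<dots> = (\<Sum>j\<in>UNIV. col_sum g j * x $ j)"
    by (subst sum.swap) (simp add: col_sum_def sum_distrib_right)
  finally show ?thesis .
qed

lemma axis_S_plus: "axis j 1 \<in> (S_plus :: (real^'d) set)"
proof -
  have "(\<Sum>i\<in>UNIV. \<bar>(axis j 1 :: real^'d) $ i\<bar>) = (\<Sum>i\<in>UNIV. if i = j then 1 else 0)"
    by (intro sum.cong) (auto simp: axis_def)
  then show ?thesis
    by (auto simp: S_plus_def l1_norm_def axis_def)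
qed

lemma S_plus_nonzero: "x \<in> S_plus \<Longrightarrow> x \<noteq> 0"
  by (auto simp: S_plus_def l1_norm_def)

lemma l1_norm_mult_axis:
  assumes "g \<in> G_set" shows "l1_norm (g *v axis j 1) = col_sum g j"
proof -
  have "(\<Sum>k\<in>UNIV. col_sum g k * axis j 1 $ k) = (\<Sum>k\<in>UNIV. if k = j then col_sum g k else 0)"
    by (intro sum.cong) (auto simp: axis_def)
  then show ?thesis
    using l1_norm_mult_eq[OF assms, of "axis j 1"] by (simp add: axis_def)
qed

text \<open>On the unit sphere of the norm the supremum is attained at a basis vector, so operator norm and
  \<^const>\<open>v_min\<close> are the largest and the smallest column sum.\<close>

lemma l1_opnorm_eq:
  assumes g: "g \<in> G_set"
  shows "l1_opnorm g = Max (range (col_sum g))"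
  unfolding l1_opnorm_def
proof (rule cSup_eq_maximum)
  have "Max (range (col_sum g)) \<in> range (col_sum g)" by (rule Max_in) auto
  then obtain j where j: "Max (range (col_sum g)) = col_sum g j" by blast
  show "Max (range (col_sum g)) \<in> (\<lambda>x. l1_norm (g *v x)) ` {x. l1_norm x = 1}"
    using axis_S_plus[of j] l1_norm_mult_axis[OF g, of j] unfolding j
    by (intro image_eqI[of _ _ "axis j 1"]) (auto simp: S_plus_def)
next
  fix y assume "y \<in> (\<lambda>x. l1_norm (g *v x)) ` {x. l1_norm x = 1}"
  then obtain x where x: "l1_norm x = 1" and y: "y = l1_norm (g *v x)" by auto
  have "y \<le> (\<Sum>j\<in>UNIV. col_sum g j * \<bar>x $ j\<bar>)"
    unfolding y by (rule l1_norm_mult_le[OF g])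
  also have "\<dots> \<le> (\<Sum>j\<in>UNIV. Max (range (col_sum g)) * \<bar>x $ j\<bar>)"
    by (intro sum_mono mult_right_mono) auto
  also have "\<dots> = Max (range (col_sum g))"
    using x by (simp add: sum_distrib_left[symmetric] l1_norm_def)
  finally show "y \<le> Max (range (col_sum g))" .
qed

lemma v_min_eq:
  assumes g: "g \<in> G_set"
  shows "v_min g = Min (range (col_sum g))"
  unfolding v_min_def
proof (rule cInf_eq_minimum)
  have "Min (range (col_sum g)) \<in> range (col_sum g)" by (rule Min_in) auto
  then obtain j where j: "Min (range (col_sum g)) = col_sum g j" by blast
  show "Min (range (col_sum g)) \<in> (\<lambda>x. l1_norm (g *v x)) ` S_plus"
    using axis_S_plus[of j] l1_norm_mult_axis[OF g, of j] unfolding j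
    by (intro image_eqI[of _ _ "axis j 1"]) auto
next
  fix y assume "y \<in> (\<lambda>x. l1_norm (g *v x)) ` S_plus"
  then obtain x where x: "x \<in> S_plus" and y: "y = l1_norm (g *v x)" by auto
  have nn: "0 \<le> x $ i" for i using x by (simp add: S_plus_def)
  have "Min (range (col_sum g)) = (\<Sum>j\<in>UNIV. Min (range (col_sum g)) * x $ j)"
    using x nn by (simp add: sum_distrib_left[symmetric] l1_norm_def S_plus_def)
  also have "\<dots> \<le> (\<Sum>j\<in>UNIV. col_sum g j * x $ j)"
    by (intro sum_mono mult_right_mono nn) auto
  also have "\<dots> = y" unfolding y using l1_norm_mult_eq[OF g nn] by simp
  finally show "Min (range (col_sum g)) \<le> y" .
qed

lemma col_sum_le_l1_opnorm: "g \<in> G_set \<Longrightarrow> col_sum g j \<le> l1_opnorm g"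
  by (simp add: l1_opnorm_eq)

lemma v_min_le_col_sum: "g \<in> G_set \<Longrightarrow> v_min g \<le> col_sum g j"
  by (simp add: v_min_eq)

lemma l1_opnorm_attained: "g \<in> G_set \<Longrightarrow> \<exists>j. l1_opnorm g = col_sum g j"
proof -
  assume g: "g \<in> G_set"
  have "Max (range (col_sum g)) \<in> range (col_sum g)" by (rule Max_in) auto
  then show ?thesis unfolding l1_opnorm_eq[OF g] by blast
qed

lemma v_min_attained: "g \<in> G_set \<Longrightarrow> \<exists>j. v_min g = col_sum g j"
proof -
  assume g: "g \<in> G_set"
  have "Min (range (col_sum g)) \<in> range (col_sum g)" by (rule Min_in) auto
  then show ?thesis unfolding v_min_eq[OF g] by blast
qed

lemma v_min_pos: "g \<in> G_set \<Longrightarrow> 0 < v_min g"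
  using v_min_attained col_sum_pos by metis

lemma v_min_le_l1_opnorm: "g \<in> G_set \<Longrightarrow> v_min g \<le> l1_opnorm g"
  using v_min_le_col_sum col_sum_le_l1_opnorm order_trans by blast

lemma l1_opnorm_pos: "g \<in> G_set \<Longrightarrow> 0 < l1_opnorm g"
  using v_min_pos v_min_le_l1_opnorm by fastforce

lemma S_plus_orbit_bounds:
  assumes g: "g \<in> G_set" and x: "x \<in> S_plus"
  shows "v_min g \<le> l1_norm (g *v x)" "l1_norm (g *v x) \<le> l1_opnorm g"
proof -
  have nn: "0 \<le> x $ i" for i using x by (simp add: S_plus_def)
  have sum1: "(\<Sum>j\<in>UNIV. x $ j) = 1"
    using x nn by (simp add: l1_norm_def S_plus_def)
  have eq: "l1_norm (g *v x) = (\<Sum>j\<in>UNIV. col_sum g j * x $ j)"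
    by (rule l1_norm_mult_eq[OF g nn])
  have "v_min g = (\<Sum>j\<in>UNIV. v_min g * x $ j)"
    by (simp add: sum_distrib_left[symmetric] sum1)
  also have "\<dots> \<le> l1_norm (g *v x)" unfolding eq
    by (intro sum_mono mult_right_mono nn v_min_le_col_sum g)
  finally show "v_min g \<le> l1_norm (g *v x)" .
  have "l1_norm (g *v x) \<le> (\<Sum>j\<in>UNIV. l1_opnorm g * x $ j)" unfolding eq
    by (intro sum_mono mult_right_mono nn col_sum_le_l1_opnorm g)
  also have "\<dots> = l1_opnorm g"
    by (simp add: sum_distrib_left[symmetric] sum1)
  finally show "l1_norm (g *v x) \<le> l1_opnorm g" .
qed

lemma col_sum_mult_bounds:
  assumes g: "g \<in> G_set" and h: "h \<in> G_set"
  shows "v_min g * col_sum h j \<le> col_sum (g ** h) j"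
    and "col_sum (g ** h) j \<le> l1_opnorm g * col_sum h j"
proof -
  have "v_min g * col_sum h j = (\<Sum>k\<in>UNIV. v_min g * h $ k $ j)"
    by (simp add: col_sum_def sum_distrib_left)
  also have "\<dots> \<le> col_sum (g ** h) j" unfolding col_sum_mult
    by (intro sum_mono mult_right_mono v_min_le_col_sum G_set_nonneg g h)
  finally show "v_min g * col_sum h j \<le> col_sum (g ** h) j" .
  have "col_sum (g ** h) j \<le> (\<Sum>k\<in>UNIV. l1_opnorm g * h $ k $ j)" unfolding col_sum_mult
    by (intro sum_mono mult_right_mono col_sum_le_l1_opnorm G_set_nonneg g h)
  also have "\<dots> = l1_opnorm g * col_sum h j"
    by (simp add: col_sum_def sum_distrib_left)
  finally show "col_sum (g ** h) j \<le> l1_opnorm g * col_sum h j" .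
qed

lemma l1_opnorm_mult_le:
  assumes g: "g \<in> G_set" and h: "h \<in> G_set"
  shows "l1_opnorm (g ** h) \<le> l1_opnorm g * l1_opnorm h"
proof -
  obtain j where "l1_opnorm (g ** h) = col_sum (g ** h) j"
    using l1_opnorm_attained[OF G_set_mult[OF g h]] by auto
  also have "\<dots> \<le> l1_opnorm g * col_sum h j"
    by (rule col_sum_mult_bounds[OF g h])
  also have "\<dots> \<le> l1_opnorm g * l1_opnorm h"
    using col_sum_le_l1_opnorm[OF h] l1_opnorm_pos[OF g] by (simp add: mult_left_mono)
  finally show ?thesis .
qed

lemma l1_opnorm_mult_ge:
  assumes g: "g \<in> G_set" and h: "h \<in> G_set"
  shows "v_min g * l1_opnorm h \<le> l1_opnorm (g ** h)"
  using l1_opnorm_attained[OF h] col_sum_mult_bounds(1)[OF g h]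
    col_sum_le_l1_opnorm[OF G_set_mult[OF g h]] by (metis order_trans)

lemma v_min_mult_ge:
  assumes g: "g \<in> G_set" and h: "h \<in> G_set"
  shows "v_min g * v_min h \<le> v_min (g ** h)"
proof -
  obtain j where "v_min (g ** h) = col_sum (g ** h) j"
    using v_min_attained[OF G_set_mult[OF g h]] by auto
  moreover have "v_min g * v_min h \<le> v_min g * col_sum h j"
    using v_min_le_col_sum[OF h] v_min_pos[OF g] by (simp add: mult_left_mono)
  ultimately show ?thesis
    using col_sum_mult_bounds(1)[OF g h, of j] by linarith
qed

text \<open>The logarithm of the ratio of the largest and the smallest column sum. It bounds the distance
  between any two of the functionals of \<open>g\<close> that the theorem compares.\<close>

definition log_ratio :: "real^'d^'d \<Rightarrow> real" where
  "log_ratio g = ln (l1_opnorm g) - ln (v_min g)"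

lemma log_ratio_nonneg: "g \<in> G_set \<Longrightarrow> 0 \<le> log_ratio g"
  using ln_mono[OF v_min_le_l1_opnorm v_min_pos] by (simp add: log_ratio_def)

lemma ln_l1_opnorm_mult_bounds:
  assumes g: "g \<in> G_set" and h: "h \<in> G_set"
  shows "ln (l1_opnorm (g ** h)) \<le> ln (l1_opnorm g) + ln (l1_opnorm h)"
    and "ln (v_min g) + ln (l1_opnorm h) \<le> ln (l1_opnorm (g ** h))"
    and "ln (v_min g) + ln (v_min h) \<le> ln (v_min (g ** h))"
proof -
  note p = l1_opnorm_pos[OF g] l1_opnorm_pos[OF h] v_min_pos[OF g] v_min_pos[OF h]
  have "ln (l1_opnorm (g ** h)) \<le> ln (l1_opnorm g * l1_opnorm h)"
    using l1_opnorm_mult_le[OF g h] l1_opnorm_pos[OF G_set_mult[OF g h]] by (rule ln_mono)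
  then show "ln (l1_opnorm (g ** h)) \<le> ln (l1_opnorm g) + ln (l1_opnorm h)"
    using p by (simp add: ln_mult_pos)
  have "ln (v_min g * l1_opnorm h) \<le> ln (l1_opnorm (g ** h))"
    using l1_opnorm_mult_ge[OF g h] p by (intro ln_mono) auto
  then show "ln (v_min g) + ln (l1_opnorm h) \<le> ln (l1_opnorm (g ** h))"
    using p by (simp add: ln_mult_pos)
  have "ln (v_min g * v_min h) \<le> ln (v_min (g ** h))"
    using v_min_mult_ge[OF g h] p by (intro ln_mono) auto
  then show "ln (v_min g) + ln (v_min h) \<le> ln (v_min (g ** h))"
    using p by (simp add: ln_mult_pos)
qed

lemma log_ratio_mult_le:
  assumes "g \<in> G_set" "h \<in> G_set"
  shows "log_ratio (g ** h) \<le> log_ratio g + log_ratio h"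
  using ln_l1_opnorm_mult_bounds[OF assms] by (simp add: log_ratio_def)

text \<open>Matrices in which any two entries of the same row are comparable up to the factor \<open>C\<close>. As every
  row contains a positive entry, such a matrix has only positive entries when \<open>C > 0\<close>.\<close>

definition row_balanced :: "real \<Rightarrow> (real^'d^'d) set" where
  "row_balanced C = {g \<in> G_set. \<forall>i j k. g $ i $ j \<le> C * g $ i $ k}"

text \<open>The column sums of \<open>g ** h\<close> are nonnegative combinations, with the column sums of \<open>g\<close> as weights,
  of the entries of \<open>h\<close> in the respective column; so the bound does not involve \<open>g\<close>.\<close>

lemma log_ratio_mult_balanced:
  assumes g: "g \<in> G_set" and h: "h \<in> row_balanced C" and C: "0 < C"
  shows "log_ratio (g ** h) \<le> ln C"
proof -
  have hG: "h \<in> G_set" and hb: "\<And>i j k. h $ i $ j \<le> C * h $ i $ k"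
    using h by (auto simp: row_balanced_def)
  have gh: "g ** h \<in> G_set" by (rule G_set_mult[OF g hG])
  obtain j where j: "l1_opnorm (g ** h) = col_sum (g ** h) j"
    using l1_opnorm_attained[OF gh] by auto
  obtain k where k: "v_min (g ** h) = col_sum (g ** h) k"
    using v_min_attained[OF gh] by auto
  have "l1_opnorm (g ** h) \<le> (\<Sum>i\<in>UNIV. col_sum g i * (C * h $ i $ k))"
    unfolding j col_sum_mult
    by (intro sum_mono mult_left_mono hb less_imp_le[OF col_sum_pos[OF g]])
  also have "\<dots> = C * v_min (g ** h)"
    unfolding k col_sum_mult by (simp add: sum_distrib_left ac_simps)
  finally have "ln (l1_opnorm (g ** h)) \<le> ln (C * v_min (g ** h))"
    using l1_opnorm_pos[OF gh] by simp
  also have "\<dots> = ln C + ln (v_min (g ** h))"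
    using C v_min_pos[OF gh] by (simp add: ln_mult)
  finally show ?thesis by (simp add: log_ratio_def)
qed

lemma G_plus_subset_row_balanced: "G_plus \<subseteq> (\<Union>n. row_balanced (real (Suc n)))"
proof
  fix g :: "real^'d^'d" assume "g \<in> G_plus"
  then have g: "g \<in> G_set" and pos: "\<And>i j. 0 < g $ i $ j" by (auto simp: G_plus_def)
  define C where "C = Max (range (\<lambda>(i,j,k). g $ i $ j / g $ i $ k))"
  obtain n where n: "C < real n" using reals_Archimedean2 by blast
  have "g $ i $ j \<le> real (Suc n) * g $ i $ k" for i j k
  proof -
    have "g $ i $ j / g $ i $ k \<le> C" unfolding C_def
      by (rule Max_ge) (auto intro!: image_eqI[of _ _ "(i,j,k)"])
    then have "g $ i $ j / g $ i $ k \<le> real (Suc n)" using n by simp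
    then show ?thesis using pos[of i k] by (simp add: field_simps)
  qed
  then show "g \<in> (\<Union>n. row_balanced (real (Suc n)))"
    using g by (auto simp: row_balanced_def simp del: of_nat_Suc)
qed

lemma ln_N_max_bounds:
  assumes g: "g \<in> G_set"
  shows "0 \<le> ln (N_max g)" "\<bar>ln (l1_opnorm g)\<bar> \<le> ln (N_max g)" "\<bar>ln (v_min g)\<bar> \<le> ln (N_max g)"
proof -
  note p = v_min_pos[OF g] l1_opnorm_pos[OF g] v_min_le_l1_opnorm[OF g]
  have a: "l1_opnorm g \<le> N_max g" "1 / v_min g \<le> N_max g" by (auto simp: N_max_def)
  then have b: "ln (l1_opnorm g) \<le> ln (N_max g)" using p by simp
  have "ln (1 / v_min g) \<le> ln (N_max g)"
    using a p by (intro ln_mono) auto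
  then have c: "- ln (v_min g) \<le> ln (N_max g)" using p by (simp add: ln_div)
  have d: "ln (v_min g) \<le> ln (l1_opnorm g)" using p by simp
  show "0 \<le> ln (N_max g)" "\<bar>ln (l1_opnorm g)\<bar> \<le> ln (N_max g)" "\<bar>ln (v_min g)\<bar> \<le> ln (N_max g)"
    using b c d by linarith+
qed

section \<open>Measurability of matrix functionals\<close>

lemma space_G_borel: "space G_borel = G_set"
  by (simp add: G_borel_def space_restrict_space)

lemma measurable_G_borel_nth [measurable]: "(\<lambda>g. g $ i $ j) \<in> borel_measurable G_borel"
  unfolding G_borel_def
  by (intro measurable_restrict_space1 borel_measurable_continuous_onI continuous_intros)

text \<open>A matrix-valued map is measurable as soon as its entries are.\<close>

lemma measurable_into_G_borel:
  fixes f :: "'a \<Rightarrow> real^'d^'d"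
  assumes "\<And>i j. (\<lambda>x. f x $ i $ j) \<in> borel_measurable M" "\<And>x. x \<in> space M \<Longrightarrow> f x \<in> G_set"
  shows "f \<in> M \<rightarrow>\<^sub>M G_borel"
proof -
  have "f \<in> borel_measurable M"
  proof (rule borel_measurable_euclidean_space[THEN iffD2], rule ballI)
    fix b :: "real^'d^'d" assume "b \<in> Basis"
    then obtain i j where "b = axis i (axis j 1)"
      by (auto simp: Basis_vec_def)
    then show "(\<lambda>x. f x \<bullet> b) \<in> borel_measurable M"
      using assms(1) by (simp add: inner_axis)
  qed
  then show ?thesis
    unfolding G_borel_def using assms(2) by (intro measurable_restrict_space2) auto
qed

lemma measurable_G_mult [measurable]:
  "(\<lambda>(g, h). g ** h) \<in> G_borel \<Otimes>\<^sub>M G_borel \<rightarrow>\<^sub>M (G_borel :: (real^'d^'d) measure)"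
proof (rule measurable_into_G_borel)
  fix i j :: 'd
  show "(\<lambda>p. (case p of (g, h) \<Rightarrow> g ** h) $ i $ j) \<in> borel_measurable (G_borel \<Otimes>\<^sub>M G_borel)"
    by (simp add: split_beta matrix_matrix_mult_def)
next
  fix p :: "(real^'d^'d) \<times> (real^'d^'d)" assume "p \<in> space (G_borel \<Otimes>\<^sub>M G_borel)"
  then show "(case p of (g, h) \<Rightarrow> g ** h) \<in> G_set"
    by (auto simp: space_pair_measure space_G_borel intro: G_set_mult)
qed

lemma measurable_G_col_sum [measurable]: "(\<lambda>g. col_sum g j) \<in> borel_measurable G_borel"
  unfolding col_sum_def by measurable

lemma measurable_l1_opnorm [measurable]: "l1_opnorm \<in> borel_measurable G_borel"
proof -
  have "(\<lambda>g. Max ((\<lambda>j. col_sum g j) ` UNIV)) \<in> borel_measurable G_borel"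
    by (intro borel_measurable_Max) auto
  then show ?thesis
    by (rule measurable_cong[THEN iffD1, rotated]) (simp add: l1_opnorm_eq space_G_borel)
qed

lemma measurable_v_min [measurable]: "v_min \<in> borel_measurable G_borel"
proof -
  have "(\<lambda>g. Min ((\<lambda>j. col_sum g j) ` UNIV)) \<in> borel_measurable G_borel"
    by (intro borel_measurable_Min) auto
  then show ?thesis
    by (rule measurable_cong[THEN iffD1, rotated]) (simp add: v_min_eq space_G_borel)
qed

lemma measurable_N_max [measurable]: "N_max \<in> borel_measurable G_borel"
  unfolding N_max_def[abs_def] by measurable

lemma measurable_log_ratio [measurable]: "log_ratio \<in> borel_measurable G_borel"
  unfolding log_ratio_def[abs_def] by measurable

lemma measurable_cocycle [measurable]: "(\<lambda>g. cocycle g x) \<in> borel_measurable G_borel"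
proof -
  have "(\<lambda>g. ln (\<Sum>i\<in>UNIV. \<bar>\<Sum>j\<in>UNIV. g $ i $ j * x $ j\<bar>)) \<in> borel_measurable G_borel"
    by measurable
  then show ?thesis
    by (simp add: cocycle_def l1_norm_def matrix_vector_mult_def)
qed

lemma row_balanced_sets: "row_balanced C \<in> sets G_borel"
proof -
  have "row_balanced C = {g \<in> space G_borel. \<forall>i j k. g $ i $ j \<le> C * g $ i $ k}"
    by (auto simp: row_balanced_def space_G_borel)
  also have "\<dots> \<in> sets G_borel" by measurable
  finally show ?thesis .
qed


section \<open>The spectral radius of a nonnegative matrix\<close>

text \<open>The real matrix \<open>g\<close> regarded as a complex one.\<close>

abbreviation complex_matrix :: "real^'d^'d \<Rightarrow> complex^'d^'d" where
  "complex_matrix g \<equiv> (\<chi> i j. complex_of_real (g $ i $ j))"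

text \<open>The complex spectrum of a real matrix.\<close>

definition eigenvalues :: "real^'d^'d \<Rightarrow> complex set" where
  "eigenvalues g = {z. \<exists>u::complex^'d. u \<noteq> 0 \<and> complex_matrix g *v u = z *s u}"

lemma spec_rad_eq_Max: "spec_rad g = Max (cmod ` eigenvalues g)"
  unfolding spec_rad_def eigenvalues_def by (rule arg_cong[of _ _ Max]) auto

lemma eigenvalue_le_l1_opnorm:
  fixes g :: "real^'d^'d"
  assumes g: "g \<in> G_set" and z: "z \<in> eigenvalues g"
  shows "cmod z \<le> l1_opnorm g"
proof -
  obtain u where u: "u \<noteq> 0" and eq: "complex_matrix g *v u = z *s u"
    using z by (auto simp: eigenvalues_def)
  define w :: "real^'d" where "w = (\<chi> i. cmod (u $ i))"
  have "cmod z * l1_norm w = (\<Sum>i\<in>UNIV. cmod ((complex_matrix g *v u) $ i))"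
    unfolding eq by (simp add: l1_norm_def w_def norm_mult sum_distrib_left)
  also have "\<dots> \<le> (\<Sum>i\<in>UNIV. \<Sum>j\<in>UNIV. g $ i $ j * cmod (u $ j))"
    unfolding matrix_vector_mult_def
    by (auto intro!: sum_mono order_trans[OF norm_sum]
        simp: norm_mult abs_of_nonneg G_set_nonneg[OF g])
  also have "\<dots> = (\<Sum>j\<in>UNIV. col_sum g j * cmod (u $ j))"
    by (subst sum.swap) (simp add: col_sum_def sum_distrib_right)
  also have "\<dots> \<le> (\<Sum>j\<in>UNIV. l1_opnorm g * cmod (u $ j))"
    by (intro sum_mono mult_right_mono col_sum_le_l1_opnorm g) simp
  also have "\<dots> = l1_opnorm g * l1_norm w"
    by (simp add: l1_norm_def w_def sum_distrib_left)
  finally have le: "cmod z * l1_norm w \<le> l1_opnorm g * l1_norm w" .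
  obtain i where "u $ i \<noteq> 0" using u by (auto simp: vec_eq_iff)
  then have "0 < l1_norm w"
    unfolding l1_norm_def by (intro sum_pos2[of _ i]) (auto simp: w_def)
  with le show ?thesis by simp
qed

text \<open>The characteristic polynomial, obtained by replacing each entry of \<open>mat z - A\<close> in the Leibniz
  formula by the corresponding polynomial in \<open>z\<close> of degree at most one.\<close>

lemma det_char_matrix_polynomial:
  fixes A :: "'a::comm_ring_1^'n^'n"
  shows "\<exists>p. \<forall>z. det (mat z - A) = poly p z"
proof
  have *: "poly (if i = j then [:- A $ i $ j, 1:] else [:- A $ i $ j:]) z =
      (if i = j then z else 0) - A $ i $ j" for i j z
    by simp
  show "\<forall>z. det (mat z - A) = poly (\<Sum>\<pi> | \<pi> permutes UNIV. of_int (sign \<pi>) *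
          (\<Prod>i\<in>UNIV. if i = \<pi> i then [:- A $ i $ \<pi> i, 1:] else [:- A $ i $ \<pi> i:])) z"
    by (simp add: det_def poly_sum poly_prod mat_def *)
qed

text \<open>The maximum defining \<^const>\<open>spec_rad\<close> is meaningful only for a finite set: the eigenvalues are
  the zeros of the characteristic polynomial, which is not the zero polynomial because eigenvalues
  are bounded by the operator norm.\<close>

lemma finite_eigenvalues:
  fixes g :: "real^'d^'d"
  assumes g: "g \<in> G_set"
  shows "finite (eigenvalues g)"
proof -
  let ?A = "complex_matrix g"
  obtain p where p: "\<And>z. det (mat z - ?A) = poly p z"
    using det_char_matrix_polynomial[of ?A] by blast
  have "(mat z :: complex^'d^'d) *v u = z *s u" for z u
    by (simp add: vec_eq_iff matrix_vector_mult_def mat_def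
        if_distrib[of "\<lambda>x. x * _"] sum.delta cong: if_cong)
  then have mv: "(mat z - ?A) *v u = z *s u - ?A *v u" for z u
    by (metis matrix_vector_mult_diff_rdistrib)
  have root: "det (mat z - ?A) = 0 \<longleftrightarrow> z \<in> eigenvalues g" for z
    using matrix_left_invertible_ker[of "mat z - ?A"] invertible_left_inverse[of "mat z - ?A"]
      invertible_det_nz[of "mat z - ?A"] by (auto simp: mv eigenvalues_def)
  \<comment> \<open>A number of modulus larger than the operator norm is not a zero.\<close>
  have "p \<noteq> 0"
  proof
    assume "p = 0"
    then have "complex_of_real (l1_opnorm g + 1) \<in> eigenvalues g"
      using root[of "complex_of_real (l1_opnorm g + 1)"] by (simp add: p)
    then have "cmod (complex_of_real (l1_opnorm g + 1)) \<le> l1_opnorm g"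
      by (rule eigenvalue_le_l1_opnorm[OF g])
    then show False using l1_opnorm_pos[OF g] by (simp only: norm_of_real)
  qed
  then show ?thesis
    using poly_roots_finite[of p] by (simp add: p[symmetric] root)
qed

text \<open>Brouwer's fixed point theorem, applied to the action of \<open>g\<close> on the simplex.\<close>

lemma perron_eigenvector:
  fixes g :: "real^'d^'d"
  assumes g: "g \<in> G_set"
  shows "\<exists>x\<in>S_plus. g *v x = l1_norm (g *v x) *\<^sub>R x"
proof -
  have S: "S_plus = {x :: real^'d. (\<Sum>i\<in>UNIV. x $ i) = 1} \<inter> (\<Inter>i. {x. 0 \<le> x $ i})"
    by (auto simp: S_plus_def l1_norm_def)
  have "closed (S_plus :: (real^'d) set)"
    unfolding S by (intro closed_Int closed_INT ballI closed_Collect_eq closed_Collect_le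
        continuous_intros)
  moreover have "bounded (S_plus :: (real^'d) set)"
  proof (rule boundedI)
    fix x :: "real^'d" assume "x \<in> S_plus"
    then have "(\<Sum>i\<in>UNIV. \<bar>x $ i\<bar>) = 1" unfolding S_plus_def l1_norm_def by blast
    then show "norm x \<le> 1" using norm_le_l1_cart[of x] by linarith
  qed
  ultimately have comp: "compact (S_plus :: (real^'d) set)"
    by (simp add: compact_eq_bounded_closed)
  have conv: "convex (S_plus :: (real^'d) set)"
    unfolding S by (auto simp: convex_def sum.distrib sum_distrib_left[symmetric])
  have pos: "0 < l1_norm (g *v x)" if "x \<in> S_plus" for x :: "real^'d"
    using S_plus_orbit_bounds(1)[OF g that] v_min_pos[OF g] by simp
  have cont: "continuous_on S_plus (act g)"
  proof -
    have "l1_norm (g *v x) \<noteq> 0" if "x \<in> S_plus" for x :: "real^'d" using pos[OF that] by simp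
    moreover have "continuous_on S_plus (\<lambda>x :: real^'d. l1_norm (g *v x))"
      unfolding l1_norm_def matrix_vector_mult_def by (simp, intro continuous_intros)
    ultimately show ?thesis
      unfolding act_def[abs_def] by (intro continuous_intros) auto
  qed
  have maps: "act g \<in> S_plus \<rightarrow> S_plus"
  proof
    fix x :: "real^'d" assume x: "x \<in> S_plus"
    have "0 \<le> (g *v x) $ i" for i
      using x by (simp add: matrix_vector_mult_def S_plus_def sum_nonneg G_set_nonneg[OF g])
    then show "act g x \<in> S_plus"
      using pos[OF x]
      by (simp add: S_plus_def act_def l1_norm_def abs_mult sum_distrib_left[symmetric] sum_nonneg
          sum_divide_distrib[symmetric])
  qed
  obtain x where x: "x \<in> S_plus" and fix_eq: "act g x = x"
    using brouwer[OF comp conv _ cont maps] axis_S_plus by blast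
  have "g *v x = l1_norm (g *v x) *\<^sub>R act g x"
    using pos[OF x] by (simp add: act_def)
  then show ?thesis using x fix_eq by auto
qed

lemma perron_eigenvalue:
  fixes g :: "real^'d^'d"
  assumes g: "g \<in> G_set"
  shows "\<exists>x\<in>S_plus. complex_of_real (l1_norm (g *v x)) \<in> eigenvalues g"
proof -
  obtain x where x: "x \<in> S_plus" and ev: "g *v x = l1_norm (g *v x) *\<^sub>R x"
    using perron_eigenvector[OF g] by blast
  let ?u = "\<chi> i. complex_of_real (x $ i)"
  have "?u \<noteq> 0"
    using S_plus_nonzero[OF x] by (auto simp: vec_eq_iff)
  moreover have "complex_matrix g *v ?u = (\<chi> i. complex_of_real ((g *v x) $ i))"
    by (simp add: vec_eq_iff matrix_vector_mult_def)
  then have "complex_matrix g *v ?u = complex_of_real (l1_norm (g *v x)) *s ?u"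
    by (subst (asm) ev) (simp add: vec_eq_iff)
  ultimately show ?thesis using x unfolding eigenvalues_def by blast
qed

lemma spec_rad_bounds:
  fixes g :: "real^'d^'d"
  assumes g: "g \<in> G_set"
  shows "v_min g \<le> spec_rad g" "spec_rad g \<le> l1_opnorm g"
proof -
  have fin: "finite (cmod ` eigenvalues g)" using finite_eigenvalues[OF g] by simp
  obtain x where x: "x \<in> S_plus" and mem: "complex_of_real (l1_norm (g *v x)) \<in> eigenvalues g"
    using perron_eigenvalue[OF g] by blast
  have "v_min g \<le> l1_norm (g *v x)" by (rule S_plus_orbit_bounds[OF g x])
  also have "\<dots> \<le> cmod (complex_of_real (l1_norm (g *v x)))" by (simp only: norm_of_real abs_ge_self)
  also have "\<dots> \<le> spec_rad g"
    unfolding spec_rad_eq_Max using fin imageI[OF mem, of cmod] by (intro Max_ge)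
  finally show "v_min g \<le> spec_rad g" .
  have "Max (cmod ` eigenvalues g) \<in> cmod ` eigenvalues g"
    using fin mem by (intro Max_in; blast)
  then show "spec_rad g \<le> l1_opnorm g"
    unfolding spec_rad_eq_Max using eigenvalue_le_l1_opnorm[OF g] by auto
qed

text \<open>Normalising the eigenvectors expresses the superlevel sets of the spectral radius through a
  compactness argument in \<open>measurable_spec_rad\<close>.\<close>

lemma le_spec_rad_iff:
  fixes g :: "real^'d^'d"
  assumes g: "g \<in> G_set"
  shows "c \<le> spec_rad g \<longleftrightarrow>
    (\<exists>z. \<exists>u::complex^'d. norm u = 1 \<and> c \<le> cmod z \<and> complex_matrix g *v u = z *s u)"
proof -
  have "finite (eigenvalues g)" "eigenvalues g \<noteq> {}"
    using finite_eigenvalues[OF g] perron_eigenvalue[OF g] by blast+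
  then have "c \<le> spec_rad g \<longleftrightarrow> (\<exists>z\<in>eigenvalues g. c \<le> cmod z)"
    unfolding spec_rad_eq_Max by (subst Max_ge_iff) auto
  also have "\<dots> \<longleftrightarrow>
    (\<exists>z. \<exists>u::complex^'d. norm u = 1 \<and> c \<le> cmod z \<and> complex_matrix g *v u = z *s u)"
  proof
    assume "\<exists>z\<in>eigenvalues g. c \<le> cmod z"
    then obtain z and u :: "complex^'d"
      where *: "c \<le> cmod z" "u \<noteq> 0" "complex_matrix g *v u = z *s u"
      by (auto simp: eigenvalues_def)
    define w where "w = complex_of_real (inverse (norm u)) *s u"
    have w: "w = inverse (norm u) *\<^sub>R u"
      unfolding w_def
      by (simp add: vec_eq_iff scaleR_conv_of_real[where 'a = complex])
    have "norm w = 1" unfolding w using \<open>u \<noteq> 0\<close> by simp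
    moreover have "complex_matrix g *v w = z *s w"
      using *(3) unfolding w_def
      by (simp add: vector_scalar_commute mult.commute)
    ultimately show "\<exists>z. \<exists>u::complex^'d. norm u = 1 \<and> c \<le> cmod z \<and> complex_matrix g *v u = z *s u"
      using *(1) by blast
  next
    assume "\<exists>z. \<exists>u::complex^'d. norm u = 1 \<and> c \<le> cmod z \<and> complex_matrix g *v u = z *s u"
    then obtain z and u :: "complex^'d"
      where "norm u = 1" "c \<le> cmod z" "complex_matrix g *v u = z *s u" by blast
    moreover from \<open>norm u = 1\<close> have "u \<noteq> 0" by auto
    ultimately show "\<exists>z\<in>eigenvalues g. c \<le> cmod z" unfolding eigenvalues_def by blast
  qed
  finally show ?thesis .
qed

text \<open>The matrices that have a unit eigenvector for an eigenvalue \<open>z\<close> with \<open>c \<le> |z| \<le> n\<close> form a closed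
  set, namely a projection of a closed set along a compact factor. Hence the superlevel sets of
  the spectral radius are countable unions of closed sets.\<close>

lemma measurable_spec_rad [measurable]:
  "spec_rad \<in> borel_measurable (G_borel :: (real^'d^'d) measure)"
proof (rule borel_measurable_iff_ge[THEN iffD2], rule allI)
  fix c :: real
  define T :: "nat \<Rightarrow> ((complex \<times> (complex^'d)) \<times> (real^'d^'d)) set" where
    "T n = {p. c \<le> cmod (fst (fst p)) \<and>
      complex_matrix (snd p) *v snd (fst p) = fst (fst p) *s snd (fst p)}" for n
  define C :: "nat \<Rightarrow> (real^'d^'d) set" where
    "C n = {g. \<exists>q. q \<in> cball 0 (real n) \<times> sphere 0 1 \<and> (q, g) \<in> T n}" for n
  have "closed (T n)" for n
  proof -
    have "T n = {p. c \<le> cmod (fst (fst p))} \<inter> (\<Inter>i. {p.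
        (\<Sum>j\<in>UNIV. complex_of_real (snd p $ i $ j) * snd (fst p) $ j) = fst (fst p) * snd (fst p) $ i})"
      by (auto simp: T_def vec_eq_iff matrix_vector_mult_def)
    then show ?thesis
      by (auto intro!: closed_Int closed_INT closed_Collect_le closed_Collect_eq continuous_intros)
  qed
  then have "closed (C n)" for n
    unfolding C_def by (intro closed_compact_projection compact_Times compact_cball compact_sphere)
  then have "(\<Union>n. C n) \<in> sets borel" by auto
  moreover have "{g \<in> G_set. c \<le> spec_rad g} = (\<Union>n. C n) \<inter> G_set"
  proof (intro equalityI subsetI)
    fix g :: "real^'d^'d" assume "g \<in> {g \<in> G_set. c \<le> spec_rad g}"
    then obtain z and u :: "complex^'d" where g: "g \<in> G_set" and
      zu: "norm u = 1" "c \<le> cmod z" "complex_matrix g *v u = z *s u"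
      using le_spec_rad_iff by blast
    obtain n where "cmod z \<le> real n" using real_arch_simple by blast
    then have "g \<in> C n"
      unfolding C_def T_def using zu by (auto intro!: exI[of _ z] exI[of _ u])
    then show "g \<in> (\<Union>n. C n) \<inter> G_set" using g by blast
  next
    fix g assume "g \<in> (\<Union>n. C n) \<inter> G_set"
    then show "g \<in> {g \<in> G_set. c \<le> spec_rad g}"
      using le_spec_rad_iff[of g c] by (auto simp: C_def T_def)
  qed
  ultimately have "{g \<in> G_set. c \<le> spec_rad g} \<in> (\<lambda>A. G_set \<inter> A) ` sets (borel :: (real^'d^'d) measure)"
    by auto
  then show "{g \<in> space (G_borel :: (real^'d^'d) measure). c \<le> spec_rad g} \<in> sets G_borel"
    unfolding space_G_borel unfolding G_borel_def sets_restrict_space .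
qed

section \<open>Square-integrable random variables\<close>

text \<open>Square-integrable real functions and the \<open>L\<^sup>2\<close> seminorm. Values of \<open>l2\<close> are meaningful only
  under \<open>sq_int\<close>.\<close>

definition sq_int :: "'a measure \<Rightarrow> ('a \<Rightarrow> real) \<Rightarrow> bool" where
  "sq_int M f \<longleftrightarrow> f \<in> borel_measurable M \<and> integrable M (\<lambda>x. (f x)\<^sup>2)"

definition l2 :: "'a measure \<Rightarrow> ('a \<Rightarrow> real) \<Rightarrow> real" where
  "l2 M f = sqrt (\<integral>x. (f x)\<^sup>2 \<partial>M)"

lemma sq_int_measurable: "sq_int M f \<Longrightarrow> f \<in> borel_measurable M"
  by (simp add: sq_int_def)

lemma l2_nonneg: "0 \<le> l2 M f"
  by (simp add: l2_def)

lemma l2_power2: "(l2 M f)\<^sup>2 = (\<integral>x. (f x)\<^sup>2 \<partial>M)"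
  by (simp add: l2_def)

lemma sq_int_bound:
  assumes "sq_int M g" "f \<in> borel_measurable M" "\<And>x. x \<in> space M \<Longrightarrow> \<bar>f x\<bar> \<le> \<bar>g x\<bar>"
  shows "sq_int M f"
  unfolding sq_int_def
proof
  show "integrable M (\<lambda>x. (f x)\<^sup>2)"
  proof (rule Bochner_Integration.integrable_bound)
    show "integrable M (\<lambda>x. (g x)\<^sup>2)" using assms(1) by (simp add: sq_int_def)
    show "AE x in M. norm ((f x)\<^sup>2) \<le> norm ((g x)\<^sup>2)"
      using assms(3) by (intro AE_I2) (simp add: abs_le_square_iff[symmetric])
  qed (use assms(2) in measurable)
qed (rule assms(2))

lemma sq_int_add:
  assumes "sq_int M f" "sq_int M g"
  shows "sq_int M (\<lambda>x. f x + g x)"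
  unfolding sq_int_def
proof
  have [measurable]: "f \<in> borel_measurable M" "g \<in> borel_measurable M"
    using assms by (auto simp: sq_int_def)
  show "(\<lambda>x. f x + g x) \<in> borel_measurable M" by measurable
  show "integrable M (\<lambda>x. (f x + g x)\<^sup>2)"
  proof (rule Bochner_Integration.integrable_bound)
    show "integrable M (\<lambda>x. 2 * (f x)\<^sup>2 + 2 * (g x)\<^sup>2)"
      using assms by (auto simp: sq_int_def)
    have "(a + b)\<^sup>2 \<le> 2 * a\<^sup>2 + 2 * b\<^sup>2" for a b :: real
      using zero_le_power2[of "a - b"] by (simp add: power2_sum power2_diff)
    then show "AE x in M. norm ((f x + g x)\<^sup>2) \<le> norm (2 * (f x)\<^sup>2 + 2 * (g x)\<^sup>2)"
      by (intro AE_I2) simp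
  qed measurable
qed

lemma sq_int_cmult: "sq_int M f \<Longrightarrow> sq_int M (\<lambda>x. c * f x)"
  by (auto simp: sq_int_def power_mult_distrib)

lemma sq_int_divide: "sq_int M f \<Longrightarrow> sq_int M (\<lambda>x. f x / c)"
  using sq_int_cmult[of M f "1 / c"] by simp

lemma sq_int_diff: "sq_int M f \<Longrightarrow> sq_int M g \<Longrightarrow> sq_int M (\<lambda>x. f x - g x)"
  using sq_int_add[of M f "\<lambda>x. (-1) * g x"] sq_int_cmult[of M g "-1"] by simp

lemma sq_int_abs: "sq_int M f \<Longrightarrow> sq_int M (\<lambda>x. \<bar>f x\<bar>)"
  by (auto simp: sq_int_def)

lemma (in prob_space) sq_int_const: "sq_int M (\<lambda>x. c)"
  by (simp add: sq_int_def)

lemma (in prob_space) sq_int_sum: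
  "(\<And>i. i \<in> I \<Longrightarrow> sq_int M (f i)) \<Longrightarrow> sq_int M (\<lambda>x. \<Sum>i\<in>I. f i x)"
proof (induction I rule: infinite_finite_induct)
  case (insert i I)
  then show ?case by (simp add: sq_int_add)
qed (simp_all add: sq_int_const)

lemma (in prob_space) sq_int_integrable: "sq_int M f \<Longrightarrow> integrable M f"
  by (rule square_integrable_imp_integrable) (auto simp: sq_int_def)

lemma sq_int_integrable_mult:
  assumes "sq_int M f" "sq_int M g"
  shows "integrable M (\<lambda>x. f x * g x)"
proof (rule Bochner_Integration.integrable_bound)
  have [measurable]: "f \<in> borel_measurable M" "g \<in> borel_measurable M"
    using assms by (auto simp: sq_int_def)
  show "(\<lambda>x. f x * g x) \<in> borel_measurable M" by measurable
  show "integrable M (\<lambda>x. (f x)\<^sup>2 + (g x)\<^sup>2)"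
    using assms by (auto simp: sq_int_def)
  have "\<bar>a * b\<bar> \<le> a\<^sup>2 + b\<^sup>2" for a b :: real
  proof -
    have "2 * (\<bar>a\<bar> * \<bar>b\<bar>) \<le> a\<^sup>2 + b\<^sup>2"
      using zero_le_power2[of "\<bar>a\<bar> - \<bar>b\<bar>"] by (simp add: power2_diff)
    moreover have "0 \<le> \<bar>a\<bar> * \<bar>b\<bar>" by simp
    ultimately show ?thesis unfolding abs_mult by linarith
  qed
  then show "AE x in M. norm (f x * g x) \<le> norm ((f x)\<^sup>2 + (g x)\<^sup>2)"
    by (intro AE_I2) simp
qed

lemma l2_mono:
  assumes "sq_int M g" "f \<in> borel_measurable M" "\<And>x. x \<in> space M \<Longrightarrow> \<bar>f x\<bar> \<le> \<bar>g x\<bar>"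
  shows "l2 M f \<le> l2 M g"
proof -
  have "sq_int M f" by (rule sq_int_bound[OF assms])
  then show ?thesis
    unfolding l2_def using assms
    by (intro real_sqrt_le_mono integral_mono) (auto simp: sq_int_def abs_le_square_iff)
qed

lemma l2_cmult: "l2 M (\<lambda>x. c * f x) = \<bar>c\<bar> * l2 M f"
  by (simp add: l2_def power_mult_distrib real_sqrt_mult)

lemma l2_divide: "l2 M (\<lambda>x. f x / c) = l2 M f / \<bar>c\<bar>"
  using l2_cmult[of M "1 / c" f] by simp

lemma l2_minus_commute: "l2 M (\<lambda>x. f x - g x) = l2 M (\<lambda>x. g x - f x)"
  by (simp add: l2_def power2_commute)

lemma l2_Cauchy_Schwarz:
  assumes f: "sq_int M f" and g: "sq_int M g"
  shows "(\<integral>x. f x * g x \<partial>M) \<le> l2 M f * l2 M g"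
proof -
  have int: "integrable M (\<lambda>x. (f x)\<^sup>2)" "integrable M (\<lambda>x. (g x)\<^sup>2)" "integrable M (\<lambda>x. f x * g x)"
    using f g sq_int_integrable_mult by (auto simp: sq_int_def)
  have quad: "2 * (\<integral>x. f x * g x \<partial>M) * a * b \<le> a\<^sup>2 * (l2 M f)\<^sup>2 + b\<^sup>2 * (l2 M g)\<^sup>2" for a b :: real
  proof -
    have "0 \<le> (\<integral>x. (a * f x - b * g x)\<^sup>2 \<partial>M)" by simp
    also have "\<dots> = (\<integral>x. a\<^sup>2 * (f x)\<^sup>2 + b\<^sup>2 * (g x)\<^sup>2 - 2 * a * b * (f x * g x) \<partial>M)"
      by (intro Bochner_Integration.integral_cong) (auto simp: power2_eq_square algebra_simps)
    also have "\<dots> = a\<^sup>2 * (\<integral>x. (f x)\<^sup>2 \<partial>M) + b\<^sup>2 * (\<integral>x. (g x)\<^sup>2 \<partial>M) - 2 * a * b * (\<integral>x. f x * g x \<partial>M)"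
      using int by simp
    finally show ?thesis by (simp add: l2_power2 algebra_simps)
  qed
  define A B I where "A = l2 M f" and "B = l2 M g" and "I = (\<integral>x. f x * g x \<partial>M)"
  have AB: "0 \<le> A" "0 \<le> B" by (simp_all add: A_def B_def l2_nonneg)
  have q: "2 * I * a * b \<le> a\<^sup>2 * A\<^sup>2 + b\<^sup>2 * B\<^sup>2" for a b
    using quad[of a b] by (simp add: A_def B_def I_def)
  \<comment> \<open>The choice \<open>a = B + e\<close>, \<open>b = A + e\<close> avoids dividing by a possibly vanishing norm.\<close>
  have "I \<le> (A + e) * (B + e)" if e: "0 < e" for e
  proof -
    have "2 * I * (B + e) * (A + e) \<le> (B + e)\<^sup>2 * A\<^sup>2 + (A + e)\<^sup>2 * B\<^sup>2" by (rule q)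
    also have "\<dots> \<le> (B + e)\<^sup>2 * (A + e)\<^sup>2 + (A + e)\<^sup>2 * (B + e)\<^sup>2"
      using AB e by (intro add_mono mult_left_mono power_mono) auto
    also have "\<dots> = 2 * ((A + e) * (B + e)) * (B + e) * (A + e)"
      by (simp add: power2_eq_square algebra_simps)
    finally have "2 * I * ((B + e) * (A + e)) \<le> 2 * ((A + e) * (B + e)) * ((B + e) * (A + e))"
      by (simp add: mult.assoc)
    moreover have "0 < (B + e) * (A + e)" using AB e by (simp add: add_nonneg_pos)
    ultimately show ?thesis by (metis mult_le_cancel_right_pos mult_le_cancel_left_pos zero_less_numeral)
  qed
  moreover have "((\<lambda>e. (A + e) * (B + e)) \<longlongrightarrow> (A + 0) * (B + 0)) (at_right 0)"
    by (intro tendsto_intros)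
  ultimately have "I \<le> (A + 0) * (B + 0)"
    by (intro tendsto_lowerbound[where F = "at_right 0"]) (auto simp: eventually_at_filter)
  then show ?thesis by (simp add: A_def B_def I_def)
qed

lemma l2_triangle:
  assumes f: "sq_int M f" and g: "sq_int M g"
  shows "l2 M (\<lambda>x. f x + g x) \<le> l2 M f + l2 M g"
proof -
  have int: "integrable M (\<lambda>x. (f x)\<^sup>2)" "integrable M (\<lambda>x. (g x)\<^sup>2)" "integrable M (\<lambda>x. f x * g x)"
    using f g sq_int_integrable_mult by (auto simp: sq_int_def)
  have "(l2 M (\<lambda>x. f x + g x))\<^sup>2 = (\<integral>x. (f x)\<^sup>2 + (g x)\<^sup>2 + 2 * (f x * g x) \<partial>M)"
    unfolding l2_power2
    by (intro Bochner_Integration.integral_cong) (auto simp: power2_sum)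
  also have "\<dots> = (l2 M f)\<^sup>2 + (l2 M g)\<^sup>2 + 2 * (\<integral>x. f x * g x \<partial>M)"
    using int by (simp add: l2_power2)
  also have "\<dots> \<le> (l2 M f + l2 M g)\<^sup>2"
    using l2_Cauchy_Schwarz[OF f g] by (simp add: power2_sum)
  finally show ?thesis
    using l2_nonneg by (meson add_nonneg_nonneg power2_le_imp_le)
qed

lemma l2_triangle_diff:
  assumes f: "sq_int M f" and g: "sq_int M g"
  shows "\<bar>l2 M f - l2 M g\<bar> \<le> l2 M (\<lambda>x. f x - g x)"
proof -
  have "l2 M f \<le> l2 M (\<lambda>x. f x - g x) + l2 M g"
    using l2_triangle[OF sq_int_diff[OF f g] g] by simp
  moreover have "l2 M g \<le> l2 M (\<lambda>x. g x - f x) + l2 M f"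
    using l2_triangle[OF sq_int_diff[OF g f] f] by simp
  ultimately show ?thesis using l2_minus_commute[of M f g] by linarith
qed

context prob_space
begin

lemma l2_const: "l2 M (\<lambda>x. c) = \<bar>c\<bar>"
  by (simp add: l2_def prob_space)

lemma l2_sum_le:
  "(\<And>i. i \<in> I \<Longrightarrow> sq_int M (f i)) \<Longrightarrow> l2 M (\<lambda>x. \<Sum>i\<in>I. f i x) \<le> (\<Sum>i\<in>I. l2 M (f i))"
proof (induction I rule: infinite_finite_induct)
  case (insert i I)
  then show ?case
    using l2_triangle[of M "f i" "\<lambda>x. \<Sum>i\<in>I. f i x"] by (fastforce intro!: sq_int_sum)
qed (simp_all add: l2_const)

lemma expectation_abs_le_l2:
  assumes "sq_int M f" shows "expectation (\<lambda>x. \<bar>f x\<bar>) \<le> l2 M f"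
  using l2_Cauchy_Schwarz[OF sq_int_abs[OF assms] sq_int_const[of 1]]
  by (simp add: l2_const) (simp add: l2_def)

lemma abs_expectation_le_l2:
  assumes "sq_int M f" shows "\<bar>expectation f\<bar> \<le> l2 M f"
  using expectation_abs_le_l2[OF assms] integral_abs_bound[of M f] by linarith

lemma l2_center_le:
  assumes f: "sq_int M f"
  shows "l2 M (\<lambda>x. f x - expectation f) \<le> l2 M f"
proof -
  have "(l2 M (\<lambda>x. f x - expectation f))\<^sup>2 = expectation (\<lambda>x. (f x)\<^sup>2) - (expectation f)\<^sup>2"
    unfolding l2_power2 using f sq_int_integrable[OF f] by (intro variance_eq) (auto simp: sq_int_def)
  also have "\<dots> \<le> (l2 M f)\<^sup>2" by (simp add: l2_power2)
  finally show ?thesis using l2_nonneg by (meson power2_le_imp_le)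
qed

lemma l2_add_indep:
  assumes f: "sq_int M f" and g: "sq_int M g" and ind: "indep_var borel f borel g"
    and "expectation f = 0"
  shows "(l2 M (\<lambda>x. f x + g x))\<^sup>2 = (l2 M f)\<^sup>2 + (l2 M g)\<^sup>2"
proof -
  have int: "integrable M (\<lambda>x. (f x)\<^sup>2)" "integrable M (\<lambda>x. (g x)\<^sup>2)" "integrable M (\<lambda>x. f x * g x)"
    using f g sq_int_integrable_mult by (auto simp: sq_int_def)
  have "(l2 M (\<lambda>x. f x + g x))\<^sup>2 = (\<integral>x. (f x)\<^sup>2 + (g x)\<^sup>2 + 2 * (f x * g x) \<partial>M)"
    unfolding l2_power2
    by (intro Bochner_Integration.integral_cong) (auto simp: power2_sum)
  also have "\<dots> = (l2 M f)\<^sup>2 + (l2 M g)\<^sup>2 + 2 * (\<integral>x. f x * g x \<partial>M)"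
    using int by (simp add: l2_power2)
  also have "(\<integral>x. f x * g x \<partial>M) = 0"
    using indep_var_lebesgue_integral[OF ind sq_int_integrable[OF f] sq_int_integrable[OF g]] assms(4)
    by simp
  finally show ?thesis by simp
qed

lemma second_moment_eq_l2:
  "sq_int M f \<Longrightarrow> second_moment M f = ennreal ((l2 M f)\<^sup>2)"
  unfolding second_moment_def l2_power2
  by (subst nn_integral_eq_integral) (auto simp: sq_int_def)

end

text \<open>The nonnegative integral is a supremum over the simple functions below the integrand, so
  monotonicity holds for arbitrary, possibly non-measurable functions. This is used for
  \<^term>\<open>cocycle (A n \<omega>) (W \<omega>)\<close>, whose joint measurability is thereby never needed.\<close>

lemma second_moment_mono:
  assumes "\<And>x. x \<in> space M \<Longrightarrow> \<bar>f x\<bar> \<le> \<bar>g x\<bar>"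
  shows "second_moment M f \<le> second_moment M g"
  unfolding second_moment_def using assms
  by (intro nn_integral_mono ennreal_leI) (simp add: abs_le_square_iff)

text \<open>\<open>Z\<close> need not be measurable: it is enclosed between the measurable functions \<open>max 0 (|U| - D)\<close> and
  \<open>|U| + D\<close>.\<close>

lemma (in prob_space) second_moment_perturbation:
  assumes U: "sq_int M U" and D: "sq_int M D" "l2 M D \<le> K"
    and Z: "\<And>x. x \<in> space M \<Longrightarrow> \<bar>Z x - U x\<bar> \<le> D x"
  shows "ennreal ((max 0 (l2 M U - K))\<^sup>2) \<le> second_moment M Z"
    and "second_moment M Z \<le> ennreal ((l2 M U + K)\<^sup>2)"
proof -
  have K: "0 \<le> K" using D(2) l2_nonneg[of M D] by linarith
  have [measurable]: "U \<in> borel_measurable M" "D \<in> borel_measurable M"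
    using U D by (auto simp: sq_int_def)
  have D0: "0 \<le> D x" if "x \<in> space M" for x using Z[OF that] by linarith
  \<comment> \<open>The lower envelope satisfies \<open>|U| \<le> V + D\<close> and \<open>V \<le> |Z|\<close>.\<close>
  let ?V = "\<lambda>x. max 0 (\<bar>U x\<bar> - D x)"
  have V: "sq_int M ?V"
    by (rule sq_int_bound[OF U]) (use D0 in \<open>force simp: max_def\<close>)+
  have "l2 M U \<le> l2 M (\<lambda>x. ?V x + D x)"
  proof (rule l2_mono[OF sq_int_add[OF V D(1)]])
    fix x assume "x \<in> space M"
    then show "\<bar>U x\<bar> \<le> \<bar>?V x + D x\<bar>" using D0[of x] by simp
  qed measurable
  also have "\<dots> \<le> l2 M ?V + K"
    using l2_triangle[OF V D(1)] D(2) by linarith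
  finally have "(max 0 (l2 M U - K))\<^sup>2 \<le> (l2 M ?V)\<^sup>2"
    by (intro power_mono) (auto simp: l2_nonneg)
  then have "ennreal ((max 0 (l2 M U - K))\<^sup>2) \<le> second_moment M ?V"
    unfolding second_moment_eq_l2[OF V] by (rule ennreal_leI)
  also have "\<dots> \<le> second_moment M Z"
    by (rule second_moment_mono) (use Z in force)
  finally show "ennreal ((max 0 (l2 M U - K))\<^sup>2) \<le> second_moment M Z" .
  have W: "sq_int M (\<lambda>x. \<bar>U x\<bar> + D x)" by (intro sq_int_add sq_int_abs U D)
  have "second_moment M Z \<le> second_moment M (\<lambda>x. \<bar>U x\<bar> + D x)"
    by (rule second_moment_mono) (use Z in force)
  also have "\<dots> = ennreal ((l2 M (\<lambda>x. \<bar>U x\<bar> + D x))\<^sup>2)"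
    by (rule second_moment_eq_l2[OF W])
  also have "\<dots> \<le> ennreal ((l2 M U + K)\<^sup>2)"
    using l2_triangle[OF sq_int_abs[OF U] D(1)] D(2)
    by (intro ennreal_leI power_mono l2_nonneg) (simp add: l2_def)
  finally show "second_moment M Z \<le> ennreal ((l2 M U + K)\<^sup>2)" .
qed

section \<open>Characteristic functions\<close>

text \<open>The map \<open>x \<mapsto> exp (i t x)\<close> is Lipschitz with constant \<open>|t|\<close>, and the \<open>L\<^sup>1\<close> norm is at most the \<open>L\<^sup>2\<close>
  norm.\<close>

lemma (in prob_space) char_distr_diff_le:
  assumes U: "sq_int M U" and V: "sq_int M V"
  shows "cmod (char (distr M borel U) t - char (distr M borel V) t) \<le> \<bar>t\<bar> * l2 M (\<lambda>x. U x - V x)"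
proof -
  have [measurable]: "U \<in> borel_measurable M" "V \<in> borel_measurable M"
    using U V by (auto simp: sq_int_def)
  have int: "integrable M (\<lambda>x. iexp (t * U x))" "integrable M (\<lambda>x. iexp (t * V x))"
    by (auto intro!: integrable_const_bound[of _ 1] AE_I2)
  have lip: "cmod (iexp a - iexp b) \<le> \<bar>a - b\<bar>" for a b :: real
  proof -
    have "iexp a = iexp b * iexp (a - b)"
      unfolding exp_add[symmetric] by (simp add: algebra_simps)
    then have "iexp a - iexp b = iexp b * (iexp (a - b) - 1)" by (simp add: right_diff_distrib)
    then have "cmod (iexp a - iexp b) = cmod (iexp (a - b) - 1)" by (simp add: norm_mult)
    also have "\<dots> \<le> \<bar>a - b\<bar>" using iexp_approx1[of "a - b" 0] by simp
    finally show ?thesis .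
  qed
  have "char (distr M borel U) t - char (distr M borel V) t = (CLINT x|M. iexp (t * U x) - iexp (t * V x))"
    unfolding Bochner_Integration.integral_diff[OF int] by (simp add: char_def integral_distr)
  also have "cmod \<dots> \<le> (LINT x|M. cmod (iexp (t * U x) - iexp (t * V x)))"
    by (rule integral_norm_bound)
  also have "\<dots> \<le> (LINT x|M. \<bar>t\<bar> * \<bar>U x - V x\<bar>)"
  proof (rule integral_mono)
    show "integrable M (\<lambda>x. \<bar>t\<bar> * \<bar>U x - V x\<bar>)"
      using sq_int_integrable[OF sq_int_diff[OF U V]] by simp
    show "cmod (iexp (t * U x) - iexp (t * V x)) \<le> \<bar>t\<bar> * \<bar>U x - V x\<bar>" for x
      using lip[of "t * U x" "t * V x"] by (simp add: abs_mult[symmetric] right_diff_distrib)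
  qed (use int in simp)
  also have "\<dots> \<le> \<bar>t\<bar> * l2 M (\<lambda>x. U x - V x)"
    using expectation_abs_le_l2[OF sq_int_diff[OF U V]] by (simp add: mult_left_mono)
  finally show ?thesis .
qed

lemma char_distr_scale:
  assumes "U \<in> borel_measurable M"
  shows "char (distr M borel (\<lambda>x. c * U x)) t = char (distr M borel U) (c * t)"
  using assms unfolding char_def by (simp add: integral_distr ac_simps)

lemma centered_normal_eq:
  assumes "0 \<le> s"
  shows "centered_normal s = distr std_normal_distribution borel (\<lambda>x. s * x)"
proof (cases "s = 0")
  case True
  interpret N: real_distribution std_normal_distribution by (rule real_dist_normal_dist)
  show ?thesis using N.distr_const[of 0 borel] True by (simp add: centered_normal_def)
next
  case False
  interpret N: real_distribution std_normal_distribution by (rule real_dist_normal_dist)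
  have "distributed std_normal_distribution lborel (\<lambda>x. x) std_normal_density"
    unfolding distributed_def by (auto simp: distr_id2)
  then have "distributed std_normal_distribution lborel (\<lambda>x. s * x) (normal_density 0 s)"
    using N.normal_density_affine[of "\<lambda>x. x" 0 1 s 0] False assms by simp
  then show ?thesis
    unfolding distributed_def centered_normal_def using False
    by (simp add: distr_cong[of _ _ lborel borel])
qed

lemma real_distribution_centered_normal: "0 \<le> s \<Longrightarrow> real_distribution (centered_normal s)"
proof -
  assume "0 \<le> s"
  interpret N: real_distribution std_normal_distribution by (rule real_dist_normal_dist)
  show ?thesis unfolding centered_normal_eq[OF \<open>0 \<le> s\<close>] by simp
qed

lemma char_centered_normal:
  "0 \<le> s \<Longrightarrow> char (centered_normal s) t = exp (- ((s * t)\<^sup>2) / 2)"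
  by (simp add: centered_normal_eq char_distr_scale distr_id2 char_std_normal_distribution
      char_distr_scale[where U = "\<lambda>x. x" and M = std_normal_distribution])

lemma cdf_centered_normal:
  assumes "0 < s"
  shows "cdf (centered_normal s) t = cdf std_normal_distribution (t / s)"
proof -
  have "{x. s * x \<le> t} = {..t / s}" using assms by (auto simp: field_simps)
  then show ?thesis
    using assms by (simp add: centered_normal_eq cdf_def measure_distr vimage_def)
qed

lemma isCont_cdf_std_normal: "isCont (cdf std_normal_distribution) x"
proof -
  interpret N: real_distribution std_normal_distribution by (rule real_dist_normal_dist)
  have "emeasure std_normal_distribution {x} = 0"
    by (subst emeasure_density) (auto intro!: nn_integral_null_set simp: null_sets_def)
  then show ?thesis by (simp add: N.isCont_cdf measure_def)
qed

text \<open>The classical central limit theorem in terms of characteristic functions, including the degenerate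
  case of variance zero.\<close>

lemma (in prob_space) char_iid_sum_tendsto:
  fixes X :: "nat \<Rightarrow> 'a \<Rightarrow> real"
  assumes ind: "indep_vars (\<lambda>i. borel) X UNIV"
    and mean: "\<And>n. expectation (X n) = 0"
    and sq: "\<And>n. sq_int M (X n)"
    and var: "\<And>n. l2 M (X n) = v"
    and law: "\<And>n. distr M borel (X n) = \<mu>"
    and m: "0 < m"
  shows "(\<lambda>q. char (distr M borel (\<lambda>x. (\<Sum>i<q. X i x) / sqrt (real q * m))) t)
           \<longlonglongrightarrow> exp (- ((v / sqrt m * t)\<^sup>2) / 2)"
proof (cases "v = 0")
  case True
  have [measurable]: "random_variable borel (X i)" for i using sq by (simp add: sq_int_def)
  have "char (distr M borel (\<lambda>x. (\<Sum>i<q. X i x) / sqrt (real q * m))) t = 1" for q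
  proof -
    let ?S = "\<lambda>x. (\<Sum>i<q. X i x) / sqrt (real q * m)"
    have S: "sq_int M ?S" by (intro sq_int_divide sq_int_sum sq)
    have "l2 M (\<lambda>x. \<Sum>i<q. X i x) \<le> (\<Sum>i<q. l2 M (X i))" by (rule l2_sum_le[OF sq])
    then have "l2 M ?S = 0"
      using l2_nonneg[of M "\<lambda>x. \<Sum>i<q. X i x"] by (simp add: var True l2_divide)
    then have "cmod (char (distr M borel ?S) t - char (distr M borel (\<lambda>x. 0)) t) \<le> 0"
      using char_distr_diff_le[OF S sq_int_const[of 0], of t] by simp
    moreover have "char (distr M borel (\<lambda>x. 0)) t = 1"
      unfolding char_def by (subst integral_distr) (auto simp: prob_space)
    ultimately show ?thesis by simp
  qed
  then show ?thesis using True by simp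
next
  case False
  then have v: "0 < v" using var[of 0] l2_nonneg[of M "X 0"] by simp
  have [measurable]: "random_variable borel (X i)" for i using sq by (simp add: sq_int_def)
  have "weak_conv_m (\<lambda>n. distr M borel (\<lambda>x. (\<Sum>i<n. X i x) / sqrt (real n * v\<^sup>2))) std_normal_distribution"
  proof (rule central_limit_theorem_zero_mean[OF ind mean v _ _ law])
    show "integrable M (\<lambda>x. (X n x)\<^sup>2)" for n using sq by (simp add: sq_int_def)
    show "variance (X n) = v\<^sup>2" for n using l2_power2[of M "X n"] by (simp add: mean var)
  qed
  then have "(\<lambda>n. char (distr M borel (\<lambda>x. (\<Sum>i<n. X i x) / sqrt (real n * v\<^sup>2))) (v / sqrt m * t))
      \<longlonglongrightarrow> char std_normal_distribution (v / sqrt m * t)"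
    by (intro levy_continuity1 real_dist_normal_dist) auto
  moreover have "char (distr M borel (\<lambda>x. (\<Sum>i<n. X i x) / sqrt (real n * v\<^sup>2))) (v / sqrt m * t)
      = char (distr M borel (\<lambda>x. (\<Sum>i<n. X i x) / sqrt (real n * m))) t" for n
  proof -
    have "(\<lambda>x. (\<Sum>i<n. X i x) / sqrt (real n * m)) =
        (\<lambda>x. v / sqrt m * ((\<Sum>i<n. X i x) / sqrt (real n * v\<^sup>2)))"
      using v by (simp add: real_sqrt_mult mult.commute)
    then show ?thesis by (simp only:) (subst char_distr_scale, simp_all)
  qed
  ultimately show ?thesis by (simp add: char_std_normal_distribution)
qed

section \<open>Almost sure convergence\<close>

lemma AE_tendsto_zero_of_summable_expectation:
  fixes f :: "nat \<Rightarrow> 'a \<Rightarrow> real"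
  assumes int: "\<And>k. integrable M (f k)" and nn: "\<And>k x. x \<in> space M \<Longrightarrow> 0 \<le> f k x"
    and sum: "summable c" and bound: "\<And>k. (\<integral>x. f k x \<partial>M) \<le> c k"
  shows "AE x in M. (\<lambda>k. f k x) \<longlonglongrightarrow> 0"
proof -
  have [measurable]: "f k \<in> borel_measurable M" for k using int by auto
  have c0: "0 \<le> c k" for k
  proof -
    have "0 \<le> (\<integral>x. f k x \<partial>M)" by (intro integral_nonneg_AE AE_I2 nn)
    then show ?thesis using bound[of k] by linarith
  qed
  have "(\<integral>\<^sup>+x. (\<Sum>k. ennreal (f k x)) \<partial>M) = (\<Sum>k. \<integral>\<^sup>+x. ennreal (f k x) \<partial>M)"
    by (rule nn_integral_suminf) simp
  also have "\<dots> = (\<Sum>k. ennreal (\<integral>x. f k x \<partial>M))"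
    using nn by (intro suminf_cong nn_integral_eq_integral int AE_I2)
  also have "\<dots> \<le> (\<Sum>k. ennreal (c k))"
    by (intro suminf_le ennreal_leI bound) auto
  also have "\<dots> = ennreal (suminf c)" by (intro suminf_ennreal2 c0 sum)
  finally have "(\<integral>\<^sup>+x. (\<Sum>k. ennreal (f k x)) \<partial>M) \<noteq> \<infinity>"
    by (auto simp: top_unique)
  then have "AE x in M. (\<Sum>k. ennreal (f k x)) \<noteq> \<infinity>"
    by (intro nn_integral_PInf_AE) auto
  then show ?thesis
  proof (rule AE_mp, intro AE_I2 impI)
    fix x assume x: "x \<in> space M" and fin: "(\<Sum>k. ennreal (f k x)) \<noteq> \<infinity>"
    have "summable (\<lambda>k. f k x)"
      using fin nn[OF x] by (intro summable_suminf_not_top) auto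
    then show "(\<lambda>k. f k x) \<longlonglongrightarrow> 0" by (rule summable_LIMSEQ_zero)
  qed
qed

text \<open>A law of large numbers for processes whose second moments grow at most linearly. Along the
  subsequence of squares the second moments of \<open>T n / n\<close> are summable, and so are those of the
  normalised increments between consecutive squares.\<close>

lemma (in prob_space) AE_tendsto_zero_of_second_moment:
  fixes T :: "nat \<Rightarrow> 'a \<Rightarrow> real" and \<xi> :: "nat \<Rightarrow> 'a \<Rightarrow> real"
  assumes T: "\<And>n. sq_int M (T n)" and T_bound: "\<And>n. 1 \<le> n \<Longrightarrow> l2 M (T n) \<le> C * sqrt (real n)"
    and \<xi>: "\<And>n. sq_int M (\<xi> n)" and \<xi>_bound: "\<And>n. l2 M (\<xi> n) \<le> C"
    and \<xi>_nonneg: "\<And>n x. x \<in> space M \<Longrightarrow> 0 \<le> \<xi> n x"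
    and incr: "\<And>k n x. x \<in> space M \<Longrightarrow> k \<le> n \<Longrightarrow> \<bar>T n x - T k x\<bar> \<le> (\<Sum>i\<in>{k<..n}. \<xi> i x)"
  shows "AE x in M. (\<lambda>n. T n x / real n) \<longlonglongrightarrow> 0"
proof -
  define R where "R k x = (\<Sum>i\<in>{k\<^sup>2<..(Suc k)\<^sup>2}. \<xi> i x)" for k x
  have C: "0 \<le> C" using \<xi>_bound[of 0] l2_nonneg[of M "\<xi> 0"] by linarith
  have R: "sq_int M (R k)" for k unfolding R_def by (intro sq_int_sum \<xi>)
  have R_bound: "l2 M (R k) \<le> 3 * C * real k" if "1 \<le> k" for k
  proof -
    have "l2 M (R k) \<le> (\<Sum>i\<in>{k\<^sup>2<..(Suc k)\<^sup>2}. l2 M (\<xi> i))"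
      unfolding R_def by (intro l2_sum_le \<xi>)
    also have "\<dots> \<le> (\<Sum>i\<in>{k\<^sup>2<..(Suc k)\<^sup>2}. C)" by (intro sum_mono \<xi>_bound)
    also have "\<dots> = real (2 * k + 1) * C" by (simp add: power2_eq_square)
    also have "\<dots> \<le> (3 * real k) * C" using that C by (intro mult_right_mono) auto
    finally show ?thesis by (simp add: ac_simps)
  qed
  have sumC: "summable (\<lambda>k. D / (real (Suc k))\<^sup>2)" for D
    using summable_mult[OF inverse_power_summable[of 2, where 'a = real, THEN summable_Suc_iff[THEN iffD2]], of D]
    by (simp add: field_simps)
  have sq_div: "(a / b)\<^sup>2 = a\<^sup>2 / b\<^sup>2" for a b :: real by (simp add: power_divide)
  have T0: "AE x in M. (\<lambda>k. (T ((Suc k)\<^sup>2) x / (real (Suc k))\<^sup>2)\<^sup>2) \<longlonglongrightarrow> 0"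
  proof (rule AE_tendsto_zero_of_summable_expectation[OF _ _ sumC[of "C\<^sup>2"]])
    fix k
    show "integrable M (\<lambda>x. (T ((Suc k)\<^sup>2) x / (real (Suc k))\<^sup>2)\<^sup>2)"
      using sq_int_divide[OF T] by (simp add: sq_int_def)
    have "l2 M (\<lambda>x. T ((Suc k)\<^sup>2) x / (real (Suc k))\<^sup>2) = l2 M (T ((Suc k)\<^sup>2)) / (real (Suc k))\<^sup>2"
      by (simp only: l2_divide abs_power2)
    also have "\<dots> \<le> C * sqrt (real ((Suc k)\<^sup>2)) / (real (Suc k))\<^sup>2"
      by (intro divide_right_mono T_bound) simp_all
    also have "sqrt (real ((Suc k)\<^sup>2)) = real (Suc k)"
      by (simp only: of_nat_power real_sqrt_abs abs_of_nat)
    also have "C * real (Suc k) / (real (Suc k))\<^sup>2 = C / real (Suc k)"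
      by (simp add: power2_eq_square del: of_nat_Suc)
    finally have "(l2 M (\<lambda>x. T ((Suc k)\<^sup>2) x / (real (Suc k))\<^sup>2))\<^sup>2 \<le> (C / real (Suc k))\<^sup>2"
      by (rule power_mono[OF _ l2_nonneg])
    then show "(\<integral>x. (T ((Suc k)\<^sup>2) x / (real (Suc k))\<^sup>2)\<^sup>2 \<partial>M) \<le> C\<^sup>2 / (real (Suc k))\<^sup>2"
      by (simp only: l2_power2 sq_div)
  qed simp
  have R0: "AE x in M. (\<lambda>k. (R (Suc k) x / (real (Suc k))\<^sup>2)\<^sup>2) \<longlonglongrightarrow> 0"
  proof (rule AE_tendsto_zero_of_summable_expectation[OF _ _ sumC[of "(3 * C)\<^sup>2"]])
    fix k
    show "integrable M (\<lambda>x. (R (Suc k) x / (real (Suc k))\<^sup>2)\<^sup>2)"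
      using sq_int_divide[OF R] by (simp add: sq_int_def)
    have "l2 M (\<lambda>x. R (Suc k) x / (real (Suc k))\<^sup>2) = l2 M (R (Suc k)) / (real (Suc k))\<^sup>2"
      by (simp only: l2_divide abs_power2)
    also have "\<dots> \<le> 3 * C * real (Suc k) / (real (Suc k))\<^sup>2"
      by (intro divide_right_mono R_bound) simp_all
    also have "\<dots> = 3 * C / real (Suc k)" by (simp add: power2_eq_square del: of_nat_Suc)
    finally have "(l2 M (\<lambda>x. R (Suc k) x / (real (Suc k))\<^sup>2))\<^sup>2 \<le> (3 * C / real (Suc k))\<^sup>2"
      by (rule power_mono[OF _ l2_nonneg])
    then show "(\<integral>x. (R (Suc k) x / (real (Suc k))\<^sup>2)\<^sup>2 \<partial>M) \<le> (3 * C)\<^sup>2 / (real (Suc k))\<^sup>2"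
      by (simp only: l2_power2 sq_div)
  qed simp
  show ?thesis
    using AE_space T0 R0
  proof eventually_elim
    case (elim x)
    note T0 = elim(2) and R0 = elim(3)
    define h where "h k = \<bar>T ((Suc k)\<^sup>2) x / (real (Suc k))\<^sup>2\<bar> + \<bar>R (Suc k) x / (real (Suc k))\<^sup>2\<bar>" for k
    have h0: "h \<longlonglongrightarrow> 0"
      unfolding h_def[abs_def]
      using tendsto_add[OF tendsto_real_sqrt[OF T0] tendsto_real_sqrt[OF R0]] by simp
    define k where "k n = nat \<lfloor>sqrt (real n)\<rfloor> - 1" for n :: nat
    have "filterlim k at_top sequentially"
      unfolding k_def
      by (intro filterlim_compose[OF filterlim_minus_const_nat_at_top]
          filterlim_compose[OF filterlim_nat_sequentially] filterlim_compose[OF filterlim_floor_sequentially]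
          filterlim_compose[OF sqrt_at_top] filterlim_real_sequentially)
    then have hk: "(\<lambda>n. h (k n)) \<longlonglongrightarrow> 0" by (rule filterlim_compose[OF h0])
    show "(\<lambda>n. T n x / real n) \<longlonglongrightarrow> 0"
    proof (rule Lim_null_comparison[OF _ hk], rule eventually_sequentiallyI[of 1])
      fix n :: nat assume n: "1 \<le> n"
      define j where "j = nat \<lfloor>sqrt (real n)\<rfloor>"
      have "1 \<le> sqrt (real n)" using n by simp
      then have j1: "1 \<le> j" unfolding j_def by linarith
      then have j: "Suc (k n) = j" by (simp add: k_def j_def)
      have "real j \<le> sqrt (real n)" "sqrt (real n) \<le> real (Suc j)"
        unfolding j_def using \<open>1 \<le> sqrt (real n)\<close> by linarith+
      then have "(real j)\<^sup>2 \<le> (sqrt (real n))\<^sup>2" "(sqrt (real n))\<^sup>2 \<le> (real (Suc j))\<^sup>2"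
        by (intro power_mono; simp)+
      then have "real (j\<^sup>2) \<le> real n" "real n \<le> real ((Suc j)\<^sup>2)" by simp_all
      then have jn: "j\<^sup>2 \<le> n" "n \<le> (Suc j)\<^sup>2" by (simp_all only: of_nat_le_iff)
      have "\<bar>T n x - T (j\<^sup>2) x\<bar> \<le> (\<Sum>i\<in>{j\<^sup>2<..n}. \<xi> i x)"
        by (rule incr[OF \<open>x \<in> space M\<close> jn(1)])
      also have "\<dots> \<le> R j x" unfolding R_def
        using jn \<xi>_nonneg[OF \<open>x \<in> space M\<close>] by (intro sum_mono2) auto
      finally have "\<bar>T n x\<bar> \<le> \<bar>T (j\<^sup>2) x\<bar> + \<bar>R j x\<bar>" by linarith
      then have "\<bar>T n x\<bar> / real n \<le> (\<bar>T (j\<^sup>2) x\<bar> + \<bar>R j x\<bar>) / (real j)\<^sup>2"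
        using j1 \<open>real (j\<^sup>2) \<le> real n\<close> by (intro frac_le) auto
      then show "norm (T n x / real n) \<le> h (k n)"
        by (simp add: h_def j add_divide_distrib del: of_nat_Suc)
    qed
  qed
qed

section \<open>Uniform convergence of distribution functions\<close>

text \<open>Polya's theorem: pointwise convergence of distribution functions to a continuous one is uniform.\<close>

lemma uniform_convergence_of_cdfs:
  fixes F :: "nat \<Rightarrow> real \<Rightarrow> real" and G :: "real \<Rightarrow> real"
  assumes F: "\<And>n. mono (F n)" "\<And>n t. 0 \<le> F n t" "\<And>n t. F n t \<le> 1"
    and G: "mono G" "continuous_on UNIV G" "(G \<longlongrightarrow> 0) at_bot" "(G \<longlongrightarrow> 1) at_top"
    and lim: "\<And>t. (\<lambda>n. F n t) \<longlonglongrightarrow> G t" and e: "0 < e"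
  shows "eventually (\<lambda>n. \<forall>t. \<bar>F n t - G t\<bar> \<le> 2 * e) sequentially"
proof -
  have G01: "0 \<le> G t" "G t \<le> 1" for t
    using LIMSEQ_le_const[OF lim[of t], of 0] LIMSEQ_le_const2[OF lim[of t], of 1] F by auto
  obtain a where a: "G a < e"
    using order_tendstoD(2)[OF G(3) e] by (auto simp: eventually_at_bot_linorder)
  have "eventually (\<lambda>t. 1 - e < G t) at_top"
    using order_tendstoD(1)[OF G(4), of "1 - e"] e by simp
  then have "eventually (\<lambda>t. 1 - e < G t \<and> a < t) at_top"
    using eventually_gt_at_top[of a] by eventually_elim simp
  then obtain b where b: "1 - e < G b" "a < b"
    by (auto simp: eventually_at_top_linorder)
  have "uniformly_continuous_on {a..b} G"
    by (intro compact_uniformly_continuous continuous_on_subset[OF G(2)]) auto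
  then obtain d where d: "0 < d"
    "\<And>x y. x \<in> {a..b} \<Longrightarrow> y \<in> {a..b} \<Longrightarrow> dist x y < d \<Longrightarrow> dist (G x) (G y) < e"
    using e unfolding uniformly_continuous_on_def by metis
  obtain N :: nat where N: "(b - a) / d < real N" using reals_Archimedean2 by blast
  then have N0: "0 < real N" using b d by (smt (verit) divide_pos_pos)
  define p where "p i = a + (b - a) * real i / real N" for i
  have step: "p (Suc i) - p i < d" for i
  proof -
    have "p (Suc i) - p i = (b - a) / real N" by (simp add: p_def algebra_simps add_divide_distrib diff_divide_distrib)
    moreover have "(b - a) / real N < d" using N N0 d by (simp add: field_simps)
    ultimately show ?thesis by linarith
  qed
  have "eventually (\<lambda>n. \<forall>i\<in>{..N}. \<bar>F n (p i) - G (p i)\<bar> < e) sequentially"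
    using tendstoD[OF lim e] by (intro eventually_ball_finite) (auto simp: dist_real_def)
  then show ?thesis
  proof eventually_elim
    case (elim n)
    show ?case
    proof
      fix t
      have pa: "p 0 = a" and pb: "p N = b" using N0 by (auto simp: p_def)
      consider "t \<le> a" | "b \<le> t" | "a < t" "t < b" by linarith
      then show "\<bar>F n t - G t\<bar> \<le> 2 * e"
      proof cases
        case 1
        then have "F n t \<le> F n a" "G t \<le> G a" using F(1) G(1) by (auto dest: monoD)
        moreover have "\<bar>F n a - G a\<bar> < e" using elim pa by (metis atMost_iff le0)
        ultimately show ?thesis using a F(2)[of n t] G01[of t] by linarith
      next
        case 2
        then have "F n b \<le> F n t" "G b \<le> G t" using F(1) G(1) by (auto dest: monoD)
        moreover have "\<bar>F n b - G b\<bar> < e" using elim pb by (metis atMost_iff order_refl)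
        ultimately show ?thesis using b F(3)[of n t] G01[of t] by linarith
      next
        case 3
        define i where "i = nat \<lfloor>(t - a) * real N / (b - a)\<rfloor>"
        have pos: "0 \<le> (t - a) * real N / (b - a)" using 3 b N0 by simp
        have "real i \<le> (t - a) * real N / (b - a)" "(t - a) * real N / (b - a) \<le> real (Suc i)"
          unfolding i_def using pos by linarith+
        then have it: "p i \<le> t" "t \<le> p (Suc i)"
          unfolding p_def using b N0 by (simp_all add: field_simps)
        have "p i < b" using it 3 by simp
        have mono_p: "p i \<le> p j" if "i \<le> j" for i j
          unfolding p_def using that b N0 by (simp add: divide_right_mono)
        have iN: "i < N" using mono_p[of N i] pb \<open>p i < b\<close> by (meson not_le)
        have in_ab: "p i \<in> {a..b}" "p (Suc i) \<in> {a..b}" "t \<in> {a..b}"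
          using mono_p[of 0 i] mono_p[of i N] mono_p[of 0 "Suc i"] mono_p[of "Suc i" N] iN 3
          by (auto simp: pa pb)
        have "dist (p i) t < d" "dist (p (Suc i)) t < d"
          using it step[of i] by (auto simp: dist_real_def)
        then have "\<bar>G (p i) - G t\<bar> < e" "\<bar>G (p (Suc i)) - G t\<bar> < e"
          using d(2)[OF in_ab(1) in_ab(3)] d(2)[OF in_ab(2) in_ab(3)] by (auto simp: dist_real_def)
        moreover have "\<bar>F n (p i) - G (p i)\<bar> < e" "\<bar>F n (p (Suc i)) - G (p (Suc i))\<bar> < e"
          using elim iN by auto
        moreover have "F n (p i) \<le> F n t" "F n t \<le> F n (p (Suc i))"
          using it F(1) by (auto dest: monoD)
        ultimately show ?thesis by linarith
      qed
    qed
  qed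
qed

section \<open>Almost additive processes with independent blocks\<close>

lemma (in prob_space) indep_var_of_indep_set:
  assumes ind: "indep_set (sets A) (sets B)" and sp: "space A = space M" "space B = space M"
    and sub: "sets A \<subseteq> events" "sets B \<subseteq> events"
    and f: "f \<in> borel_measurable A" and g: "g \<in> borel_measurable B"
  shows "indep_var borel f borel g"
  unfolding indep_var_eq
proof (intro conjI)
  show "random_variable borel f" "random_variable borel g"
    by (rule measurable_from_subalg[OF _ f] measurable_from_subalg[OF _ g],
        simp add: subalgebra_def sp sub)+
  have "sigma_sets (space M) {f -` X \<inter> space M |X. X \<in> sets borel} \<subseteq> sets A"
    unfolding sp(1)[symmetric] using measurable_sets[OF f] by (intro sets.sigma_sets_subset) auto
  moreover have "sigma_sets (space M) {g -` X \<inter> space M |X. X \<in> sets borel} \<subseteq> sets B"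
    unfolding sp(2)[symmetric] using measurable_sets[OF g] by (intro sets.sigma_sets_subset) auto
  ultimately show "indep_set (sigma_sets (space M) {f -` X \<inter> space M |X. X \<in> sets borel})
      (sigma_sets (space M) {g -` X \<inter> space M |X. X \<in> sets borel})"
    using ind unfolding indep_set_def by (elim indep_sets_mono_sets) (auto split: bool.split)
qed

text \<open>Here \<open>X a n\<close> stands for the value of the process over the block \<open>{a<..a + n}\<close> of indices, and
  \<open>F a n\<close> carries the events that depend on this block only. Disjoint adjacent blocks are
  independent, the law of \<open>X a n\<close> depends only on the length \<open>n\<close>, and \<open>X\<close> is additive over adjacent
  blocks up to an error of \<open>L\<^sup>2\<close> norm at most \<open>K\<close>.\<close>

locale almost_additive = prob_space M for M :: "'a measure" +
  fixes X :: "nat \<Rightarrow> nat \<Rightarrow> 'a \<Rightarrow> real" and F :: "nat \<Rightarrow> nat \<Rightarrow> 'a measure" and K :: real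
  assumes F_space: "\<And>a n. space (F a n) = space M"
    and F_events: "\<And>a n. sets (F a n) \<subseteq> events"
    and F_left: "\<And>a n m. sets (F a n) \<subseteq> sets (F a (n + m))"
    and F_right: "\<And>a n m. sets (F (a + n) m) \<subseteq> sets (F a (n + m))"
    and F_indep: "\<And>a n m. indep_set (sets (F a n)) (sets (F (a + n) m))"
    and X_adapted: "\<And>a n. X a n \<in> borel_measurable (F a n)"
    and X_law: "\<And>a n. distr M borel (X a n) = distr M borel (X 0 n)"
    and X_sq_0: "\<And>n. sq_int M (X 0 n)"
    and X_blocks: "\<And>m. indep_vars (\<lambda>_. borel) (\<lambda>j. X (j * m) m) UNIV"
    and X_defect: "\<And>a n m. l2 M (\<lambda>\<omega>. X a (n + m) \<omega> - X a n \<omega> - X (a + n) m \<omega>) \<le> K"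
begin

lemma K_nonneg: "0 \<le> K"
  using X_defect[of 0 0 0] l2_nonneg order_trans by blast

lemma measurable_F_M: "f \<in> borel_measurable (F a n) \<Longrightarrow> f \<in> borel_measurable M"
  by (rule measurable_from_subalg[of M "F a n"]) (simp_all add: subalgebra_def F_space F_events)

lemma measurable_F_subblock:
  assumes "f \<in> borel_measurable (F (a + i) k)" "i + k \<le> n"
  shows "f \<in> borel_measurable (F a n)"
proof -
  have "sets (F (a + i) k) \<subseteq> sets (F (a + i) (k + (n - i - k)))" by (rule F_left)
  also have "k + (n - i - k) = n - i" using assms(2) by simp
  also have "sets (F (a + i) (n - i)) \<subseteq> sets (F a (i + (n - i)))" by (rule F_right)
  also have "i + (n - i) = n" using assms(2) by simp
  finally show ?thesis
    by (intro measurable_from_subalg[OF _ assms(1)]) (simp add: subalgebra_def F_space)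
qed

lemma X_measurable [measurable]: "X a n \<in> borel_measurable M"
  by (rule measurable_F_M[OF X_adapted])

lemma X_sq: "sq_int M (X a n)"
proof -
  have "integrable (distr M borel (X 0 n)) (\<lambda>x. x\<^sup>2)"
    using X_sq_0[of n] by (subst integrable_distr_eq) (auto simp: sq_int_def)
  then have "integrable (distr M borel (X a n)) (\<lambda>x. x\<^sup>2)" by (simp only: X_law[of a n])
  then show ?thesis by (subst (asm) integrable_distr_eq) (auto simp: sq_int_def)
qed

text \<open>Mean and standard deviation of the value over a block of length \<open>n\<close>. By stationarity they do not
  depend on the position of the block.\<close>

definition mean :: "nat \<Rightarrow> real" where "mean n = expectation (X 0 n)"

lemma expectation_X: "expectation (X a n) = mean n"
proof -
  have "(\<integral>x. x \<partial>distr M borel (X a n)) = (\<integral>x. x \<partial>distr M borel (X 0 n))" by (simp only: X_law[of a n])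
  then show ?thesis by (simp add: integral_distr mean_def)
qed

definition X_centered :: "nat \<Rightarrow> nat \<Rightarrow> 'a \<Rightarrow> real" where "X_centered a n \<omega> = X a n \<omega> - mean n"

definition std_dev :: "nat \<Rightarrow> real" where "std_dev n = l2 M (X_centered 0 n)"

lemma X_centered_sq: "sq_int M (X_centered a n)"
  unfolding X_centered_def[abs_def] by (intro sq_int_diff X_sq sq_int_const)

lemma X_centered_adapted: "X_centered a n \<in> borel_measurable (F a n)"
  unfolding X_centered_def[abs_def] using X_adapted by simp

lemma expectation_X_centered: "expectation (X_centered a n) = 0"
  unfolding X_centered_def[abs_def] using sq_int_integrable[OF X_sq] by (simp add: expectation_X prob_space)

lemma X_centered_law: "distr M borel (X_centered a n) = distr M borel (X_centered 0 n)"
proof -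
  have "distr M borel (X_centered b n) = distr (distr M borel (X b n)) borel (\<lambda>x. x - mean n)" for b
    by (subst distr_distr) (auto simp: comp_def X_centered_def[abs_def])
  then show ?thesis by (simp only: X_law[of a n])
qed

lemma l2_X_centered: "l2 M (X_centered a n) = std_dev n"
proof -
  have [measurable]: "X_centered b n \<in> borel_measurable M" for b by (rule sq_int_measurable[OF X_centered_sq])
  have "(\<integral>x. x\<^sup>2 \<partial>distr M borel (X_centered a n)) = (\<integral>x. x\<^sup>2 \<partial>distr M borel (X_centered 0 n))" by (simp only: X_centered_law[of a n])
  then show ?thesis by (simp add: integral_distr std_dev_def l2_def)
qed

text \<open>The additivity error of the centred process.\<close>

definition defect :: "nat \<Rightarrow> nat \<Rightarrow> nat \<Rightarrow> 'a \<Rightarrow> real" where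
  "defect a n m \<omega> = X_centered a (n + m) \<omega> - X_centered a n \<omega> - X_centered (a + n) m \<omega>"

lemma defect_sq: "sq_int M (defect a n m)"
  unfolding defect_def[abs_def] by (intro sq_int_diff X_centered_sq)

lemma l2_defect: "l2 M (defect a n m) \<le> K"
proof -
  let ?d = "\<lambda>\<omega>. X a (n + m) \<omega> - X a n \<omega> - X (a + n) m \<omega>"
  have "expectation ?d = mean (n + m) - mean n - mean m"
    using sq_int_integrable[OF X_sq] by (simp add: expectation_X)
  then have "defect a n m = (\<lambda>\<omega>. ?d \<omega> - expectation ?d)"
    by (auto simp: defect_def X_centered_def)
  then show ?thesis
    using l2_center_le[of ?d] X_defect[of a n m] sq_int_diff[OF sq_int_diff[OF X_sq X_sq] X_sq]
    by (metis order_trans)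
qed

lemma mean_defect: "\<bar>mean (n + m) - mean n - mean m\<bar> \<le> K"
proof -
  let ?d = "\<lambda>\<omega>. X 0 (n + m) \<omega> - X 0 n \<omega> - X (0 + n) m \<omega>"
  have "expectation ?d = mean (n + m) - mean n - mean m"
    using sq_int_integrable[OF X_sq] by (simp add: expectation_X)
  moreover have "\<bar>expectation ?d\<bar> \<le> l2 M ?d"
    by (intro abs_expectation_le_l2 sq_int_diff X_sq)
  ultimately show ?thesis using X_defect[of 0 n m] by linarith
qed

text \<open>The sum of the centred values over \<open>q\<close> consecutive blocks of length \<open>m\<close>, and its difference to the
  centred value over their union.\<close>

definition block_sum :: "nat \<Rightarrow> nat \<Rightarrow> nat \<Rightarrow> 'a \<Rightarrow> real" where
  "block_sum m a q \<omega> = (\<Sum>j<q. X_centered (a + j * m) m \<omega>)"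

definition block_error :: "nat \<Rightarrow> nat \<Rightarrow> nat \<Rightarrow> 'a \<Rightarrow> real" where
  "block_error m a q \<omega> = X_centered a (q * m) \<omega> - block_sum m a q \<omega>"

lemma block_sum_add: "block_sum m a (p + q) \<omega> = block_sum m a p \<omega> + block_sum m (a + p * m) q \<omega>"
  by (induction q) (simp_all add: block_sum_def algebra_simps)

lemma block_error_add:
  "block_error m a (p + q) \<omega> =
     block_error m a p \<omega> + block_error m (a + p * m) q \<omega> + defect a (p * m) (q * m) \<omega>"
  by (simp add: block_error_def block_sum_add defect_def add_mult_distrib)

lemma block_sum_sq: "sq_int M (block_sum m a q)"
  unfolding block_sum_def[abs_def] by (intro sq_int_sum X_centered_sq)

lemma block_error_sq: "sq_int M (block_error m a q)"
  unfolding block_error_def[abs_def] by (intro sq_int_diff X_centered_sq block_sum_sq)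

lemma block_sum_adapted: "block_sum m a q \<in> borel_measurable (F a (q * m))"
  unfolding block_sum_def[abs_def]
proof (rule borel_measurable_sum)
  fix j assume "j \<in> {..<q}"
  then have "j * m + m \<le> q * m"
    using mult_le_mono1[of "Suc j" q m] by simp
  then show "X_centered (a + j * m) m \<in> borel_measurable (F a (q * m))"
    by (rule measurable_F_subblock[OF X_centered_adapted])
qed

lemma block_error_adapted: "block_error m a q \<in> borel_measurable (F a (q * m))"
  unfolding block_error_def[abs_def] using X_centered_adapted block_sum_adapted by simp

lemma expectation_block_sum: "expectation (block_sum m a q) = 0"
  unfolding block_sum_def[abs_def]
  using sq_int_integrable[OF X_centered_sq] by (subst Bochner_Integration.integral_sum) (auto simp: expectation_X_centered)

lemma expectation_block_error: "expectation (block_error m a q) = 0"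
  unfolding block_error_def[abs_def]
  using sq_int_integrable[OF X_centered_sq] sq_int_integrable[OF block_sum_sq]
  by (subst Bochner_Integration.integral_diff) (auto simp: expectation_X_centered expectation_block_sum)

lemma l2_add_adjacent:
  assumes f: "sq_int M f" "f \<in> borel_measurable (F a n)" "expectation f = 0"
    and g: "sq_int M g" "g \<in> borel_measurable (F (a + n) m)"
  shows "(l2 M (\<lambda>\<omega>. f \<omega> + g \<omega>))\<^sup>2 = (l2 M f)\<^sup>2 + (l2 M g)\<^sup>2"
  by (rule l2_add_indep[OF f(1) g(1) indep_var_of_indep_set[OF F_indep _ _ _ _ f(2) g(2)] f(3)])
     (simp_all add: F_space F_events)

lemma l2_block_sum: "l2 M (block_sum m a q) = sqrt (real q) * std_dev m"
proof -
  have "(l2 M (block_sum m a q))\<^sup>2 = real q * (std_dev m)\<^sup>2"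
  proof (induction q)
    case 0
    then show ?case by (simp add: block_sum_def[abs_def] l2_const)
  next
    case (Suc q)
    have "block_sum m a (Suc q) = (\<lambda>\<omega>. block_sum m a q \<omega> + X_centered (a + q * m) m \<omega>)"
      by (auto simp: block_sum_def)
    then have "(l2 M (block_sum m a (Suc q)))\<^sup>2 = (l2 M (block_sum m a q))\<^sup>2 + (l2 M (X_centered (a + q * m) m))\<^sup>2"
      using l2_add_adjacent[OF block_sum_sq block_sum_adapted expectation_block_sum X_centered_sq X_centered_adapted]
      by simp
    then show ?case by (simp add: Suc l2_X_centered algebra_simps)
  qed
  then have "sqrt ((l2 M (block_sum m a q))\<^sup>2) = sqrt (real q * (std_dev m)\<^sup>2)" by simp
  then show ?thesis by (simp add: real_sqrt_mult l2_nonneg std_dev_def)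
qed

text \<open>Writing \<open>e q\<close> for the left-hand side, merging two groups of \<open>p\<close> blocks gives
  \<open>e (2p) \<le> \<surd>2 e p + K\<close>, because the errors of the two groups are centred and independent, and adding
  one more block gives \<open>e (2p+1) \<le> e (2p) + K\<close>. The bound \<open>5K(\<surd>q - 1)\<close> is reproduced by this
  recursion since \<open>5(\<surd>2 - 1) \<ge> 2\<close>.\<close>

lemma l2_block_error:
  assumes "1 \<le> q" shows "l2 M (block_error m a q) \<le> 5 * K * (sqrt (real q) - 1)"
  using assms
proof (induction q arbitrary: a rule: less_induct)
  case (less q)
  show ?case
  proof (cases "q = 1")
    case True
    then show ?thesis by (simp add: block_error_def[abs_def] block_sum_def l2_const)
  next
    case False
    define p where "p = q div 2"
    have p: "1 \<le> p" "p < q" using False less.prems by (auto simp: p_def)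
    have double: "l2 M (block_error m a (2 * p)) \<le> 5 * K * (sqrt (real (2 * p)) - 1) - K"
    proof -
      let ?f = "block_error m a p" and ?g = "block_error m (a + p * m) p"
      define e where "e = 5 * K * (sqrt (real p) - 1)"
      have e: "l2 M ?f \<le> e" "l2 M ?g \<le> e" unfolding e_def by (rule less.IH[OF p(2,1)])+
      have e0: "0 \<le> e" using e(1) l2_nonneg[of M ?f] by linarith
      have "(l2 M (\<lambda>\<omega>. ?f \<omega> + ?g \<omega>))\<^sup>2 = (l2 M ?f)\<^sup>2 + (l2 M ?g)\<^sup>2"
        by (rule l2_add_adjacent[OF block_error_sq block_error_adapted expectation_block_error
              block_error_sq block_error_adapted])
      also have "\<dots> \<le> e\<^sup>2 + e\<^sup>2" by (intro add_mono power_mono e l2_nonneg)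
      also have "\<dots> = (sqrt 2 * e)\<^sup>2" by (simp add: power_mult_distrib)
      finally have fg: "l2 M (\<lambda>\<omega>. ?f \<omega> + ?g \<omega>) \<le> sqrt 2 * e"
        using e0 by (auto intro: power2_le_imp_le)
      have "block_error m a (2 * p) = (\<lambda>\<omega>. (?f \<omega> + ?g \<omega>) + defect a (p * m) (p * m) \<omega>)"
        using block_error_add[of m a p p] by (auto simp: mult_2)
      then have "l2 M (block_error m a (2 * p)) \<le> l2 M (\<lambda>\<omega>. ?f \<omega> + ?g \<omega>) + l2 M (defect a (p * m) (p * m))"
        using l2_triangle[OF sq_int_add[OF block_error_sq block_error_sq] defect_sq] by simp
      also have "\<dots> \<le> sqrt 2 * e + K" by (intro add_mono fg l2_defect)
      also have "sqrt 2 * e = 5 * K * sqrt (real (2 * p)) - 5 * K * sqrt 2"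
        by (simp add: e_def real_sqrt_mult algebra_simps)
      also have "5 * K * sqrt (real (2 * p)) - 5 * K * sqrt 2 + K \<le> 5 * K * (sqrt (real (2 * p)) - 1) - K"
      proof -
        \<comment> \<open>This is the inequality \<open>5(\<surd>2 - 1) \<ge> 2\<close>.\<close>
        have "7 / 5 \<le> sqrt (2 :: real)" by (rule real_le_rsqrt) (simp add: power2_eq_square)
        then have "K * (7 / 5) \<le> K * sqrt 2" using K_nonneg by (rule mult_left_mono)
        then show ?thesis by (simp add: algebra_simps)
      qed
      finally show ?thesis .
    qed
    show ?thesis
    proof (cases "even q")
      case True
      then have "q = 2 * p" by (simp add: p_def)
      then show ?thesis using double K_nonneg by simp
    next
      case False
      then have q: "q = 2 * p + 1" by (simp add: p_def)
      have "block_error m b 1 = (\<lambda>\<omega>. 0)" for b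
        by (simp add: block_error_def[abs_def] block_sum_def)
      then have "block_error m a q = (\<lambda>\<omega>. block_error m a (2 * p) \<omega> + defect a (2 * p * m) (1 * m) \<omega>)"
        unfolding q using block_error_add[of m a "2 * p" 1] by (auto simp del: One_nat_def)
      then have "l2 M (block_error m a q) \<le> l2 M (block_error m a (2 * p)) + l2 M (defect a (2 * p * m) (1 * m))"
        using l2_triangle[OF block_error_sq defect_sq] by simp
      also have "\<dots> \<le> 5 * K * (sqrt (real (2 * p)) - 1)"
        using double l2_defect[of a "2 * p * m" "1 * m"] by linarith
      also have "\<dots> \<le> 5 * K * (sqrt (real q) - 1)"
        using K_nonneg q by (intro mult_left_mono) auto
      finally show ?thesis .
    qed
  qed
qed

lemma one_le_div:
  fixes m n :: nat
  assumes "1 \<le> m" "m \<le> n" shows "1 \<le> n div m"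
  using div_le_mono[OF assms(2), of m] assms(1) by simp

lemma block_approximation:
  assumes m: "1 \<le> m" and n: "m \<le> n"
  shows "l2 M (\<lambda>\<omega>. X_centered 0 n \<omega> - block_sum m 0 (n div m) \<omega>)
           \<le> 5 * K * sqrt (real (n div m)) + (K + (\<Sum>r<m. std_dev r))"
proof -
  define q r where "q = n div m" and "r = n mod m"
  have q1: "1 \<le> q" unfolding q_def by (rule one_le_div[OF m n])
  have r: "r < m" using m by (simp add: r_def)
  have nqr: "n = q * m + r" by (simp add: q_def r_def)
  have "(\<lambda>\<omega>. X_centered 0 n \<omega> - block_sum m 0 q \<omega>) =
      (\<lambda>\<omega>. block_error m 0 q \<omega> + (X_centered (0 + q * m) r \<omega> + defect 0 (q * m) r \<omega>))"
    by (simp add: block_error_def defect_def nqr)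
  then have "l2 M (\<lambda>\<omega>. X_centered 0 n \<omega> - block_sum m 0 q \<omega>)
      \<le> l2 M (block_error m 0 q) + l2 M (\<lambda>\<omega>. X_centered (0 + q * m) r \<omega> + defect 0 (q * m) r \<omega>)"
    using l2_triangle[OF block_error_sq sq_int_add[OF X_centered_sq defect_sq]] by simp
  also have "\<dots> \<le> l2 M (block_error m 0 q) + (l2 M (X_centered (0 + q * m) r) + l2 M (defect 0 (q * m) r))"
    by (intro add_left_mono l2_triangle X_centered_sq defect_sq)
  also have "\<dots> \<le> 5 * K * (sqrt (real q) - 1) + (std_dev r + K)"
    by (intro add_mono l2_block_error[OF q1] l2_defect) (simp_all add: l2_X_centered)
  also have "\<dots> \<le> 5 * K * sqrt (real q) + (K + (\<Sum>r<m. std_dev r))"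
    using member_le_sum[of r "{..<m}" std_dev] r K_nonneg by (simp add: std_dev_def l2_nonneg algebra_simps)
  finally show ?thesis by (simp add: q_def)
qed

text \<open>The square root of the number of complete blocks, relative to the normalisation \<open>\<surd>n\<close>; it tends to
  \<open>1 / \<surd>m\<close>.\<close>

definition scaling :: "nat \<Rightarrow> nat \<Rightarrow> real" where
  "scaling m n = sqrt (real (n div m)) / sqrt (real n)"

text \<open>Bounds the \<open>L\<^sup>2\<close> distance of the normalised process at time \<open>n\<close> from a normalised sum of independent
  block values; the middle term accounts for the incomplete last block.\<close>

definition scaled_error :: "nat \<Rightarrow> nat \<Rightarrow> real" where
  "scaled_error m n = 5 * K * scaling m n + (K + (\<Sum>r<m. std_dev r)) / sqrt (real n)
     + \<bar>scaling m n - 1 / sqrt (real m)\<bar> * std_dev m"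

lemma filterlim_nat_div:
  assumes "1 \<le> m" shows "filterlim (\<lambda>n::nat. n div m) at_top sequentially"
  unfolding filterlim_at_top
proof
  fix Z :: nat
  have "Z \<le> n div m" if "Z * m \<le> n" for n
    using div_le_mono[OF that, of m] assms by simp
  then show "\<forall>\<^sub>F n in sequentially. Z \<le> n div m" by (rule eventually_sequentiallyI)
qed

lemma scaling_tendsto:
  assumes "1 \<le> m" shows "scaling m \<longlonglongrightarrow> 1 / sqrt (real m)"
proof -
  have "(\<lambda>n. real (n div m) / real n) \<longlonglongrightarrow> 1 / real m"
  proof (rule tendsto_sandwich)
    show "\<forall>\<^sub>F n in sequentially. real (n div m) / real n \<le> 1 / real m"
    proof (rule eventually_sequentiallyI[of 1])
      fix n :: nat assume n: "1 \<le> n"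
      have "real (n div m) \<le> real n / real m" by (rule of_nat_div_le_of_nat)
      then show "real (n div m) / real n \<le> 1 / real m"
        using n assms by (simp add: field_simps)
    qed
    show "\<forall>\<^sub>F n in sequentially. 1 / real m - 1 / real n \<le> real (n div m) / real n"
    proof (rule eventually_sequentiallyI[of 1])
      fix n :: nat assume n: "1 \<le> n"
      have "real n / real m - real (n div m) = real (n mod m) / real m"
        using of_nat_of_nat_div_aux[where 'a = real, of n m] by linarith
      also have "\<dots> \<le> 1" using assms by (simp add: less_imp_le)
      finally have "real n / real m - real (n div m) \<le> 1" .
      then have "(real n / real m - 1) / real n \<le> real (n div m) / real n"
        by (intro divide_right_mono) auto
      then show "1 / real m - 1 / real n \<le> real (n div m) / real n"
        using n by (simp add: diff_divide_distrib)
    qed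
    show "(\<lambda>n. 1 / real m - 1 / real n) \<longlonglongrightarrow> 1 / real m"
      using tendsto_diff[OF tendsto_const lim_1_over_n, of "1 / real m"] by simp
  qed simp
  from tendsto_real_sqrt[OF this] show ?thesis
    by (simp add: scaling_def[abs_def] real_sqrt_divide)
qed

lemma scaled_error_tendsto:
  assumes "1 \<le> m" shows "scaled_error m \<longlonglongrightarrow> 5 * K / sqrt (real m)"
proof -
  have "(\<lambda>n. (K + (\<Sum>r<m. std_dev r)) / sqrt (real n)) \<longlonglongrightarrow> 0"
    by (intro tendsto_divide_0[OF tendsto_const] filterlim_at_top_imp_at_infinity
        filterlim_compose[OF sqrt_at_top filterlim_real_sequentially])
  from tendsto_add[OF tendsto_add[OF tendsto_mult[OF tendsto_const scaling_tendsto[OF assms], of "5 * K"] this]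
      tendsto_mult[OF tendsto_rabs[OF tendsto_diff[OF scaling_tendsto[OF assms] tendsto_const]] tendsto_const,
        of "1 / sqrt (real m)" "std_dev m"]]
  show ?thesis by (simp add: scaled_error_def[abs_def])
qed

lemma l2_scaled_error:
  assumes m: "1 \<le> m" and n: "m \<le> n"
  shows "l2 M (\<lambda>\<omega>. X_centered 0 n \<omega> / sqrt (real n) - block_sum m 0 (n div m) \<omega> / sqrt (real (n div m) * real m))
           \<le> scaled_error m n"
proof -
  define q where "q = n div m"
  have q1: "1 \<le> q" unfolding q_def by (rule one_le_div[OF m n])
  let ?S = "block_sum m 0 q"
  define c where "c = 1 / sqrt (real n) - 1 / sqrt (real q * real m)"
  have n0: "0 < sqrt (real n)" "0 < sqrt (real m)" "0 < sqrt (real q)" using m n q1 by simp_all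
  have "(\<lambda>\<omega>. X_centered 0 n \<omega> / sqrt (real n) - ?S \<omega> / sqrt (real q * real m)) =
      (\<lambda>\<omega>. (X_centered 0 n \<omega> - ?S \<omega>) / sqrt (real n) + c * ?S \<omega>)"
    by (auto simp: c_def diff_divide_distrib algebra_simps)
  then have "l2 M (\<lambda>\<omega>. X_centered 0 n \<omega> / sqrt (real n) - ?S \<omega> / sqrt (real q * real m))
      \<le> l2 M (\<lambda>\<omega>. (X_centered 0 n \<omega> - ?S \<omega>) / sqrt (real n)) + l2 M (\<lambda>\<omega>. c * ?S \<omega>)"
    using l2_triangle[OF sq_int_divide[OF sq_int_diff[OF X_centered_sq block_sum_sq]] sq_int_cmult[OF block_sum_sq]]
    by simp
  also have "l2 M (\<lambda>\<omega>. (X_centered 0 n \<omega> - ?S \<omega>) / sqrt (real n)) = l2 M (\<lambda>\<omega>. X_centered 0 n \<omega> - ?S \<omega>) / sqrt (real n)"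
    using n0 by (simp add: l2_divide)
  also have "\<dots> \<le> (5 * K * sqrt (real q) + (K + (\<Sum>r<m. std_dev r))) / sqrt (real n)"
    using block_approximation[OF m n] n0 by (intro divide_right_mono) (auto simp: q_def)
  also have "\<dots> = 5 * K * scaling m n + (K + (\<Sum>r<m. std_dev r)) / sqrt (real n)"
    by (simp add: scaling_def q_def add_divide_distrib)
  also have "l2 M (\<lambda>\<omega>. c * ?S \<omega>) = \<bar>c * sqrt (real q)\<bar> * std_dev m"
    using n0 by (simp add: l2_cmult l2_block_sum abs_mult)
  also have "c * sqrt (real q) = scaling m n - 1 / sqrt (real m)"
    using n0 by (simp add: c_def scaling_def q_def[symmetric] real_sqrt_mult left_diff_distrib)
  finally show ?thesis by (simp add: scaled_error_def q_def)
qed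

lemma std_dev_scaled_error:
  assumes m: "1 \<le> m" and n: "m \<le> n"
  shows "\<bar>std_dev n / sqrt (real n) - std_dev m / sqrt (real m)\<bar> \<le> scaled_error m n"
proof -
  define q where "q = n div m"
  have q1: "1 \<le> q" unfolding q_def by (rule one_le_div[OF m n])
  have "l2 M (\<lambda>\<omega>. X_centered 0 n \<omega> / sqrt (real n)) = std_dev n / sqrt (real n)"
    by (simp add: l2_divide std_dev_def)
  moreover have "l2 M (\<lambda>\<omega>. block_sum m 0 q \<omega> / sqrt (real q * real m)) = std_dev m / sqrt (real m)"
    using q1 by (simp add: l2_divide l2_block_sum real_sqrt_mult)
  ultimately show ?thesis
    using l2_triangle_diff[OF sq_int_divide[OF X_centered_sq] sq_int_divide[OF block_sum_sq],
        of 0 n "sqrt (real n)" m 0 q "sqrt (real q * real m)"]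
      l2_scaled_error[OF m n] by (simp add: q_def)
qed

text \<open>The square root of the asymptotic variance.\<close>

definition limit_std_dev :: real where "limit_std_dev = lim (\<lambda>n. std_dev n / sqrt (real n))"

lemma std_dev_tendsto: "(\<lambda>n. std_dev n / sqrt (real n)) \<longlonglongrightarrow> limit_std_dev"
proof -
  have "Cauchy (\<lambda>n. std_dev n / sqrt (real n))"
  proof (rule metric_CauchyI)
    fix e :: real assume e: "0 < e"
    have "(\<lambda>m. 5 * K / sqrt (real m)) \<longlonglongrightarrow> 0"
      by (intro tendsto_divide_0[OF tendsto_const] filterlim_at_top_imp_at_infinity
          filterlim_compose[OF sqrt_at_top filterlim_real_sequentially])
    then have "\<forall>\<^sub>F m in sequentially. 5 * K / sqrt (real m) < e / 2 \<and> 1 \<le> m"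
      using e by (intro eventually_conj order_tendstoD(2)[where y = 0] eventually_ge_at_top) auto
    then obtain m where m: "5 * K / sqrt (real m) < e / 2" "1 \<le> m"
      by (auto simp: eventually_sequentially)
    have "\<forall>\<^sub>F n in sequentially. scaled_error m n < e / 2 \<and> m \<le> n"
      using order_tendstoD(2)[OF scaled_error_tendsto[OF m(2)] m(1)] eventually_ge_at_top[of m]
      by (intro eventually_conj) auto
    then obtain N where N: "\<And>n. N \<le> n \<Longrightarrow> scaled_error m n < e / 2 \<and> m \<le> n"
      by (auto simp: eventually_sequentially)
    have close: "dist (std_dev n / sqrt (real n)) (std_dev m / sqrt (real m)) < e / 2" if "N \<le> n" for n
      using std_dev_scaled_error[OF m(2), of n] N[OF that] by (simp add: dist_real_def)
    then show "\<exists>N. \<forall>k\<ge>N. \<forall>n\<ge>N. dist (std_dev k / sqrt (real k)) (std_dev n / sqrt (real n)) < e"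
      using dist_triangle_half_l[OF close close] by blast
  qed
  then show ?thesis
    unfolding limit_std_dev_def by (simp add: Cauchy_convergent_iff convergent_LIMSEQ_iff)
qed

lemma limit_std_dev_nonneg: "0 \<le> limit_std_dev"
  by (rule LIMSEQ_le_const[OF std_dev_tendsto]) (simp add: std_dev_def l2_nonneg)

lemma char_X_centered_tendsto:
  "(\<lambda>n. char (distr M borel (\<lambda>\<omega>. X_centered 0 n \<omega> / sqrt (real n))) t)
     \<longlonglongrightarrow> char (centered_normal limit_std_dev) t"
proof (rule tendstoI)
  fix e :: real assume e: "0 < e"
  define \<psi> where "\<psi> n = char (distr M borel (\<lambda>\<omega>. X_centered 0 n \<omega> / sqrt (real n))) t" for n
  define \<phi> where "\<phi> v = complex_of_real (exp (- ((v * t)\<^sup>2) / 2))" for v :: real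
  have [measurable]: "X_centered a n \<in> borel_measurable M" for a n by (rule sq_int_measurable[OF X_centered_sq])
  have "(\<lambda>m. \<phi> (std_dev m / sqrt (real m))) \<longlonglongrightarrow> \<phi> limit_std_dev"
    unfolding \<phi>_def by (intro tendsto_intros std_dev_tendsto) simp
  then have lim1: "\<forall>\<^sub>F m in sequentially. dist (\<phi> (std_dev m / sqrt (real m))) (\<phi> limit_std_dev) < e / 3"
    using e by (intro tendstoD) auto
  have "(\<lambda>m. \<bar>t\<bar> * (5 * K / sqrt (real m))) \<longlonglongrightarrow> \<bar>t\<bar> * 0"
    by (intro tendsto_mult tendsto_const tendsto_divide_0[OF tendsto_const] filterlim_at_top_imp_at_infinity
        filterlim_compose[OF sqrt_at_top filterlim_real_sequentially])
  then have lim2: "\<forall>\<^sub>F m in sequentially. \<bar>t\<bar> * (5 * K / sqrt (real m)) < e / 3"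
    using e by (intro order_tendstoD(2)) auto
  obtain m where m: "1 \<le> m" "dist (\<phi> (std_dev m / sqrt (real m))) (\<phi> limit_std_dev) < e / 3"
    "\<bar>t\<bar> * (5 * K / sqrt (real m)) < e / 3"
    using eventually_conj[OF eventually_conj[OF lim1 lim2] eventually_ge_at_top[of 1]]
    by (auto simp: eventually_sequentially)
  define S where "S q \<omega> = block_sum m 0 q \<omega> / sqrt (real q * real m)" for q \<omega>
  have "(\<lambda>q. char (distr M borel (S q)) t) \<longlonglongrightarrow> \<phi> (std_dev m / sqrt (real m))"
    unfolding S_def[abs_def] block_sum_def \<phi>_def
  proof (rule char_iid_sum_tendsto[where \<mu> = "distr M borel (X_centered 0 m)"])
    have "indep_vars (\<lambda>_. borel) (\<lambda>j \<omega>. X (j * m) m \<omega> - mean m) UNIV"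
      by (rule indep_vars_compose2[OF X_blocks]) simp
    then show "indep_vars (\<lambda>_. borel) (\<lambda>j. X_centered (0 + j * m) m) UNIV"
      by (simp add: X_centered_def[abs_def])
    show "distr M borel (X_centered (0 + j * m) m) = distr M borel (X_centered 0 m)" for j by (rule X_centered_law)
  qed (use m in \<open>auto simp: expectation_X_centered X_centered_sq l2_X_centered\<close>)
  moreover have "filterlim (\<lambda>n. n div m) at_top sequentially"
    by (rule filterlim_nat_div[OF m(1)])
  ultimately have lim3: "(\<lambda>n. char (distr M borel (S (n div m))) t) \<longlonglongrightarrow> \<phi> (std_dev m / sqrt (real m))"
    by (rule filterlim_compose)
  have "(\<lambda>n. \<bar>t\<bar> * scaled_error m n) \<longlonglongrightarrow> \<bar>t\<bar> * (5 * K / sqrt (real m))"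
    by (intro tendsto_mult tendsto_const scaled_error_tendsto m)
  then have "\<forall>\<^sub>F n in sequentially. \<bar>t\<bar> * scaled_error m n < e / 3"
    using m(3) by (rule order_tendstoD(2))
  moreover have "\<forall>\<^sub>F n in sequentially. dist (char (distr M borel (S (n div m))) t) (\<phi> (std_dev m / sqrt (real m))) < e / 3"
    using lim3 e by (intro tendstoD) auto
  moreover have "\<forall>\<^sub>F n in sequentially. m \<le> n" by (rule eventually_ge_at_top)
  ultimately have "\<forall>\<^sub>F n in sequentially. dist (\<psi> n) (\<phi> limit_std_dev) < e"
  proof eventually_elim
    case (elim n)
    have "dist (\<psi> n) (char (distr M borel (S (n div m))) t)
        \<le> \<bar>t\<bar> * l2 M (\<lambda>\<omega>. X_centered 0 n \<omega> / sqrt (real n) - S (n div m) \<omega>)"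
      unfolding \<psi>_def dist_norm S_def[abs_def]
      by (intro char_distr_diff_le sq_int_divide X_centered_sq block_sum_sq)
    also have "\<dots> \<le> \<bar>t\<bar> * scaled_error m n"
      unfolding S_def using l2_scaled_error[OF m(1) elim(3)] by (intro mult_left_mono) auto
    finally have "dist (\<psi> n) (char (distr M borel (S (n div m))) t) < e / 3" using elim(1) by linarith
    then show ?case
      using elim(2) m(2) dist_triangle[of "\<psi> n" "\<phi> limit_std_dev" "char (distr M borel (S (n div m))) t"]
        dist_triangle[of "char (distr M borel (S (n div m))) t" "\<phi> limit_std_dev" "\<phi> (std_dev m / sqrt (real m))"]
      by linarith
  qed
  then show "\<forall>\<^sub>F n in sequentially. dist (char (distr M borel (\<lambda>\<omega>. X_centered 0 n \<omega> / sqrt (real n))) t)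
      (char (centered_normal limit_std_dev) t) < e"
    by (simp add: \<psi>_def \<phi>_def char_centered_normal[OF limit_std_dev_nonneg])
qed

text \<open>The asymptotic mean per step.\<close>

definition drift :: real where "drift = lim (\<lambda>n. mean n / real n)"

lemma mean_multiple: "\<bar>mean (Suc q * m) - real (Suc q) * mean m\<bar> \<le> real q * K"
proof (induction q)
  case (Suc q)
  have "\<bar>mean (Suc q * m + m) - mean (Suc q * m) - mean m\<bar> \<le> K" by (rule mean_defect)
  then have "\<bar>mean (Suc (Suc q) * m) - mean (Suc q * m) - mean m\<bar> \<le> K" by (simp add: add.commute)
  moreover have "real (Suc (Suc q)) * mean m = real (Suc q) * mean m + mean m"
    by (simp add: algebra_simps)
  moreover have "real (Suc q) * K = real q * K + K" by (simp add: algebra_simps)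
  ultimately show ?case using Suc by linarith
qed simp

lemma mean_quotient_diff:
  assumes n: "1 \<le> n" and m: "1 \<le> m"
  shows "\<bar>mean n / real n - mean m / real m\<bar> \<le> K / real n + K / real m"
proof -
  have key: "\<bar>mean (p * k) / real (p * k) - mean k / real k\<bar> \<le> K / real k"
    if p: "1 \<le> p" and k: "1 \<le> k" for p k
  proof -
    obtain q where q: "p = Suc q" using p by (cases p) auto
    have "\<bar>mean (p * k) - real p * mean k\<bar> \<le> real q * K" unfolding q by (rule mean_multiple)
    also have "\<dots> \<le> real p * K" using K_nonneg q by (intro mult_right_mono) auto
    finally have "\<bar>mean (p * k) - real p * mean k\<bar> / real (p * k) \<le> real p * K / real (p * k)"
      by (rule divide_right_mono) simp
    moreover have "mean (p * k) / real (p * k) - mean k / real k =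
        (mean (p * k) - real p * mean k) / real (p * k)"
      using p k by (simp add: field_simps)
    ultimately show ?thesis using p by (simp add: abs_divide)
  qed
  from key[OF m n] key[OF n m] show ?thesis by (simp add: mult.commute)
qed

text \<open>Almost additive sequences of numbers are at bounded distance from linear ones.\<close>

lemma mean_drift: "\<bar>mean n - real n * drift\<bar> \<le> K"
proof -
  have K_lim: "(\<lambda>n. K / real n) \<longlonglongrightarrow> 0"
    using tendsto_mult[OF tendsto_const lim_1_over_n, of K] by simp
  have "Cauchy (\<lambda>n. mean n / real n)"
  proof (rule metric_CauchyI)
    fix e :: real assume e: "0 < e"
    then have "\<forall>\<^sub>F n in sequentially. K / real n < e / 2 \<and> 1 \<le> n"
      using K_lim by (intro eventually_conj order_tendstoD(2)[where y = 0] eventually_ge_at_top) auto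
    then obtain N where N: "\<And>n. N \<le> n \<Longrightarrow> K / real n < e / 2 \<and> 1 \<le> n"
      by (auto simp: eventually_sequentially)
    have "dist (mean k / real k) (mean n / real n) < e" if "N \<le> k" "N \<le> n" for k n
      using mean_quotient_diff[of k n] N[OF that(1)] N[OF that(2)] unfolding dist_real_def by linarith
    then show "\<exists>N. \<forall>k\<ge>N. \<forall>n\<ge>N. dist (mean k / real k) (mean n / real n) < e" by blast
  qed
  then have lim: "(\<lambda>n. mean n / real n) \<longlonglongrightarrow> drift"
    unfolding drift_def by (simp add: Cauchy_convergent_iff convergent_LIMSEQ_iff)
  show ?thesis
  proof (cases "n = 0")
    case True
    then show ?thesis using mean_defect[of 0 0] by simp
  next
    case False
    have "(\<lambda>m. \<bar>mean n / real n - mean m / real m\<bar>) \<longlonglongrightarrow> \<bar>mean n / real n - drift\<bar>"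
      by (intro tendsto_intros lim)
    moreover have "(\<lambda>m. K / real n + K / real m) \<longlonglongrightarrow> K / real n + 0"
      by (intro tendsto_intros K_lim)
    ultimately have "\<bar>mean n / real n - drift\<bar> \<le> K / real n + 0"
      by (rule LIMSEQ_le) (use mean_quotient_diff[of n] False in \<open>auto intro!: exI[of _ 1]\<close>)
    then have "real n * \<bar>mean n / real n - drift\<bar> \<le> real n * (K / real n)"
      by (intro mult_left_mono) auto
    moreover have "real n * \<bar>mean n / real n - drift\<bar> = \<bar>mean n - real n * drift\<bar>"
      using False by (simp add: abs_mult_pos' right_diff_distrib)
    ultimately show ?thesis using False by simp
  qed
qed

text \<open>The \<open>L\<^sup>2\<close> distance to the linear drift, as opposed to the mean.\<close>

definition deviation :: "nat \<Rightarrow> real" where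
  "deviation n = l2 M (\<lambda>\<omega>. X 0 n \<omega> - real n * drift)"

lemma deviation_std_dev: "\<bar>deviation n - std_dev n\<bar> \<le> K"
proof -
  have "\<bar>deviation n - std_dev n\<bar> \<le> l2 M (\<lambda>\<omega>. (X 0 n \<omega> - real n * drift) - X_centered 0 n \<omega>)"
    unfolding deviation_def std_dev_def by (intro l2_triangle_diff sq_int_diff X_sq sq_int_const X_centered_sq)
  also have "\<dots> = \<bar>mean n - real n * drift\<bar>" by (simp add: X_centered_def l2_const)
  finally show ?thesis using mean_drift[of n] by linarith
qed

lemma const_over_sqrt_tendsto: "(\<lambda>n. c / sqrt (real n)) \<longlonglongrightarrow> 0"
  by (intro tendsto_divide_0[OF tendsto_const] filterlim_at_top_imp_at_infinity
      filterlim_compose[OF sqrt_at_top filterlim_real_sequentially])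

lemma deviation_tendsto: "(\<lambda>n. deviation n / sqrt (real n)) \<longlonglongrightarrow> limit_std_dev"
proof -
  have "(\<lambda>n. deviation n / sqrt (real n) - std_dev n / sqrt (real n)) \<longlonglongrightarrow> 0"
  proof (rule Lim_null_comparison[OF _ const_over_sqrt_tendsto[of K]], rule always_eventually, rule allI)
    fix n
    have "\<bar>deviation n - std_dev n\<bar> / sqrt (real n) \<le> K / sqrt (real n)"
      by (intro divide_right_mono deviation_std_dev) simp
    then show "norm (deviation n / sqrt (real n) - std_dev n / sqrt (real n)) \<le> K / sqrt (real n)"
      by (simp add: diff_divide_distrib[symmetric])
  qed
  from tendsto_add[OF this std_dev_tendsto] show ?thesis by simp
qed

text \<open>Every sequence that is a second moment of the process up to a bounded change of the \<open>L\<^sup>2\<close> norm has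
  the asymptotic variance as its limit; \<open>u n\<close> may also be a supremum of second moments.\<close>

lemma second_moment_limit:
  assumes lower: "\<And>n. ennreal ((max 0 (deviation n - C))\<^sup>2) \<le> u n"
    and upper: "\<And>n. u n \<le> ennreal ((deviation n + C)\<^sup>2)"
  shows "(\<lambda>n. u n / of_nat n) \<longlonglongrightarrow> ennreal (limit_std_dev\<^sup>2)"
proof -
  have C: "(\<lambda>n. C / sqrt (real n)) \<longlonglongrightarrow> 0" by (rule const_over_sqrt_tendsto)
  have div: "ennreal (v\<^sup>2) / of_nat n = ennreal ((v / sqrt (real n))\<^sup>2)" if "1 \<le> n" for v n
    using that by (simp add: power_divide divide_ennreal[symmetric] ennreal_of_nat_eq_real_of_nat)
  have lo: "(\<lambda>n. ennreal ((max 0 (deviation n / sqrt (real n) - C / sqrt (real n)))\<^sup>2))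
      \<longlonglongrightarrow> ennreal ((max 0 (limit_std_dev - 0))\<^sup>2)"
    by (intro tendsto_intros C deviation_tendsto tendsto_ennrealI tendsto_max)
  have up: "(\<lambda>n. ennreal ((deviation n / sqrt (real n) + C / sqrt (real n))\<^sup>2))
      \<longlonglongrightarrow> ennreal ((limit_std_dev + 0)\<^sup>2)"
    by (intro tendsto_intros C deviation_tendsto tendsto_ennrealI)
  show ?thesis
  proof (rule tendsto_sandwich)
    show "(\<lambda>n. ennreal ((max 0 (deviation n / sqrt (real n) - C / sqrt (real n)))\<^sup>2))
        \<longlonglongrightarrow> ennreal (limit_std_dev\<^sup>2)"
      using lo limit_std_dev_nonneg by (simp add: max_absorb2)
    show "(\<lambda>n. ennreal ((deviation n / sqrt (real n) + C / sqrt (real n))\<^sup>2)) \<longlonglongrightarrow> ennreal (limit_std_dev\<^sup>2)"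
      using up by simp
    show "\<forall>\<^sub>F n in sequentially.
        ennreal ((max 0 (deviation n / sqrt (real n) - C / sqrt (real n)))\<^sup>2) \<le> u n / of_nat n"
    proof (rule eventually_sequentiallyI[of 1])
      fix n :: nat assume n: "1 \<le> n"
      have "max 0 (deviation n / sqrt (real n) - C / sqrt (real n)) = max 0 (deviation n - C) / sqrt (real n)"
        using n by (auto simp: max_def field_simps)
      then show "ennreal ((max 0 (deviation n / sqrt (real n) - C / sqrt (real n)))\<^sup>2) \<le> u n / of_nat n"
        using divide_right_mono_ennreal[OF lower[of n], of "of_nat n"] by (simp only: div[OF n])
    qed
    show "\<forall>\<^sub>F n in sequentially.
        u n / of_nat n \<le> ennreal ((deviation n / sqrt (real n) + C / sqrt (real n))\<^sup>2)"
    proof (rule eventually_sequentiallyI[of 1])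
      fix n :: nat assume n: "1 \<le> n"
      show "u n / of_nat n \<le> ennreal ((deviation n / sqrt (real n) + C / sqrt (real n))\<^sup>2)"
        using divide_right_mono_ennreal[OF upper[of n], of "of_nat n"]
        by (simp only: div[OF n] add_divide_distrib[symmetric])
    qed
  qed
qed

text \<open>The central limit theorem for the process persists under perturbations bounded in \<open>L\<^sup>2\<close>.\<close>

lemma clt_perturbation:
  assumes Z: "\<And>n. Z n \<in> borel_measurable M" and D: "\<And>n. sq_int M (D n)" "\<And>n. l2 M (D n) \<le> C"
    and ZX: "\<And>n \<omega>. \<omega> \<in> space M \<Longrightarrow> \<bar>Z n \<omega> - X 0 n \<omega>\<bar> \<le> D n \<omega>"
  shows "clt_holds M drift limit_std_dev Z"
  unfolding clt_holds_def
proof (rule levy_continuity)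
  fix n
  have [measurable]: "Z n \<in> borel_measurable M" by (rule Z)
  show "real_distribution (distr M borel (\<lambda>\<omega>. (Z n \<omega> - real n * drift) / sqrt (real n)))"
    by (rule real_distribution_distr) simp
next
  show "real_distribution (centered_normal limit_std_dev)"
    by (rule real_distribution_centered_normal[OF limit_std_dev_nonneg])
next
  fix t
  define \<psi> where "\<psi> n = char (distr M borel (\<lambda>\<omega>. (Z n \<omega> - real n * drift) / sqrt (real n))) t" for n
  define \<phi> where "\<phi> n = char (distr M borel (\<lambda>\<omega>. X_centered 0 n \<omega> / sqrt (real n))) t" for n
  have "(\<lambda>n. \<psi> n - \<phi> n) \<longlonglongrightarrow> 0"
  proof (rule Lim_null_comparison[OF _ const_over_sqrt_tendsto[of "\<bar>t\<bar> * (C + K)"]], rule always_eventually, rule allI)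
    fix n
    have [measurable]: "Z n \<in> borel_measurable M" by (rule Z)
    have ZX_sq: "sq_int M (\<lambda>\<omega>. Z n \<omega> - X 0 n \<omega>)"
      by (rule sq_int_bound[OF D(1)[of n] _ order_trans[OF ZX abs_ge_self]]) measurable
    have "sq_int M (\<lambda>\<omega>. (Z n \<omega> - X 0 n \<omega>) + X 0 n \<omega>)" by (intro sq_int_add ZX_sq X_sq)
    then have Z_sq: "sq_int M (Z n)" by simp
    have "cmod (\<psi> n - \<phi> n) \<le> \<bar>t\<bar> * l2 M (\<lambda>\<omega>. (Z n \<omega> - real n * drift) / sqrt (real n) - X_centered 0 n \<omega> / sqrt (real n))"
      unfolding \<psi>_def \<phi>_def
      by (intro char_distr_diff_le sq_int_divide sq_int_diff Z_sq sq_int_const X_centered_sq)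
    also have "(\<lambda>\<omega>. (Z n \<omega> - real n * drift) / sqrt (real n) - X_centered 0 n \<omega> / sqrt (real n)) =
        (\<lambda>\<omega>. ((Z n \<omega> - X 0 n \<omega>) + (mean n - real n * drift)) / sqrt (real n))"
      by (auto simp: X_centered_def diff_divide_distrib[symmetric])
    also have "l2 M \<dots> = l2 M (\<lambda>\<omega>. (Z n \<omega> - X 0 n \<omega>) + (mean n - real n * drift)) / sqrt (real n)"
      by (simp add: l2_divide)
    also have "\<dots> \<le> (C + K) / sqrt (real n)"
    proof (rule divide_right_mono)
      have "l2 M (\<lambda>\<omega>. Z n \<omega> - X 0 n \<omega>) \<le> l2 M (D n)"
        by (rule l2_mono[OF D(1) sq_int_measurable[OF ZX_sq] order_trans[OF ZX abs_ge_self]])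
      then show "l2 M (\<lambda>\<omega>. (Z n \<omega> - X 0 n \<omega>) + (mean n - real n * drift)) \<le> C + K"
        using l2_triangle[OF ZX_sq sq_int_const[of "mean n - real n * drift"]] mean_drift[of n] D(2)[of n]
        by (simp add: l2_const)
    qed simp
    finally show "norm (\<psi> n - \<phi> n) \<le> \<bar>t\<bar> * (C + K) / sqrt (real n)"
      by (simp add: mult_left_mono)
  qed
  from tendsto_add[OF this char_X_centered_tendsto[of t]]
  show "(\<lambda>n. char (distr M borel (\<lambda>\<omega>. (Z n \<omega> - real n * drift) / sqrt (real n))) t)
      \<longlonglongrightarrow> char (centered_normal limit_std_dev) t"
    by (simp add: \<psi>_def \<phi>_def)
qed

lemma AE_drift:
  assumes \<xi>: "\<And>n. sq_int M (\<xi> n)" and \<xi>_bound: "\<And>n. l2 M (\<xi> n) \<le> C"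
    and \<xi>_nonneg: "\<And>n \<omega>. \<omega> \<in> space M \<Longrightarrow> 0 \<le> \<xi> n \<omega>"
    and incr: "\<And>k n \<omega>. \<omega> \<in> space M \<Longrightarrow> k \<le> n \<Longrightarrow> \<bar>X 0 n \<omega> - X 0 k \<omega>\<bar> \<le> (\<Sum>i\<in>{k<..n}. \<xi> i \<omega>)"
  shows "AE \<omega> in M. (\<lambda>n. X 0 n \<omega> / real n) \<longlonglongrightarrow> drift"
proof -
  have "Bseq (\<lambda>n. deviation n / sqrt (real n))"
    using deviation_tendsto by (intro convergent_imp_Bseq) (auto simp: convergent_def)
  then obtain B where B: "0 < B" "\<And>n. \<bar>deviation n / sqrt (real n)\<bar> \<le> B"
    by (auto simp: Bseq_def)
  have C: "0 \<le> C" using \<xi>_bound[of 0] l2_nonneg[of M "\<xi> 0"] by linarith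
  have "AE \<omega> in M. (\<lambda>n. (X 0 n \<omega> - real n * drift) / real n) \<longlonglongrightarrow> 0"
  proof (rule AE_tendsto_zero_of_second_moment[where \<xi> = "\<lambda>n \<omega>. \<xi> n \<omega> + \<bar>drift\<bar>" and C = "B + C + \<bar>drift\<bar>"])
    fix n
    show "sq_int M (\<lambda>\<omega>. X 0 n \<omega> - real n * drift)" by (intro sq_int_diff X_sq sq_int_const)
    show "sq_int M (\<lambda>\<omega>. \<xi> n \<omega> + \<bar>drift\<bar>)" by (intro sq_int_add \<xi> sq_int_const)
    have "l2 M (\<lambda>\<omega>. \<xi> n \<omega> + \<bar>drift\<bar>) \<le> l2 M (\<xi> n) + \<bar>drift\<bar>"
      using l2_triangle[OF \<xi> sq_int_const, of n "\<bar>drift\<bar>"] by (simp add: l2_const)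
    then show "l2 M (\<lambda>\<omega>. \<xi> n \<omega> + \<bar>drift\<bar>) \<le> B + C + \<bar>drift\<bar>"
      using \<xi>_bound[of n] B(1) by linarith
    assume "1 \<le> n"
    then have "deviation n \<le> B * sqrt (real n)"
      using B(2)[of n] by (simp add: abs_divide divide_le_eq)
    also have "\<dots> \<le> (B + C + \<bar>drift\<bar>) * sqrt (real n)" using C by (intro mult_right_mono) auto
    finally show "l2 M (\<lambda>\<omega>. X 0 n \<omega> - real n * drift) \<le> (B + C + \<bar>drift\<bar>) * sqrt (real n)"
      by (simp add: deviation_def)
  next
    fix n \<omega> assume "\<omega> \<in> space M"
    then show "0 \<le> \<xi> n \<omega> + \<bar>drift\<bar>" using \<xi>_nonneg[of \<omega> n] by simp
  next
    fix k n \<omega> assume \<omega>: "\<omega> \<in> space M" and kn: "(k::nat) \<le> n"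
    have "\<bar>(X 0 n \<omega> - real n * drift) - (X 0 k \<omega> - real k * drift)\<bar>
        \<le> \<bar>X 0 n \<omega> - X 0 k \<omega>\<bar> + \<bar>(real n - real k) * drift\<bar>"
      by (simp add: left_diff_distrib)
    also have "\<dots> \<le> (\<Sum>i\<in>{k<..n}. \<xi> i \<omega>) + (real n - real k) * \<bar>drift\<bar>"
      using incr[OF \<omega> kn] kn by (simp add: abs_mult)
    also have "\<dots> = (\<Sum>i\<in>{k<..n}. \<xi> i \<omega> + \<bar>drift\<bar>)"
      using kn by (simp add: sum.distrib of_nat_diff)
    finally show "\<bar>(X 0 n \<omega> - real n * drift) - (X 0 k \<omega> - real k * drift)\<bar>
        \<le> (\<Sum>i\<in>{k<..n}. \<xi> i \<omega> + \<bar>drift\<bar>)" .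
  qed
  then show ?thesis
  proof eventually_elim
    case (elim \<omega>)
    have "\<forall>\<^sub>F n in sequentially. (X 0 n \<omega> - real n * drift) / real n + drift = X 0 n \<omega> / real n"
      by (rule eventually_sequentiallyI[of 1]) (simp add: field_simps)
    then show ?case
      using tendsto_add[OF elim tendsto_const[of drift]] by (simp add: filterlim_cong)
  qed
qed

end

lemma (in prob_space) clt_holds_uniform:
  assumes clt: "clt_holds M l s Z" and Z: "\<And>n. Z n \<in> borel_measurable M" and s: "0 < s" and e: "0 < e"
  shows "\<forall>\<^sub>F n in sequentially. \<forall>t.
    \<bar>prob {\<omega> \<in> space M. Z n \<omega> - real n * l \<le> t * sqrt (real n)}
       - cdf std_normal_distribution (t / s)\<bar> \<le> 2 * e"
proof -
  define N where "N n = distr M borel (\<lambda>\<omega>. (Z n \<omega> - real n * l) / sqrt (real n))" for n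
  have [measurable]: "Z n \<in> borel_measurable M" for n by (rule Z)
  interpret N: real_distribution "N n" for n
    unfolding N_def by (rule real_distribution_distr) simp
  interpret S: real_distribution std_normal_distribution by (rule real_dist_normal_dist)
  let ?G = "\<lambda>t. cdf std_normal_distribution (t / s)"
  have cont: "isCont ?G t" for t
    using isCont_o2[where f = "\<lambda>t. t / s" and g = "cdf std_normal_distribution" and a = t]
      isCont_cdf_std_normal[of "t / s"] s by simp
  have G_eq: "cdf (centered_normal s) = ?G" by (rule ext) (rule cdf_centered_normal[OF s])
  have "\<forall>\<^sub>F n in sequentially. \<forall>t. \<bar>cdf (N n) t - ?G t\<bar> \<le> 2 * e"
  proof (rule uniform_convergence_of_cdfs)
    show "mono (cdf (N n))" for n by (intro monoI N.cdf_nondecreasing)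
    show "mono ?G" using s by (intro monoI S.cdf_nondecreasing divide_right_mono) auto
    show "continuous_on UNIV ?G" using cont by (simp add: continuous_on_eq_continuous_at)
    have "filterlim (\<lambda>t. 1 / s * t) at_bot at_bot"
      using s by (intro filterlim_tendsto_pos_mult_at_bot[OF tendsto_const] filterlim_ident) simp
    from filterlim_compose[OF S.cdf_lim_at_bot this] show "(?G \<longlongrightarrow> 0) at_bot" by simp
    have "filterlim (\<lambda>t. 1 / s * t) at_top at_top"
      using s by (intro filterlim_tendsto_pos_mult_at_top[OF tendsto_const] filterlim_ident) simp
    from filterlim_compose[OF S.cdf_lim_at_top_prob this] show "(?G \<longlongrightarrow> 1) at_top" by simp
    show "(\<lambda>n. cdf (N n) t) \<longlonglongrightarrow> ?G t" for t
      using clt cont[of t] unfolding clt_holds_def weak_conv_m_def weak_conv_def G_eq N_def by blast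
  qed (use N.cdf_nonneg N.cdf_bounded_prob e in auto)
  moreover have "\<forall>\<^sub>F n in sequentially. (1::nat) \<le> n" by (rule eventually_ge_at_top)
  ultimately show ?thesis
  proof eventually_elim
    case (elim n)
    have "cdf (N n) t = prob {\<omega> \<in> space M. Z n \<omega> - real n * l \<le> t * sqrt (real n)}" for t
    proof -
      have "(\<lambda>\<omega>. (Z n \<omega> - real n * l) / sqrt (real n)) -` {..t} \<inter> space M =
          {\<omega> \<in> space M. Z n \<omega> - real n * l \<le> t * sqrt (real n)}"
        using elim(2) by (auto simp: pos_divide_le_eq)
      then show ?thesis unfolding cdf_def N_def by (subst measure_distr) auto
    qed
    then show ?case using elim(1) by simp
  qed
qed

section \<open>Products over blocks of indices\<close>

text \<open>The product of the factors with indices in \<open>{a<..a + n}\<close>, the factor of largest index on the left,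
  as a function of a deterministic sequence of matrices.\<close>

primrec block_prod :: "(nat \<Rightarrow> real^'d^'d) \<Rightarrow> nat \<Rightarrow> nat \<Rightarrow> real^'d^'d" where
  "block_prod y a 0 = mat 1"
| "block_prod y a (Suc n) = y (a + Suc n) ** block_prod y a n"

lemma rand_prod_eq_block_prod: "rand_prod Y n \<omega> = block_prod (\<lambda>i. Y i \<omega>) 0 n"
  by (induction n) simp_all

lemma block_prod_add: "block_prod y a (n + m) = block_prod y (a + n) m ** block_prod y a n"
  by (induction m) (simp_all add: matrix_mul_assoc add.assoc)

lemma block_prod_restrict:
  "{a<..a + n} \<subseteq> I \<Longrightarrow> block_prod (restrict y I) a n = block_prod y a n"
proof (induction n)
  case (Suc n)
  moreover have "{a<..a + n} \<subseteq> I" using Suc.prems by auto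
  moreover have "a + Suc n \<in> I" using Suc.prems by auto
  ultimately show ?case by simp
qed simp

lemma block_prod_G_set:
  "(\<And>i. i \<in> {a<..a + n} \<Longrightarrow> y i \<in> G_set) \<Longrightarrow> block_prod y a n \<in> G_set"
  by (induction n) (auto intro: G_set_one G_set_mult)

lemma measurable_block_prod:
  "{a<..a + n} \<subseteq> I \<Longrightarrow> (\<lambda>y. block_prod y a n) \<in> (\<Pi>\<^sub>M i\<in>I. G_borel) \<rightarrow>\<^sub>M (G_borel :: (real^'d^'d) measure)"
proof (induction n)
  case 0
  then show ?case by (simp add: space_G_borel G_set_one)
next
  case (Suc n)
  have [measurable]: "(\<lambda>y. block_prod y a n) \<in> (\<Pi>\<^sub>M i\<in>I. G_borel) \<rightarrow>\<^sub>M (G_borel :: (real^'d^'d) measure)"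
    using Suc.prems by (intro Suc.IH) auto
  have "a + Suc n \<in> I" using Suc.prems by auto
  then have [measurable]: "(\<lambda>y. y (a + Suc n)) \<in> (\<Pi>\<^sub>M i\<in>I. G_borel) \<rightarrow>\<^sub>M (G_borel :: (real^'d^'d) measure)"
    by (rule measurable_component_singleton)
  have "(\<lambda>y. (\<lambda>(g, h). g ** h) (y (a + Suc n), block_prod y a n))
      \<in> (\<Pi>\<^sub>M i\<in>I. G_borel) \<rightarrow>\<^sub>M (G_borel :: (real^'d^'d) measure)"
    by measurable
  then show ?case by simp
qed

text \<open>Independent factors with common law \<open>\<mu>\<close>; only indices from \<open>1\<close> on are considered.\<close>

locale contracting_products = prob_space P for P :: "'w measure" +
  fixes \<mu> :: "(real^'d^'d) measure" and Y :: "nat \<Rightarrow> 'w \<Rightarrow> real^'d^'d"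
  assumes iid: "iid_seq P \<mu> Y"
    and contracting: "strictly_contracting \<mu>"
    and moment: "has_moment 2 \<mu>"
begin

lemma Y_indep: "indep_vars (\<lambda>_. G_borel) Y {1..}"
  using iid by (simp add: iid_seq_def)

lemma Y_measurable: "1 \<le> n \<Longrightarrow> Y n \<in> P \<rightarrow>\<^sub>M G_borel"
  using Y_indep by (auto simp: indep_vars_def)

lemma Y_law: "1 \<le> n \<Longrightarrow> distr P G_borel (Y n) = \<mu>"
  using iid by (simp add: iid_seq_def)

lemma Y_G_set: "1 \<le> n \<Longrightarrow> \<omega> \<in> space P \<Longrightarrow> Y n \<omega> \<in> G_set"
  using measurable_space[OF Y_measurable] by (simp add: space_G_borel)

text \<open>The random product over the block \<open>{a<..a + n}\<close>.\<close>

definition Yprod :: "nat \<Rightarrow> nat \<Rightarrow> 'w \<Rightarrow> real^'d^'d" where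
  "Yprod a n \<omega> = block_prod (\<lambda>i. Y i \<omega>) a n"

lemma Yprod_add: "Yprod a (n + m) \<omega> = Yprod (a + n) m \<omega> ** Yprod a n \<omega>"
  by (simp add: Yprod_def block_prod_add)

lemma Yprod_G_set: "\<omega> \<in> space P \<Longrightarrow> Yprod a n \<omega> \<in> G_set"
  unfolding Yprod_def by (rule block_prod_G_set) (auto intro: Y_G_set)

text \<open>The events that depend only on the factors with index in \<open>I\<close>.\<close>

definition info :: "nat set \<Rightarrow> 'w measure" where
  "info I = vimage_algebra (space P) (\<lambda>\<omega>. \<lambda>i\<in>I. Y i \<omega>) (\<Pi>\<^sub>M i\<in>I. G_borel)"

lemma measurable_restrict_Y:
  "I \<subseteq> {1..} \<Longrightarrow> (\<lambda>\<omega>. \<lambda>i\<in>I. Y i \<omega>) \<in> P \<rightarrow>\<^sub>M (\<Pi>\<^sub>M i\<in>I. G_borel)"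
  by (intro measurable_restrict Y_measurable) auto

lemma sets_info:
  assumes "I \<subseteq> {1..}"
  shows "sets (info I) = {(\<lambda>\<omega>. \<lambda>i\<in>I. Y i \<omega>) -` A \<inter> space P | A. A \<in> sets (\<Pi>\<^sub>M i\<in>I. G_borel)}"
  unfolding info_def using measurable_space[OF measurable_restrict_Y[OF assms]]
  by (intro sets_vimage_algebra2) auto

lemma space_info: "space (info I) = space P"
  by (simp add: info_def)

lemma sets_info_events: "I \<subseteq> {1..} \<Longrightarrow> sets (info I) \<subseteq> events"
  using measurable_sets[OF measurable_restrict_Y] by (auto simp: sets_info)

lemma sets_info_mono:
  assumes IJ: "I \<subseteq> J" and J: "J \<subseteq> {1..}"
  shows "sets (info I) \<subseteq> sets (info J)"
proof
  fix B assume "B \<in> sets (info I)"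
  then obtain A where A: "A \<in> sets (\<Pi>\<^sub>M i\<in>I. (G_borel :: (real^'d^'d) measure))"
    and B: "B = (\<lambda>\<omega>. \<lambda>i\<in>I. Y i \<omega>) -` A \<inter> space P"
    using IJ J by (auto simp: sets_info)
  let ?r = "\<lambda>y :: nat \<Rightarrow> real^'d^'d. restrict y I"
  have r: "?r \<in> (\<Pi>\<^sub>M i\<in>J. G_borel) \<rightarrow>\<^sub>M (\<Pi>\<^sub>M i\<in>I. G_borel)"
    by (rule measurable_restrict_subset[OF IJ])
  have eq: "(\<lambda>i\<in>I. Y i \<omega>) = ?r (\<lambda>i\<in>J. Y i \<omega>)" for \<omega>
    using IJ by (auto simp: restrict_def fun_eq_iff)
  have "B = (\<lambda>\<omega>. \<lambda>i\<in>J. Y i \<omega>) -` (?r -` A \<inter> space (\<Pi>\<^sub>M i\<in>J. G_borel)) \<inter> space P"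
    unfolding B using measurable_space[OF measurable_restrict_Y[OF J]] by (auto simp: eq)
  then show "B \<in> sets (info J)"
    using measurable_sets[OF r A] unfolding sets_info[OF J] by blast
qed

lemma indep_info:
  assumes "I \<inter> J = {}" "I \<subseteq> {1..}" "J \<subseteq> {1..}"
  shows "indep_set (sets (info I)) (sets (info J))"
proof -
  have "indep_var (\<Pi>\<^sub>M i\<in>I. G_borel) (\<lambda>\<omega>. \<lambda>i\<in>I. Y i \<omega>) (\<Pi>\<^sub>M i\<in>J. G_borel) (\<lambda>\<omega>. \<lambda>i\<in>J. Y i \<omega>)"
    by (rule indep_var_restrict[OF Y_indep assms])
  then show ?thesis
    unfolding indep_var_eq indep_set_def sets_info[OF assms(2)] sets_info[OF assms(3)]
    by (elim conjE indep_sets_mono_sets) (auto split: bool.splits)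
qed

lemma Yprod_info: "{a<..a + n} \<subseteq> I \<Longrightarrow> I \<subseteq> {1..} \<Longrightarrow> Yprod a n \<in> info I \<rightarrow>\<^sub>M G_borel"
proof -
  assume I: "{a<..a + n} \<subseteq> I" "I \<subseteq> {1..}"
  have "(\<lambda>\<omega>. \<lambda>i\<in>I. Y i \<omega>) \<in> info I \<rightarrow>\<^sub>M (\<Pi>\<^sub>M i\<in>I. G_borel)"
    unfolding info_def using measurable_space[OF measurable_restrict_Y[OF I(2)]]
    by (intro measurable_vimage_algebra1) auto
  from measurable_compose[OF this measurable_block_prod[OF I(1)]]
  show ?thesis by (simp add: block_prod_restrict[OF I(1)] Yprod_def[abs_def])
qed

lemma Yprod_measurable [measurable]: "Yprod a n \<in> P \<rightarrow>\<^sub>M G_borel"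
  by (rule measurable_from_subalg[OF _ Yprod_info[of a n "{a<..a + n}"]])
     (auto simp: subalgebra_def space_info intro!: sets_info_events)

lemma indep_Y_Yprod: "indep_var G_borel (Y (a + Suc n)) G_borel (Yprod a n)"
proof -
  let ?I = "{a + Suc n}" and ?J = "{a<..a + n}"
  have "indep_var (\<Pi>\<^sub>M i\<in>?I. G_borel) (\<lambda>\<omega>. \<lambda>i\<in>?I. Y i \<omega>) (\<Pi>\<^sub>M i\<in>?J. G_borel) (\<lambda>\<omega>. \<lambda>i\<in>?J. Y i \<omega>)"
    by (rule indep_var_restrict[OF Y_indep]) auto
  then have "indep_var G_borel ((\<lambda>y. y (a + Suc n)) \<circ> (\<lambda>\<omega>. \<lambda>i\<in>?I. Y i \<omega>))
      G_borel ((\<lambda>y. block_prod y a n) \<circ> (\<lambda>\<omega>. \<lambda>i\<in>?J. Y i \<omega>))"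
    by (rule indep_var_compose) (auto intro!: measurable_block_prod)
  then show ?thesis by (simp add: comp_def block_prod_restrict Yprod_def[abs_def])
qed

text \<open>Induction on \<open>n\<close>, splitting off the leftmost factor as in the definition of \<^const>\<open>conv_power\<close>.\<close>

lemma Yprod_law: "distr P G_borel (Yprod a n) = conv_power \<mu> n"
proof (induction n)
  case 0
  show ?case by (simp add: Yprod_def[abs_def] distr_const space_G_borel G_set_one)
next
  case (Suc n)
  have [measurable]: "Y (a + Suc n) \<in> P \<rightarrow>\<^sub>M G_borel" by (rule Y_measurable) simp
  have joint: "distr P (G_borel \<Otimes>\<^sub>M G_borel) (\<lambda>\<omega>. (Y (a + Suc n) \<omega>, Yprod a n \<omega>)) = \<mu> \<Otimes>\<^sub>M conv_power \<mu> n"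
    using indep_Y_Yprod[of a n] Y_law[of "a + Suc n"] Suc by (simp add: indep_var_distribution_eq)
  have pair: "(\<lambda>\<omega>. (Y (a + Suc n) \<omega>, Yprod a n \<omega>)) \<in> P \<rightarrow>\<^sub>M G_borel \<Otimes>\<^sub>M G_borel"
    by measurable
  have "Yprod a (Suc n) = (\<lambda>(g, h). g ** h) \<circ> (\<lambda>\<omega>. (Y (a + Suc n) \<omega>, Yprod a n \<omega>))"
    by (auto simp: Yprod_def)
  then have "distr P G_borel (Yprod a (Suc n)) =
      distr (distr P (G_borel \<Otimes>\<^sub>M G_borel) (\<lambda>\<omega>. (Y (a + Suc n) \<omega>, Yprod a n \<omega>))) G_borel (\<lambda>(g, h). g ** h)"
    by (simp only: distr_distr[OF measurable_G_mult pair])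
  then show ?case by (simp only: joint mat_convolution_def conv_power.simps)
qed

section \<open>Second moments of products\<close>

text \<open>The quantity \<open>log N\<close> of the \<open>i\<close>-th factor. Index \<open>0\<close> carries no factor and gets the value \<open>0\<close>, so
  that the bounds below hold for every index.\<close>

definition log_size :: "nat \<Rightarrow> 'w \<Rightarrow> real" where
  "log_size i \<omega> = (if i = 0 then 0 else ln (N_max (Y i \<omega>)))"

lemma log_size_nonneg: "\<omega> \<in> space P \<Longrightarrow> 0 \<le> log_size i \<omega>"
  using ln_N_max_bounds(1)[OF Y_G_set[of i \<omega>]] by (auto simp: log_size_def)

text \<open>The \<open>L\<^sup>2\<close> norm of \<open>log N\<close> under the law of the factors.\<close>

definition size_bound :: real where
  "size_bound = l2 \<mu> (\<lambda>g. ln (N_max g))"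

lemma sets_mu: "sets \<mu> = sets G_borel"
  using Y_law[of 1] by (metis order_refl sets_distr)

lemma log_size_sq: "sq_int P (log_size i)" and log_size_l2: "l2 P (log_size i) \<le> size_bound"
proof -
  have "sq_int P (log_size i) \<and> l2 P (log_size i) \<le> size_bound"
  proof (cases "i = 0")
    case True
    then show ?thesis
      by (simp add: log_size_def[abs_def] sq_int_const l2_const size_bound_def l2_nonneg)
  next
    case False
    then have [measurable]: "Y i \<in> P \<rightarrow>\<^sub>M G_borel" by (intro Y_measurable) simp
    have law: "distr P G_borel (Y i) = \<mu>" using False by (intro Y_law) simp
    have eq: "log_size i = (\<lambda>\<omega>. ln (N_max (Y i \<omega>)))" using False by (simp add: log_size_def[abs_def])
    have "(\<integral>\<^sup>+g. ennreal ((ln (N_max g))\<^sup>2) \<partial>\<mu>) = (\<integral>\<^sup>+g. ennreal (ln (N_max g) powr 2) \<partial>\<mu>)"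
    proof (rule nn_integral_cong)
      fix g assume "g \<in> space \<mu>"
      then have "g \<in> G_set" using sets_eq_imp_space_eq[OF sets_mu] by (simp add: space_G_borel)
      then have "0 \<le> ln (N_max g)" by (rule ln_N_max_bounds)
      then show "ennreal ((ln (N_max g))\<^sup>2) = ennreal (ln (N_max g) powr 2)"
        by (cases "ln (N_max g) = 0") (auto simp: powr_numeral)
    qed
    also have "\<dots> < \<infinity>" using moment by (simp add: has_moment_def)
    finally have "integrable \<mu> (\<lambda>g. (ln (N_max g))\<^sup>2)"
      using sets_mu by (intro integrableI_nonneg) (auto cong: measurable_cong_sets)
    then have "integrable P (\<lambda>\<omega>. (ln (N_max (Y i \<omega>)))\<^sup>2)"
      unfolding law[symmetric] by (subst (asm) integrable_distr_eq) auto
    moreover have "l2 P (\<lambda>\<omega>. ln (N_max (Y i \<omega>))) = size_bound"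
    proof -
      have "(\<integral>g. (ln (N_max g))\<^sup>2 \<partial>distr P G_borel (Y i)) = (\<integral>\<omega>. (ln (N_max (Y i \<omega>)))\<^sup>2 \<partial>P)"
        by (rule integral_distr) auto
      then show ?thesis by (simp add: size_bound_def l2_def law)
    qed
    ultimately show ?thesis by (simp add: eq sq_int_def)
  qed
  then show "sq_int P (log_size i)" "l2 P (log_size i) \<le> size_bound" by auto
qed

text \<open>The logarithmic norm of a product over a block, which is the almost additive process of interest,
  and the logarithmic ratio of its extreme column sums, which bounds the additivity error.\<close>

definition log_norm :: "nat \<Rightarrow> nat \<Rightarrow> 'w \<Rightarrow> real" where
  "log_norm a n \<omega> = ln (l1_opnorm (Yprod a n \<omega>))"

definition log_ratio_Y :: "nat \<Rightarrow> nat \<Rightarrow> 'w \<Rightarrow> real" where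
  "log_ratio_Y a n \<omega> = log_ratio (Yprod a n \<omega>)"

lemma ln_Yprod_bounds:
  assumes \<omega>: "\<omega> \<in> space P"
  shows "ln (l1_opnorm (Yprod a n \<omega>)) \<le> (\<Sum>i\<in>{a<..a + n}. log_size i \<omega>)"
    and "- (\<Sum>i\<in>{a<..a + n}. log_size i \<omega>) \<le> ln (v_min (Yprod a n \<omega>))"
proof -
  have "ln (l1_opnorm (Yprod a n \<omega>)) \<le> (\<Sum>i\<in>{a<..a + n}. log_size i \<omega>) \<and>
    - (\<Sum>i\<in>{a<..a + n}. log_size i \<omega>) \<le> ln (v_min (Yprod a n \<omega>))"
  proof (induction n)
    case 0
    have "col_sum (mat 1 :: real^'d^'d) j = 1" for j
      by (simp add: col_sum_def mat_def)
    then have "l1_opnorm (mat 1 :: real^'d^'d) = 1" "v_min (mat 1 :: real^'d^'d) = 1"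
      using l1_opnorm_attained[OF G_set_one] v_min_attained[OF G_set_one] by metis+
    then show ?case by (simp add: Yprod_def)
  next
    case (Suc n)
    have Y: "Y (a + Suc n) \<omega> \<in> G_set" using \<omega> by (intro Y_G_set) simp
    have "{a<..a + Suc n} = insert (a + Suc n) {a<..a + n}" by auto
    then have sum: "(\<Sum>i\<in>{a<..a + Suc n}. log_size i \<omega>) =
        ln (N_max (Y (a + Suc n) \<omega>)) + (\<Sum>i\<in>{a<..a + n}. log_size i \<omega>)"
      by (simp add: log_size_def)
    have "Yprod a (Suc n) \<omega> = Y (a + Suc n) \<omega> ** Yprod a n \<omega>" by (simp add: Yprod_def)
    then show ?case
      using ln_l1_opnorm_mult_bounds[OF Y Yprod_G_set[OF \<omega>], of a n] ln_N_max_bounds[OF Y] Suc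
      unfolding sum by simp linarith
  qed
  then show "ln (l1_opnorm (Yprod a n \<omega>)) \<le> (\<Sum>i\<in>{a<..a + n}. log_size i \<omega>)"
    "- (\<Sum>i\<in>{a<..a + n}. log_size i \<omega>) \<le> ln (v_min (Yprod a n \<omega>))" by auto
qed

lemma ln_Yprod_order: "\<omega> \<in> space P \<Longrightarrow> ln (v_min (Yprod a n \<omega>)) \<le> ln (l1_opnorm (Yprod a n \<omega>))"
  using Yprod_G_set[of \<omega> a n] by (intro ln_mono v_min_le_l1_opnorm v_min_pos)

lemma abs_log_norm_le: "\<omega> \<in> space P \<Longrightarrow> \<bar>log_norm a n \<omega>\<bar> \<le> (\<Sum>i\<in>{a<..a + n}. log_size i \<omega>)"
  using ln_Yprod_bounds[of \<omega> a n] ln_Yprod_order[of \<omega> a n] by (simp add: log_norm_def abs_le_iff)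

lemma log_ratio_Y_le:
  "\<omega> \<in> space P \<Longrightarrow> log_ratio_Y a n \<omega> \<le> 2 * (\<Sum>i\<in>{a<..a + n}. log_size i \<omega>)"
  using ln_Yprod_bounds[of \<omega> a n] by (simp add: log_ratio_Y_def log_ratio_def)

lemma log_ratio_Y_nonneg: "\<omega> \<in> space P \<Longrightarrow> 0 \<le> log_ratio_Y a n \<omega>"
  unfolding log_ratio_Y_def by (rule log_ratio_nonneg[OF Yprod_G_set])

lemma sum_log_size_sq: "sq_int P (\<lambda>\<omega>. \<Sum>i\<in>I. log_size i \<omega>)"
  by (intro sq_int_sum log_size_sq)

lemma l2_sum_log_size: "finite I \<Longrightarrow> l2 P (\<lambda>\<omega>. \<Sum>i\<in>I. log_size i \<omega>) \<le> real (card I) * size_bound"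
  using l2_sum_le[of I log_size, OF log_size_sq] sum_mono[of I "\<lambda>i. l2 P (log_size i)" "\<lambda>i. size_bound"]
    log_size_l2 by simp

lemma log_norm_sq: "sq_int P (log_norm a n)"
  by (rule sq_int_bound[OF sum_log_size_sq[of "{a<..a + n}"] _ order_trans[OF abs_log_norm_le abs_ge_self]])
     (simp add: log_norm_def[abs_def])

lemma log_ratio_Y_sq: "sq_int P (log_ratio_Y a n)"
proof (rule sq_int_bound[OF sq_int_cmult[OF sum_log_size_sq[of "{a<..a + n}"], of 2]])
  show "log_ratio_Y a n \<in> borel_measurable P" by (simp add: log_ratio_Y_def[abs_def])
  fix \<omega> assume "\<omega> \<in> space P"
  then show "\<bar>log_ratio_Y a n \<omega>\<bar> \<le> \<bar>2 * (\<Sum>i\<in>{a<..a + n}. log_size i \<omega>)\<bar>"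
    using log_ratio_Y_nonneg[of \<omega> a n] log_ratio_Y_le[of \<omega> a n] by linarith
qed

lemma l2_log_ratio_Y: "l2 P (log_ratio_Y a n) \<le> 2 * (real n * size_bound)"
proof -
  have "l2 P (log_ratio_Y a n) \<le> l2 P (\<lambda>\<omega>. 2 * (\<Sum>i\<in>{a<..a + n}. log_size i \<omega>))"
  proof (rule l2_mono[OF sq_int_cmult[OF sum_log_size_sq]])
    show "log_ratio_Y a n \<in> borel_measurable P" by (simp add: log_ratio_Y_def[abs_def])
    fix \<omega> assume "\<omega> \<in> space P"
    then show "\<bar>log_ratio_Y a n \<omega>\<bar> \<le> \<bar>2 * (\<Sum>i\<in>{a<..a + n}. log_size i \<omega>)\<bar>"
      using log_ratio_Y_nonneg[of \<omega> a n] log_ratio_Y_le[of \<omega> a n] by linarith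
  qed
  also have "\<dots> \<le> 2 * (real n * size_bound)"
    using l2_sum_log_size[of "{a<..a + n}"] by (simp add: l2_cmult)
  finally show ?thesis .
qed

section \<open>The contraction bound\<close>

lemma exists_balanced_step:
  "\<exists>r C. 1 \<le> r \<and> 1 \<le> C \<and> 0 < measure (conv_power \<mu> r) (row_balanced C)"
proof -
  obtain r where r: "1 \<le> r" "0 < emeasure (conv_power \<mu> r) G_plus"
    using contracting by (auto simp: strictly_contracting_def)
  interpret Q: prob_space "conv_power \<mu> r"
    unfolding Yprod_law[of 0 r, symmetric] by (rule prob_space_distr) simp
  have sets: "sets (conv_power \<mu> r) = sets G_borel"
    unfolding Yprod_law[of 0 r, symmetric] by simp
  have rb: "row_balanced C \<in> sets (conv_power \<mu> r)" for C
    unfolding sets by (rule row_balanced_sets)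
  have "\<exists>k. 0 < measure (conv_power \<mu> r) (row_balanced (real (Suc k)))"
  proof (rule ccontr)
    assume "\<nexists>k. 0 < measure (conv_power \<mu> r) (row_balanced (real (Suc k)))"
    then have "measure (conv_power \<mu> r) (row_balanced (real (Suc k))) = 0" for k
      by (metis zero_less_measure_iff)
    then have "emeasure (conv_power \<mu> r) (row_balanced (real (Suc k))) = 0" for k
      by (simp add: Q.emeasure_eq_measure)
    then have "emeasure (conv_power \<mu> r) (\<Union>k. row_balanced (real (Suc k))) = 0"
      using rb by (intro emeasure_UN_eq_0) auto
    moreover have "emeasure (conv_power \<mu> r) G_plus \<le> emeasure (conv_power \<mu> r) (\<Union>k. row_balanced (real (Suc k)))"
      using rb by (intro emeasure_mono G_plus_subset_row_balanced) auto
    ultimately show False using r(2) by simp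
  qed
  then obtain k where "0 < measure (conv_power \<mu> r) (row_balanced (real (Suc k)))" by blast
  with r(1) show ?thesis by (intro exI[of _ r] exI[of _ "real (Suc k)"]) simp
qed

text \<open>The contraction step: the first \<open>r\<close> factors are balanced with positive probability, and then they
  alone determine a bound for the whole product.\<close>

lemma l2_log_ratio_Y_step:
  assumes C: "1 \<le> C"
  shows "l2 P (log_ratio_Y a (r + n)) \<le>
    sqrt (1 - measure (conv_power \<mu> r) (row_balanced C)) * l2 P (log_ratio_Y (a + r) n)
      + (2 * (real r * size_bound) + ln C)"
proof -
  \<comment> \<open>The indicator of the event that the first \<open>r\<close> factors are not balanced.\<close>
  define bad where "bad \<omega> = (if Yprod a r \<omega> \<in> row_balanced C then 0 else 1 :: real)" for \<omega>
  let ?D = "log_ratio_Y (a + r) n"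
  have rb [measurable]: "row_balanced C \<in> sets (G_borel :: (real^'d^'d) measure)"
    by (rule row_balanced_sets)
  have bad_measurable [measurable]: "bad \<in> borel_measurable P" unfolding bad_def[abs_def] by measurable
  have step: "log_ratio_Y a (r + n) \<omega> \<le> bad \<omega> * ?D \<omega> + (log_ratio_Y a r \<omega> + ln C)"
    if \<omega>: "\<omega> \<in> space P" for \<omega>
  proof (cases "Yprod a r \<omega> \<in> row_balanced C")
    case True
    then have "log_ratio_Y a (r + n) \<omega> \<le> ln C"
      unfolding log_ratio_Y_def Yprod_add using C
      by (intro log_ratio_mult_balanced Yprod_G_set[OF \<omega>]) auto
    then show ?thesis using log_ratio_Y_nonneg[OF \<omega>, of a r] True by (simp add: bad_def)
  next
    case False
    have "log_ratio_Y a (r + n) \<omega> \<le> ?D \<omega> + log_ratio_Y a r \<omega>"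
      unfolding log_ratio_Y_def Yprod_add by (intro log_ratio_mult_le Yprod_G_set[OF \<omega>])
    moreover have "0 \<le> ln C" using C by simp
    ultimately show ?thesis using False by (simp add: bad_def)
  qed
  have bad_D: "sq_int P (\<lambda>\<omega>. bad \<omega> * ?D \<omega>)"
    by (rule sq_int_bound[OF log_ratio_Y_sq[of "a + r" n]])
       (use sq_int_measurable[OF log_ratio_Y_sq] in \<open>auto simp: bad_def\<close>)
  have "l2 P (log_ratio_Y a (r + n)) \<le> l2 P (\<lambda>\<omega>. bad \<omega> * ?D \<omega> + (log_ratio_Y a r \<omega> + ln C))"
  proof (rule l2_mono)
    show "sq_int P (\<lambda>\<omega>. bad \<omega> * ?D \<omega> + (log_ratio_Y a r \<omega> + ln C))"
      by (intro sq_int_add bad_D log_ratio_Y_sq sq_int_const)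
    show "log_ratio_Y a (r + n) \<in> borel_measurable P" by (rule sq_int_measurable[OF log_ratio_Y_sq])
    fix \<omega> assume "\<omega> \<in> space P"
    then show "\<bar>log_ratio_Y a (r + n) \<omega>\<bar> \<le> \<bar>bad \<omega> * ?D \<omega> + (log_ratio_Y a r \<omega> + ln C)\<bar>"
      using step[of \<omega>] log_ratio_Y_nonneg[of \<omega> a "r + n"] by linarith
  qed
  also have "\<dots> \<le> l2 P (\<lambda>\<omega>. bad \<omega> * ?D \<omega>) + (l2 P (log_ratio_Y a r) + l2 P (\<lambda>\<omega>. ln C))"
    using l2_triangle[OF bad_D sq_int_add[OF log_ratio_Y_sq sq_int_const], of a r "ln C"]
      l2_triangle[OF log_ratio_Y_sq sq_int_const, of a r "ln C"] by linarith
  also have "\<dots> \<le> l2 P (\<lambda>\<omega>. bad \<omega> * ?D \<omega>) + (2 * (real r * size_bound) + ln C)"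
    using l2_log_ratio_Y[of a r] C by (simp add: l2_const)
  also have "l2 P (\<lambda>\<omega>. bad \<omega> * ?D \<omega>) = sqrt (1 - measure (conv_power \<mu> r) (row_balanced C)) * l2 P ?D"
  proof -
    let ?I = "{a<..a + r}" and ?J = "{a + r<..a + r + n}"
    have indep: "indep_set (sets (info ?I)) (sets (info ?J))" by (rule indep_info) auto
    have bad_I: "bad \<in> borel_measurable (info ?I)"
    proof -
      have [measurable]: "Yprod a r \<in> info ?I \<rightarrow>\<^sub>M G_borel" by (rule Yprod_info) auto
      show ?thesis unfolding bad_def[abs_def] by measurable
    qed
    have D_J: "(\<lambda>\<omega>. (?D \<omega>)\<^sup>2) \<in> borel_measurable (info ?J)"
    proof -
      have [measurable]: "Yprod (a + r) n \<in> info ?J \<rightarrow>\<^sub>M G_borel" by (rule Yprod_info) auto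
      show ?thesis unfolding log_ratio_Y_def[abs_def] by measurable
    qed
    have ind: "indep_var borel bad borel (\<lambda>\<omega>. (?D \<omega>)\<^sup>2)"
    proof (rule indep_var_of_indep_set[OF indep space_info space_info _ _ bad_I D_J])
      show "sets (info ?I) \<subseteq> events" by (rule sets_info_events) auto
      show "sets (info ?J) \<subseteq> events" by (rule sets_info_events) auto
    qed
    have bad_int: "integrable P bad"
      by (rule integrable_const_bound[of _ 1]) (auto simp: bad_def)
    have "expectation bad = 1 - measure (conv_power \<mu> r) (row_balanced C)"
    proof -
      have "expectation bad = expectation (\<lambda>\<omega>. 1 - indicator (Yprod a r -` row_balanced C \<inter> space P) \<omega>)"
        by (intro Bochner_Integration.integral_cong) (auto simp: bad_def)
      also have "\<dots> = expectation (\<lambda>\<omega>. 1) - expectation (indicator (Yprod a r -` row_balanced C \<inter> space P))"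
        using measurable_sets[OF Yprod_measurable rb, of a r]
        by (intro Bochner_Integration.integral_diff integrable_const integrable_real_indicator)
           (simp_all add: emeasure_eq_measure)
      also have "\<dots> = 1 - prob (Yprod a r -` row_balanced C \<inter> space P)"
        by (simp add: prob_space Int_assoc)
      also have "prob (Yprod a r -` row_balanced C \<inter> space P) = measure (conv_power \<mu> r) (row_balanced C)"
        unfolding Yprod_law[of a r, symmetric] by (rule measure_distr[symmetric]) auto
      finally show ?thesis .
    qed
    moreover have "expectation (\<lambda>\<omega>. (bad \<omega> * ?D \<omega>)\<^sup>2) = expectation (\<lambda>\<omega>. bad \<omega> * (?D \<omega>)\<^sup>2)"
      by (intro Bochner_Integration.integral_cong) (auto simp: bad_def)
    moreover have "\<dots> = expectation bad * expectation (\<lambda>\<omega>. (?D \<omega>)\<^sup>2)"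
      using log_ratio_Y_sq by (intro indep_var_lebesgue_integral[OF ind bad_int]) (simp add: sq_int_def)
    ultimately show ?thesis by (simp add: l2_def real_sqrt_mult)
  qed
  finally show ?thesis by simp
qed

lemma l2_log_ratio_Y_bounded: "\<exists>K. \<forall>a n. l2 P (log_ratio_Y a n) \<le> K"
proof -
  obtain r C where r: "1 \<le> r" and C: "1 \<le> C" and pos: "0 < measure (conv_power \<mu> r) (row_balanced C)"
    using exists_balanced_step by blast
  interpret Q: prob_space "conv_power \<mu> r"
    unfolding Yprod_law[of 0 r, symmetric] by (rule prob_space_distr) simp
  define \<rho> where "\<rho> = sqrt (1 - measure (conv_power \<mu> r) (row_balanced C))"
  have \<rho>: "0 \<le> \<rho>" "\<rho> < 1" using pos Q.prob_le_1[of "row_balanced C"] by (auto simp: \<rho>_def)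
  define B where "B = 2 * (real r * size_bound) + ln C"
  have size0: "0 \<le> size_bound" by (simp add: size_bound_def l2_nonneg)
  have B: "0 \<le> B" using C size0 by (simp add: B_def)
  \<comment> \<open>The bound is the fixed point of the recursion \<open>d \<mapsto> \<rho> d + B\<close>.\<close>
  have "l2 P (log_ratio_Y a n) \<le> B / (1 - \<rho>)" for a n
  proof (induction n arbitrary: a rule: less_induct)
    case (less n)
    show ?case
    proof (cases "n < r")
      case True
      have "l2 P (log_ratio_Y a n) \<le> 2 * (real n * size_bound)" by (rule l2_log_ratio_Y)
      also have "\<dots> \<le> B" using True size0 C by (simp add: B_def mult_right_mono add_increasing2)
      also have "\<dots> \<le> B / (1 - \<rho>)" using B \<rho> by (simp add: le_divide_eq mult_left_le)
      finally show ?thesis .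
    next
      case False
      define k where "k = n - r"
      have n: "n = r + k" "k < n" using False r by (auto simp: k_def)
      have "l2 P (log_ratio_Y a n) \<le> \<rho> * l2 P (log_ratio_Y (a + r) k) + B"
        unfolding n(1) \<rho>_def B_def by (rule l2_log_ratio_Y_step[OF C])
      also have "\<dots> \<le> \<rho> * (B / (1 - \<rho>)) + B"
        by (intro add_right_mono mult_left_mono less.IH n \<rho>)
      also have "\<dots> = B / (1 - \<rho>)" using \<rho> by (simp add: field_simps)
      finally show ?thesis .
    qed
  qed
  then show ?thesis by blast
qed

text \<open>A uniform \<open>L\<^sup>2\<close> bound for the logarithmic ratios of all products.\<close>

definition ratio_bound :: real where
  "ratio_bound = (SOME K. \<forall>a n. l2 P (log_ratio_Y a n) \<le> K)"

lemma l2_log_ratio_Y_le: "l2 P (log_ratio_Y a n) \<le> ratio_bound"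
  using someI_ex[OF l2_log_ratio_Y_bounded] by (simp add: ratio_bound_def)

lemma log_norm_law: "distr P borel (log_norm a n) = distr P borel (log_norm 0 n)"
proof -
  have "distr P borel (log_norm b n) = distr (conv_power \<mu> n) borel (\<lambda>g. ln (l1_opnorm g))" for b
    unfolding Yprod_law[of b n, symmetric] by (subst distr_distr) (auto simp: comp_def log_norm_def[abs_def])
  then show ?thesis by simp
qed

lemma log_norm_blocks: "indep_vars (\<lambda>_. borel) (\<lambda>j. log_norm (j * m) m) UNIV"
proof -
  let ?I = "\<lambda>j. {j * m<..j * m + m}"
  have disj: "disjoint_family ?I"
    unfolding disjoint_family_on_def
  proof (intro ballI impI)
    fix j k :: nat assume "j \<noteq> k"
    then consider "Suc j \<le> k" | "Suc k \<le> j" by linarith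
    then show "?I j \<inter> ?I k = {}"
    proof cases
      case 1
      then have "Suc j * m \<le> k * m" by (rule mult_le_mono1)
      then show ?thesis by auto
    next
      case 2
      then have "Suc k * m \<le> j * m" by (rule mult_le_mono1)
      then show ?thesis by auto
    qed
  qed
  have "indep_vars (\<lambda>j. \<Pi>\<^sub>M i\<in>?I j. G_borel) (\<lambda>j \<omega>. \<lambda>i\<in>?I j. Y i \<omega>) UNIV"
    by (rule indep_vars_restrict[OF Y_indep _ disj]) auto
  then have "indep_vars (\<lambda>_. borel) (\<lambda>j \<omega>. ln (l1_opnorm (block_prod (\<lambda>i\<in>?I j. Y i \<omega>) (j * m) m))) UNIV"
  proof (rule indep_vars_compose2)
    fix j
    show "(\<lambda>y. ln (l1_opnorm (block_prod y (j * m) m))) \<in> borel_measurable (\<Pi>\<^sub>M i\<in>?I j. G_borel)"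
      by (intro borel_measurable_ln measurable_compose[OF measurable_block_prod[OF order_refl] measurable_l1_opnorm])
  qed
  then show ?thesis by (simp add: block_prod_restrict log_norm_def[abs_def] Yprod_def)
qed

lemma log_norm_defect:
  assumes \<omega>: "\<omega> \<in> space P"
  shows "\<bar>log_norm a (n + m) \<omega> - log_norm a n \<omega> - log_norm (a + n) m \<omega>\<bar> \<le> log_ratio_Y (a + n) m \<omega>"
  using ln_l1_opnorm_mult_bounds[OF Yprod_G_set[OF \<omega>] Yprod_G_set[OF \<omega>], of "a + n" m a n]
    log_ratio_Y_nonneg[OF \<omega>, of "a + n" m]
  by (simp add: log_norm_def log_ratio_Y_def log_ratio_def Yprod_add)

sublocale almost_additive P log_norm "\<lambda>a n. info {a<..a + n}" ratio_bound
proof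
  fix a n m
  show "space (info {a<..a + n}) = space P" by (rule space_info)
  show "sets (info {a<..a + n}) \<subseteq> events" by (rule sets_info_events) auto
  show "sets (info {a<..a + n}) \<subseteq> sets (info {a<..a + (n + m)})" by (rule sets_info_mono) auto
  show "sets (info {a + n<..a + n + m}) \<subseteq> sets (info {a<..a + (n + m)})" by (rule sets_info_mono) auto
  show "indep_set (sets (info {a<..a + n})) (sets (info {a + n<..a + n + m}))" by (rule indep_info) auto
  have [measurable]: "Yprod a n \<in> info {a<..a + n} \<rightarrow>\<^sub>M G_borel" by (rule Yprod_info) auto
  show "log_norm a n \<in> borel_measurable (info {a<..a + n})"
    unfolding log_norm_def[abs_def] by measurable
  show "distr P borel (log_norm a n) = distr P borel (log_norm 0 n)" by (rule log_norm_law)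
  show "sq_int P (log_norm 0 n)" by (rule log_norm_sq)
  show "indep_vars (\<lambda>_. borel) (\<lambda>j. log_norm (j * m) m) UNIV" by (rule log_norm_blocks)
  have "l2 P (\<lambda>\<omega>. log_norm a (n + m) \<omega> - log_norm a n \<omega> - log_norm (a + n) m \<omega>) \<le> l2 P (log_ratio_Y (a + n) m)"
    by (rule l2_mono[OF log_ratio_Y_sq _ order_trans[OF log_norm_defect abs_ge_self]])
       (intro sq_int_measurable sq_int_diff log_norm_sq)
  then show "l2 P (\<lambda>\<omega>. log_norm a (n + m) \<omega> - log_norm a n \<omega> - log_norm (a + n) m \<omega>) \<le> ratio_bound"
    using l2_log_ratio_Y_le order_trans by blast
qed

text \<open>The drift is an almost sure limit of \<open>L(0,n)/n\<close>, and a constant with this property is unique because a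
  probability space is not a null set.\<close>

lemma lyapunov_eq_drift: "lyapunov P Y = drift"
proof -
  have lim: "AE \<omega> in P. (\<lambda>n. ln (l1_opnorm (rand_prod Y n \<omega>)) / real n) \<longlonglongrightarrow> drift"
  proof -
    have "AE \<omega> in P. (\<lambda>n. log_norm 0 n \<omega> / real n) \<longlonglongrightarrow> drift"
    proof (rule AE_drift[OF log_size_sq log_size_l2 log_size_nonneg])
      fix k n \<omega> assume \<omega>: "\<omega> \<in> space P" and kn: "(k::nat) \<le> n"
      define m where "m = n - k"
      have n: "n = k + m" using kn by (simp add: m_def)
      note b = ln_l1_opnorm_mult_bounds[OF Yprod_G_set[OF \<omega>] Yprod_G_set[OF \<omega>], of k m 0 k]
      have "Yprod 0 n \<omega> = Yprod k m \<omega> ** Yprod 0 k \<omega>" using Yprod_add[of 0 k m] by (simp add: n)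
      then show "\<bar>log_norm 0 n \<omega> - log_norm 0 k \<omega>\<bar> \<le> (\<Sum>i\<in>{k<..n}. log_size i \<omega>)"
        using b(1,2) ln_Yprod_bounds[OF \<omega>, of k m] by (simp add: log_norm_def n abs_le_iff)
    qed
    then show ?thesis by (simp add: log_norm_def Yprod_def rand_prod_eq_block_prod)
  qed
  show ?thesis
    unfolding lyapunov_def
  proof (rule the_equality)
    show "AE \<omega> in P. (\<lambda>n. ln (l1_opnorm (rand_prod Y n \<omega>)) / real n) \<longlonglongrightarrow> drift"
      by (rule lim)
  next
    fix l' assume "AE \<omega> in P. (\<lambda>n. ln (l1_opnorm (rand_prod Y n \<omega>)) / real n) \<longlonglongrightarrow> l'"
    with lim have "AE \<omega> in P. l' = drift" by eventually_elim (rule LIMSEQ_unique)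
    then show "l' = drift" by (simp add: AE_const)
  qed
qed

end

section \<open>Limit theorems for norm, cocycle and spectral radius\<close>

lemma S_plus_nonempty: "S_plus \<noteq> ({} :: (real^'d) set)"
  using axis_S_plus by blast

lemma space_S_borel: "space S_borel = S_plus"
  by (simp add: S_borel_def space_measure_of_conv)

theorem proposition5p3:
  fixes \<mu> :: "(real^'d^'d) measure" and \<nu> :: "(real^'d) measure"
    and P :: "'w measure" and Y :: "nat \<Rightarrow> 'w \<Rightarrow> real^'d^'d" and W\<^sub>0 :: "'w \<Rightarrow> real^'d"
    and l s :: real and A :: "nat \<Rightarrow> 'w \<Rightarrow> real^'d^'d"
  assumes dim: "CARD('d) \<ge> 2"
    and mu: "prob_space \<mu>" "sets \<mu> = sets G_borel"
    and contracting: "strictly_contracting \<mu>"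
    and moment: "has_moment 2 \<mu>"
    and nu: "invariant_prob \<mu> \<nu>"
    and P: "prob_space P"
    and Y: "iid_seq P \<mu> Y"
    and W0: "W\<^sub>0 \<in> P \<rightarrow>\<^sub>M S_borel" "distr P S_borel W\<^sub>0 = \<nu>" "indep_of_seq P W\<^sub>0 Y"
    and A: "A = rand_prod Y"
    and l: "l = lyapunov P Y"
    and s: "s = sqrt (enn2real (lim (\<lambda>n.
           second_moment P (\<lambda>\<omega>. cocycle (A n \<omega>) (W\<^sub>0 \<omega>) - real n * l) / of_nat n)))"
  shows
    "((\<lambda>n. second_moment P (\<lambda>\<omega>. cocycle (A n \<omega>) (W\<^sub>0 \<omega>) - real n * l) / of_nat n)
       \<longlonglongrightarrow> ennreal (s\<^sup>2)) \<and>
     ((\<lambda>n. (SUP x\<in>S_plus. second_moment P (\<lambda>\<omega>. cocycle (A n \<omega>) x - real n * l)) / of_nat n)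
       \<longlonglongrightarrow> ennreal (s\<^sup>2)) \<and>
     ((\<lambda>n. second_moment P (\<lambda>\<omega>. ln (l1_opnorm (A n \<omega>)) - real n * l) / of_nat n)
       \<longlonglongrightarrow> ennreal (s\<^sup>2)) \<and>
     ((\<lambda>n. second_moment P (\<lambda>\<omega>. ln (v_min (A n \<omega>)) - real n * l) / of_nat n)
       \<longlonglongrightarrow> ennreal (s\<^sup>2)) \<and>
     ((\<lambda>n. second_moment P (\<lambda>\<omega>. ln (spec_rad (A n \<omega>)) - real n * l) / of_nat n)
       \<longlonglongrightarrow> ennreal (s\<^sup>2)) \<and>
     (\<forall>x\<in>S_plus. clt_holds P l s (\<lambda>n \<omega>. cocycle (A n \<omega>) x)) \<and>
     (clt_holds P l s (\<lambda>n \<omega>. ln (l1_opnorm (A n \<omega>)))) \<and>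
     (clt_holds P l s (\<lambda>n \<omega>. ln (v_min (A n \<omega>)))) \<and>
     (clt_holds P l s (\<lambda>n \<omega>. ln (spec_rad (A n \<omega>)))) \<and>
     (0 < s \<longrightarrow> (\<lambda>n. SUP x\<in>S_plus. SUP t.
         \<bar>measure P {\<omega> \<in> space P. cocycle (A n \<omega>) x - real n * l \<le> t * sqrt (real n)}
           - cdf std_normal_distribution (t / s)\<bar>) \<longlonglongrightarrow> 0)"
proof -
  interpret contracting_products P \<mu> Y
    by (intro contracting_products.intro contracting_products_axioms.intro P Y contracting moment)
  have A_eq: "A n \<omega> = Yprod 0 n \<omega>" for n \<omega>
    by (simp add: A rand_prod_eq_block_prod Yprod_def)
  have l_eq: "l = drift" by (simp add: l lyapunov_eq_drift)
  have A_G: "A n \<omega> \<in> G_set" if "\<omega> \<in> space P" for n \<omega>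
    unfolding A_eq by (rule Yprod_G_set[OF that])
  have A_meas [measurable]: "A n \<in> P \<rightarrow>\<^sub>M G_borel" for n
    using Yprod_measurable[of 0 n] by (simp add: A_eq[abs_def])

  have between: "\<bar>z - log_norm 0 n \<omega>\<bar> \<le> log_ratio_Y 0 n \<omega>"
    if "ln (v_min (A n \<omega>)) \<le> z" "z \<le> ln (l1_opnorm (A n \<omega>))" for z n \<omega>
    using that by (simp add: log_norm_def log_ratio_Y_def log_ratio_def A_eq)
  have norm_between: "ln (v_min (A n \<omega>)) \<le> ln (l1_opnorm (A n \<omega>))" if "\<omega> \<in> space P" for n \<omega>
    unfolding A_eq by (rule ln_Yprod_order[OF that])
  have cocycle_between: "ln (v_min (A n \<omega>)) \<le> cocycle (A n \<omega>) x"
    "cocycle (A n \<omega>) x \<le> ln (l1_opnorm (A n \<omega>))" if "\<omega> \<in> space P" "x \<in> S_plus" for n \<omega> x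
    using S_plus_orbit_bounds[OF A_G[OF that(1)] that(2), of n] v_min_pos[OF A_G[OF that(1), of n]]
    unfolding cocycle_def by (auto intro!: ln_mono)
  have spec_between: "ln (v_min (A n \<omega>)) \<le> ln (spec_rad (A n \<omega>))"
    "ln (spec_rad (A n \<omega>)) \<le> ln (l1_opnorm (A n \<omega>))" if "\<omega> \<in> space P" for n \<omega>
    using spec_rad_bounds[OF A_G[OF that], of n] v_min_pos[OF A_G[OF that, of n]]
    by (auto intro!: ln_mono)
  have W0_S: "W\<^sub>0 \<omega> \<in> S_plus" if "\<omega> \<in> space P" for \<omega>
    using measurable_space[OF W0(1) that] by (simp add: space_S_borel)

  have sm_bounds: "ennreal ((max 0 (deviation n - ratio_bound))\<^sup>2) \<le> second_moment P (\<lambda>\<omega>. Z \<omega> - real n * l)"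
    "second_moment P (\<lambda>\<omega>. Z \<omega> - real n * l) \<le> ennreal ((deviation n + ratio_bound)\<^sup>2)"
    if lo: "\<And>\<omega>. \<omega> \<in> space P \<Longrightarrow> ln (v_min (A n \<omega>)) \<le> Z \<omega>"
      and up: "\<And>\<omega>. \<omega> \<in> space P \<Longrightarrow> Z \<omega> \<le> ln (l1_opnorm (A n \<omega>))" for Z n
  proof -
    have "\<bar>(Z \<omega> - real n * l) - (log_norm 0 n \<omega> - real n * drift)\<bar> \<le> log_ratio_Y 0 n \<omega>"
      if "\<omega> \<in> space P" for \<omega>
      using between[OF lo[OF that] up[OF that]] by (simp add: l_eq)
    note * = second_moment_perturbation[OF sq_int_diff[OF log_norm_sq sq_int_const] log_ratio_Y_sq
        l2_log_ratio_Y_le this]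
    show "ennreal ((max 0 (deviation n - ratio_bound))\<^sup>2) \<le> second_moment P (\<lambda>\<omega>. Z \<omega> - real n * l)"
      using *(1) by (simp add: deviation_def)
    show "second_moment P (\<lambda>\<omega>. Z \<omega> - real n * l) \<le> ennreal ((deviation n + ratio_bound)\<^sup>2)"
      using *(2) by (simp add: deviation_def)
  qed
  have sm: "(\<lambda>n. second_moment P (\<lambda>\<omega>. Z n \<omega> - real n * l) / of_nat n) \<longlonglongrightarrow> ennreal (limit_std_dev\<^sup>2)"
    if "\<And>n \<omega>. \<omega> \<in> space P \<Longrightarrow> ln (v_min (A n \<omega>)) \<le> Z n \<omega>"
       "\<And>n \<omega>. \<omega> \<in> space P \<Longrightarrow> Z n \<omega> \<le> ln (l1_opnorm (A n \<omega>))" for Z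
    by (rule second_moment_limit[where C = ratio_bound]) (intro sm_bounds that; assumption)+
  have clt: "clt_holds P l limit_std_dev Z"
    if "\<And>n. Z n \<in> borel_measurable P"
      "\<And>n \<omega>. \<omega> \<in> space P \<Longrightarrow> ln (v_min (A n \<omega>)) \<le> Z n \<omega>"
      "\<And>n \<omega>. \<omega> \<in> space P \<Longrightarrow> Z n \<omega> \<le> ln (l1_opnorm (A n \<omega>))" for Z
    unfolding l_eq
    by (rule clt_perturbation[OF that(1) log_ratio_Y_sq l2_log_ratio_Y_le between[OF that(2,3)]])

  have sm_W0: "(\<lambda>n. second_moment P (\<lambda>\<omega>. cocycle (A n \<omega>) (W\<^sub>0 \<omega>) - real n * l) / of_nat n)
      \<longlonglongrightarrow> ennreal (limit_std_dev\<^sup>2)"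
    by (rule sm) (intro cocycle_between W0_S; assumption)+
  have s_eq: "s = limit_std_dev"
    unfolding s limI[OF sm_W0] using limit_std_dev_nonneg by simp

  have sm_sup: "(\<lambda>n. (SUP x\<in>S_plus. second_moment P (\<lambda>\<omega>. cocycle (A n \<omega>) x - real n * l)) / of_nat n)
      \<longlonglongrightarrow> ennreal (limit_std_dev\<^sup>2)"
  proof (rule second_moment_limit[where C = ratio_bound])
    fix n
    obtain x where x: "x \<in> (S_plus :: (real^'d) set)" using S_plus_nonempty by blast
    have "ennreal ((max 0 (deviation n - ratio_bound))\<^sup>2) \<le> second_moment P (\<lambda>\<omega>. cocycle (A n \<omega>) x - real n * l)"
      by (intro sm_bounds cocycle_between x)
    also have "\<dots> \<le> (SUP x\<in>S_plus. second_moment P (\<lambda>\<omega>. cocycle (A n \<omega>) x - real n * l))"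
      by (rule SUP_upper[OF x])
    finally show "ennreal ((max 0 (deviation n - ratio_bound))\<^sup>2) \<le> \<dots>" .
    show "(SUP x\<in>S_plus. second_moment P (\<lambda>\<omega>. cocycle (A n \<omega>) x - real n * l))
        \<le> ennreal ((deviation n + ratio_bound)\<^sup>2)"
      by (intro SUP_least sm_bounds cocycle_between)
  qed

  have norm_meas: "(\<lambda>\<omega>. ln (l1_opnorm (A n \<omega>))) \<in> borel_measurable P" for n by measurable
  have v_meas: "(\<lambda>\<omega>. ln (v_min (A n \<omega>))) \<in> borel_measurable P" for n by measurable
  have clt_norm: "clt_holds P l s (\<lambda>n \<omega>. ln (l1_opnorm (A n \<omega>)))"
    unfolding s_eq by (rule clt) (auto intro: norm_between)
  have clt_v: "clt_holds P l s (\<lambda>n \<omega>. ln (v_min (A n \<omega>)))"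
    unfolding s_eq by (rule clt) (auto intro: norm_between)

  have uniform: "(\<lambda>n. SUP x\<in>S_plus. SUP t.
         \<bar>measure P {\<omega> \<in> space P. cocycle (A n \<omega>) x - real n * l \<le> t * sqrt (real n)}
           - cdf std_normal_distribution (t / s)\<bar>) \<longlonglongrightarrow> 0" if s0: "0 < s"
  proof (rule LIMSEQ_I)
    fix e :: real assume e: "0 < e"
    define p where "p n x t = measure P {\<omega> \<in> space P. cocycle (A n \<omega>) x - real n * l \<le> t * sqrt (real n)}" for n x t
    define \<Phi> where "\<Phi> t = cdf std_normal_distribution (t / s)" for t
    have e4: "0 < e / 4" using e by simp
    have "\<forall>\<^sub>F n in sequentially. \<forall>x\<in>S_plus. \<forall>t. \<bar>p n x t - \<Phi> t\<bar> \<le> e / 2"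
      using clt_holds_uniform[OF clt_norm norm_meas s0 e4] clt_holds_uniform[OF clt_v v_meas s0 e4]
    proof eventually_elim
      case (elim n)
      show ?case
      proof (intro ballI allI)
        fix x :: "real^'d" and t assume x: "x \<in> S_plus"
        have "measure P {\<omega> \<in> space P. ln (l1_opnorm (A n \<omega>)) - real n * l \<le> t * sqrt (real n)} \<le> p n x t"
          unfolding p_def using cocycle_between(2)[OF _ x, of _ n] by (intro finite_measure_mono) force+
        moreover have "p n x t \<le> measure P {\<omega> \<in> space P. ln (v_min (A n \<omega>)) - real n * l \<le> t * sqrt (real n)}"
          unfolding p_def using cocycle_between(1)[OF _ x, of _ n] by (intro finite_measure_mono) force+
        ultimately show "\<bar>p n x t - \<Phi> t\<bar> \<le> e / 2"
          using elim[rule_format, of t] unfolding \<Phi>_def by linarith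
      qed
    qed
    then obtain no where no: "\<And>n x t. no \<le> n \<Longrightarrow> x \<in> S_plus \<Longrightarrow> \<bar>p n x t - \<Phi> t\<bar> \<le> e / 2"
      by (auto simp: eventually_sequentially)
    have "norm ((SUP x\<in>S_plus. SUP t. \<bar>p n x t - \<Phi> t\<bar>) - 0) < e" if n: "no \<le> n" for n
    proof -
      have inner: "(SUP t. \<bar>p n x t - \<Phi> t\<bar>) \<le> e / 2" if "x \<in> S_plus" for x
        by (rule cSUP_least) (use no[OF n that] in auto)
      then have upper: "(SUP x\<in>S_plus. SUP t. \<bar>p n x t - \<Phi> t\<bar>) \<le> e / 2"
        by (rule cSUP_least[OF S_plus_nonempty])
      obtain x where x: "x \<in> (S_plus :: (real^'d) set)" using S_plus_nonempty by blast
      have "0 \<le> \<bar>p n x 0 - \<Phi> 0\<bar>" by simp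
      also have "\<dots> \<le> (SUP t. \<bar>p n x t - \<Phi> t\<bar>)"
        by (rule cSUP_upper) (use no[OF n x] in \<open>auto intro!: bdd_aboveI2[where M = "e / 2"]\<close>)
      also have "\<dots> \<le> (SUP x\<in>S_plus. SUP t. \<bar>p n x t - \<Phi> t\<bar>)"
        by (rule cSUP_upper[OF x]) (use inner in \<open>auto intro!: bdd_aboveI2[where M = "e / 2"]\<close>)
      finally show ?thesis using upper e by simp
    qed
    then show "\<exists>no. \<forall>n\<ge>no. norm ((SUP x\<in>S_plus. SUP t.
        \<bar>measure P {\<omega> \<in> space P. cocycle (A n \<omega>) x - real n * l \<le> t * sqrt (real n)}
          - cdf std_normal_distribution (t / s)\<bar>) - 0) < e"
      unfolding p_def \<Phi>_def by blast
  qed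
  show ?thesis
    using sm_W0 sm_sup clt_norm clt_v uniform
    by (auto simp: s_eq intro!: sm clt norm_between cocycle_between spec_between)
qed

end
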